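(* Let $\mathbb F$ be a nonabelian free group of finite rank. Then $\hat f'_{\mathbb F}(1)\ge 2$, and for all positive integers $m,n$, $$\hat f'_{\mathbb F}(m+n)\ \ge\ \hat f'_{\mathbb F}(m)\,\hat f'_{\mathbb F}(n).$$
   Context: Commutators are $[a,b]=aba^{-1}b^{-1}$. For an integer $g\ge0$, let $H_g=\langle a_1,b_1,\dots,a_g,b_g\rangle$ be the free group of rank $2g$ on the indicated basis (trivial if $g=0$), and let $\partial_g=[a_1,b_1]\cdots[a_g,b_g]\in H_g$. For $x\in\mathbb F$, a genus $g$ representation of $x$ is a homomorphism $h:H_g\to\mathbb F$ with $h(\partial_g)=x$. For $x\in[\mathbb F,\mathbb F]$, the algebraic genus of $x$, written $\mathrm{a\text{-}genus}(x)$, is the smallest $g\ge0$ such that $x$ has a genus $g$ representation. A genus $g$ representation of $x$ is minimal if $g=\mathrm{a\text{-}genus}(x)$. A subgroup $S\le G$ is primitive if $t\in G$, $n\ge1$, $t^n\in S$ imply $t\in S$. A genus $g$ representation $h$ is admissible if $h$ is injective and its image $h(H_g)$ is a primitive subgroup of $\mathbb F$. For $x\in[\mathbb F,\mathbb F]$, let $\mathrm{num}'(x)$ be the number of distinct subgroups of $\mathbb F$ that are images of minimal admissible representations of $x$. Finally, $\hat f'_{\mathbb F}(g)=\sup\{\mathrm{num}'(x)\mid x\in[\mathbb F,\mathbb F],\ \mathrm{a\text{-}genus}(x)=g\}$. *)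

theory Defs
  imports "HOL-Algebra.Generated_Groups" "HOL-Library.Extended_Nat"
begin

section \<open>Free groups as groups of reduced words\<close>

text \<open>A letter is a generator together with a sign: \<open>(x, False)\<close> stands for \<open>x\<close> and
  \<open>(x, True)\<close> for its inverse.\<close>

type_synonym 'x letter = "'x \<times> bool"

definition letter_inv :: "'x letter \<Rightarrow> 'x letter" where
  "letter_inv l = (fst l, \<not> snd l)"

definition reduced :: "'x letter list \<Rightarrow> bool" where
  "reduced = successively (\<lambda>l m. m \<noteq> letter_inv l)"

fun cancel_cons :: "'x letter \<Rightarrow> 'x letter list \<Rightarrow> 'x letter list" where
  "cancel_cons l [] = [l]"
| "cancel_cons l (m # w) = (if m = letter_inv l then w else l # m # w)"

text \<open>The product of two reduced words is the reduced form of their concatenation, obtained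
  by prepending the letters of the first word one at a time, cancelling where possible.\<close>

definition free_group :: "'x set \<Rightarrow> 'x letter list monoid" where
  "free_group S = \<lparr>carrier = {w. reduced w \<and> fst ` set w \<subseteq> S},
                   monoid.mult = foldr cancel_cons,
                   one = []\<rparr>"

definition free_gen :: "'x \<Rightarrow> 'x letter list" where
  "free_gen x = [(x, False)]"

lemma letter_inv_inv [simp]: "letter_inv (letter_inv l) = l"
  by (simp add: letter_inv_def)

lemma fst_letter_inv [simp]: "fst (letter_inv l) = fst l"
  by (simp add: letter_inv_def)

lemma reduced_Nil [simp]: "reduced []"
  by (simp add: reduced_def)

lemma reduced_Cons: "reduced (l # w) \<longleftrightarrow> reduced w \<and> (w \<noteq> [] \<longrightarrow> hd w \<noteq> letter_inv l)"
  by (cases w) (auto simp: reduced_def)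

lemma reduced_cancel_cons: "reduced w \<Longrightarrow> reduced (cancel_cons l w)"
  by (cases w) (auto simp: reduced_Cons)

lemma set_cancel_cons: "set (cancel_cons l w) \<subseteq> insert l (set w)"
  by (cases w) auto

lemma cancel_cons_reduced: "reduced (l # w) \<Longrightarrow> cancel_cons l w = l # w"
  by (cases w) (auto simp: reduced_Cons)

lemma cancel_cons_letter_inv: "reduced w \<Longrightarrow> cancel_cons (letter_inv l) (cancel_cons l w) = w"
  by (cases w) (auto simp: reduced_Cons neq_Nil_conv split: list.splits intro: cancel_cons_reduced)

lemma reduced_foldr: "reduced v \<Longrightarrow> reduced (foldr cancel_cons u v)"
  by (induction u) (auto intro: reduced_cancel_cons)

lemma set_foldr_cancel_cons: "set (foldr cancel_cons u v) \<subseteq> set u \<union> set v"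
proof (induction u)
  case (Cons l u)
  then show ?case using set_cancel_cons[of l "foldr cancel_cons u v"] by auto
qed simp

lemma foldr_cancel_cons_Nil: "reduced w \<Longrightarrow> foldr cancel_cons w [] = w"
proof (induction w)
  case (Cons l w)
  then show ?case by (simp add: cancel_cons_reduced reduced_Cons[of l w])
qed simp

lemma foldr_cancel_cons:
  assumes "reduced w"
  shows "foldr cancel_cons (cancel_cons l u) w = cancel_cons l (foldr cancel_cons u w)"
proof (cases u)
  case (Cons m u')
  then show ?thesis
    using cancel_cons_letter_inv[OF reduced_foldr[OF assms, of u'], of "letter_inv l"] by auto
qed simp

lemma foldr_cancel_cons_assoc:
  assumes "reduced w"
  shows "foldr cancel_cons (foldr cancel_cons u v) w = foldr cancel_cons u (foldr cancel_cons v w)"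
  by (induction u) (simp_all add: foldr_cancel_cons assms)

lemma foldr_cancel_cons_inverse:
  "reduced v \<Longrightarrow> foldr cancel_cons (rev (map letter_inv u)) (foldr cancel_cons u v) = v"
  by (induction u arbitrary: v) (simp_all add: cancel_cons_letter_inv reduced_foldr)

lemma group_free_group: "group (free_group S)"
proof (rule groupI)
  fix u v assume uv: "u \<in> carrier (free_group S)" "v \<in> carrier (free_group S)"
  then show "u \<otimes>\<^bsub>free_group S\<^esub> v \<in> carrier (free_group S)"
    using set_foldr_cancel_cons[of u v] by (fastforce simp: free_group_def reduced_foldr)
next
  fix u assume u: "u \<in> carrier (free_group S)"
  define v where "v = foldr cancel_cons (rev (map letter_inv u)) []"
  have "fst ` set v \<subseteq> S"
    using u image_mono[OF set_foldr_cancel_cons[of "rev (map letter_inv u)" "[]"], of fst]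
    by (auto simp: free_group_def v_def image_image)
  then have v: "v \<in> carrier (free_group S)"
    by (simp add: free_group_def v_def reduced_foldr)
  have "foldr cancel_cons v u = []"
    using u foldr_cancel_cons_inverse[of "[]" u]
    by (simp add: free_group_def v_def foldr_cancel_cons_assoc foldr_cancel_cons_Nil)
  then show "\<exists>v\<in>carrier (free_group S). v \<otimes>\<^bsub>free_group S\<^esub> u = \<one>\<^bsub>free_group S\<^esub>"
    using v by (auto simp: free_group_def)
qed (auto simp: free_group_def foldr_cancel_cons_assoc)

lemma free_gen_carrier: "x \<in> S \<Longrightarrow> free_gen x \<in> carrier (free_group S)"
  by (simp add: free_group_def free_gen_def reduced_Cons)

definition eval_letter :: "('a, 'b) monoid_scheme \<Rightarrow> ('x \<Rightarrow> 'a) \<Rightarrow> 'x letter \<Rightarrow> 'a" where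
  "eval_letter G f l = (if snd l then inv\<^bsub>G\<^esub> f (fst l) else f (fst l))"

definition eval_word :: "('a, 'b) monoid_scheme \<Rightarrow> ('x \<Rightarrow> 'a) \<Rightarrow> 'x letter list \<Rightarrow> 'a" where
  "eval_word G f w = foldr (\<lambda>l z. eval_letter G f l \<otimes>\<^bsub>G\<^esub> z) w \<one>\<^bsub>G\<^esub>"

text \<open>The universal property: existence and uniqueness of the homomorphic extension.\<close>

lemma free_group_extend:
  fixes G (structure)
  assumes "group G" and f: "f \<in> S \<rightarrow> carrier G"
  shows "eval_word G f \<in> hom (free_group S) G"
    and "x \<in> S \<Longrightarrow> eval_word G f (free_gen x) = f x"
proof -
  interpret group G by fact
  have lc: "eval_letter G f l \<in> carrier G" if "fst l \<in> S" for l
    using f that by (auto simp: eval_letter_def)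
  have wc: "eval_word G f w \<in> carrier G" if "fst ` set w \<subseteq> S" for w
    using that by (induction w) (auto simp: eval_word_def lc)
  have li: "eval_letter G f (letter_inv l) = inv (eval_letter G f l)" if "fst l \<in> S" for l
    using funcset_mem[OF f that] by (simp add: eval_letter_def letter_inv_def)
  have cc: "eval_word G f (cancel_cons l w) = eval_letter G f l \<otimes> eval_word G f w"
    if "fst l \<in> S" "fst ` set w \<subseteq> S" for l w
  proof (cases w)
    case Nil
    then show ?thesis by (simp add: eval_word_def)
  next
    case (Cons m w')
    then show ?thesis
      using that wc[of w'] lc[of l] li[of l] by (auto simp: eval_word_def m_assoc[symmetric])
  qed
  have mult: "eval_word G f (foldr cancel_cons u v) = eval_word G f u \<otimes> eval_word G f v"
    if "fst ` set u \<subseteq> S" "fst ` set v \<subseteq> S" for u v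
    using that(1)
  proof (induction u)
    case Nil
    then show ?case using wc[OF that(2)] by (simp add: eval_word_def)
  next
    case (Cons l u)
    have "fst ` set (foldr cancel_cons u v) \<subseteq> S"
      using Cons.prems that(2) set_foldr_cancel_cons[of u v] by fastforce
    moreover have "eval_word G f (l # u) = eval_letter G f l \<otimes> eval_word G f u"
      by (simp add: eval_word_def)
    ultimately show ?case
      using Cons wc[of u] wc[OF that(2)] lc[of l] by (simp add: cc m_assoc)
  qed
  show "eval_word G f \<in> hom (free_group S) G"
    by (auto simp: hom_def free_group_def wc mult)
  show "eval_word G f (free_gen x) = f x" if "x \<in> S"
    using funcset_mem[OF f that] by (simp add: eval_word_def free_gen_def eval_letter_def)
qed

lemma free_group_extend_unique:
  assumes "group G" and h: "h \<in> hom (free_group S) G" and k: "k \<in> hom (free_group S) G"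
    and eq: "\<And>x. x \<in> S \<Longrightarrow> h (free_gen x) = k (free_gen x)"
    and w: "w \<in> carrier (free_group S)"
  shows "h w = k w"
proof -
  interpret F: group "free_group S" by (rule group_free_group)
  interpret h: group_hom "free_group S" G h
    using assms by (simp add: group_hom_def group_hom_axioms_def group_free_group)
  interpret k: group_hom "free_group S" G k
    using assms by (simp add: group_hom_def group_hom_axioms_def group_free_group)
  have letter: "h [l] = k [l]" if "fst l \<in> S" for l
  proof (cases "snd l")
    case False
    then have "[l] = free_gen (fst l)" by (cases l) (simp add: free_gen_def)
    then show ?thesis using eq that by simp
  next
    case True
    have "[l] \<otimes>\<^bsub>free_group S\<^esub> free_gen (fst l) = \<one>\<^bsub>free_group S\<^esub>"
      using True by (cases l) (simp add: free_group_def free_gen_def letter_inv_def)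
    moreover have "[l] \<in> carrier (free_group S)"
      using that by (simp add: free_group_def reduced_Cons)
    ultimately have "[l] = inv\<^bsub>free_group S\<^esub> free_gen (fst l)"
      using free_gen_carrier[OF that] by (simp add: F.inv_equality)
    then show ?thesis using eq[OF that] free_gen_carrier[OF that] by simp
  qed
  show ?thesis using w
  proof (induction w)
    case Nil
    then show ?case using h.hom_one k.hom_one by (simp add: free_group_def)
  next
    case (Cons l w)
    have l: "[l] \<in> carrier (free_group S)" "fst l \<in> S" and w: "w \<in> carrier (free_group S)"
      using Cons.prems by (auto simp: free_group_def reduced_Cons)
    have "l # w = [l] \<otimes>\<^bsub>free_group S\<^esub> w"
      using Cons.prems by (simp add: free_group_def cancel_cons_reduced)
    then show ?case using h.hom_mult[OF l(1) w] k.hom_mult[OF l(1) w] letter[OF l(2)] Cons.IH[OF w]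
      by simp
  qed
qed


section \<open>Genus representations\<close>

definition commutator :: "('a, 'b) monoid_scheme \<Rightarrow> 'a \<Rightarrow> 'a \<Rightarrow> 'a" where
  "commutator G a b = a \<otimes>\<^bsub>G\<^esub> b \<otimes>\<^bsub>G\<^esub> inv\<^bsub>G\<^esub> a \<otimes>\<^bsub>G\<^esub> inv\<^bsub>G\<^esub> b"

datatype surface_gen = SA nat | SB nat

definition surface_group :: "nat \<Rightarrow> surface_gen letter list monoid" where
  "surface_group g = free_group (SA ` {1..g} \<union> SB ` {1..g})"

definition surface_boundary :: "nat \<Rightarrow> surface_gen letter list" where
  "surface_boundary g =
     foldr (\<lambda>i z. commutator (surface_group g) (free_gen (SA i)) (free_gen (SB i))
                    \<otimes>\<^bsub>surface_group g\<^esub> z)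
       [1..<Suc g] \<one>\<^bsub>surface_group g\<^esub>"

definition genus_rep ::
    "('a, 'b) monoid_scheme \<Rightarrow> nat \<Rightarrow> 'a \<Rightarrow> (surface_gen letter list \<Rightarrow> 'a) \<Rightarrow> bool" where
  "genus_rep F g x h \<longleftrightarrow> h \<in> hom (surface_group g) F \<and> h (surface_boundary g) = x"

text \<open>Only meaningful for \<open>x\<close> in the commutator subgroup, where a representation exists.\<close>

definition a_genus :: "('a, 'b) monoid_scheme \<Rightarrow> 'a \<Rightarrow> nat" where
  "a_genus F x = (LEAST g. \<exists>h. genus_rep F g x h)"

definition minimal_rep ::
    "('a, 'b) monoid_scheme \<Rightarrow> nat \<Rightarrow> 'a \<Rightarrow> (surface_gen letter list \<Rightarrow> 'a) \<Rightarrow> bool" where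
  "minimal_rep F g x h \<longleftrightarrow> genus_rep F g x h \<and> g = a_genus F x"

definition primitive_subgroup :: "('a, 'b) monoid_scheme \<Rightarrow> 'a set \<Rightarrow> bool" where
  "primitive_subgroup G S \<longleftrightarrow>
     subgroup S G \<and> (\<forall>t\<in>carrier G. \<forall>n::nat. n \<ge> 1 \<longrightarrow> t [^]\<^bsub>G\<^esub> n \<in> S \<longrightarrow> t \<in> S)"

definition admissible_rep ::
    "('a, 'b) monoid_scheme \<Rightarrow> nat \<Rightarrow> 'a \<Rightarrow> (surface_gen letter list \<Rightarrow> 'a) \<Rightarrow> bool" where
  "admissible_rep F g x h \<longleftrightarrow>
     genus_rep F g x h \<and> inj_on h (carrier (surface_group g)) \<and>
     primitive_subgroup F (h ` carrier (surface_group g))"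

text \<open>Cardinality with value \<open>\<infinity>\<close> on infinite sets, unlike \<open>card\<close>.\<close>

definition ecard :: "'a set \<Rightarrow> enat" where
  "ecard A = (if finite A then enat (card A) else \<infinity>)"

definition num' :: "('a, 'b) monoid_scheme \<Rightarrow> 'a \<Rightarrow> enat" where
  "num' F x = ecard {h ` carrier (surface_group g) | g h.
                       minimal_rep F g x h \<and> admissible_rep F g x h}"

definition f_hat' :: "('a, 'b) monoid_scheme \<Rightarrow> nat \<Rightarrow> enat" where
  "f_hat' F g = (SUP x \<in> {x \<in> derived F (carrier F). a_genus F x = g}. num' F x)"

end

theory Submission
  imports Defs
begin

text \<open>
  A product of \<open>g\<close> commutators in a free group is the image of a quadratic word, i.e. of the boundary
  word of a polygon whose sides are glued in pairs to a surface of genus at most \<open>g\<close>. Killing the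
  letters outside a set of pairs of sides shows that the genus does not increase when the gluing is
  restricted to that set.

  Splitting off handles together with the rank of the intersection form gives additivity of the genus
  over \<open>F * F\<close>. If \<open>A\<close> and \<open>B\<close> are images of minimal admissible representations of \<open>x\<close> and \<open>y\<close>, the
  subgroups \<open>A * B\<close> are pairwise distinct images of minimal admissible representations of the product
  \<open>x y\<close> in \<open>F * F\<close>. It remains to embed \<open>F * F\<close> into \<open>F\<close> so that the image is primitive and the genus
  of the given element is preserved. The generators are sent to words in two letters with long lists
  of pairwise distinct gaps. By an Euler characteristic count all but boundedly many gaps are glued
  without a break, hence to an inverse copy of the same gap, and these gaps recover a gluing of the
  original word. Primitivity follows from unique roots and a map to a wreath product.
\<close>

section \<open>Words and free reduction\<close>

text \<open>A free group of finite rank at least two contains a copy of its free square, but never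
  as a retract, since the rank doubles. So the genus may drop under the embedding and the image need
  not be primitive; both have to be arranged by the choice of the embedding. The genus is controlled
  for a single element only: the gap lists are chosen after the element, with more gaps than a
  surface of smaller genus can have bad corners. Surfaces enter through words alone. The
  intersection form mod 2 is the centre coordinate of a Heisenberg group of order 8, so the bound
  for its rank on a product of commutators becomes a statement about homomorphisms. Vertices are
  replaced by classes of corners with equal mod 2 heights; these may be coarser, but the count needs
  only a lower bound for their number, and the radical of the form supplies it.\<close>

abbreviation winv :: "'x letter list \<Rightarrow> 'x letter list" where
  "winv w \<equiv> rev (map letter_inv w)"

definition nf :: "'x letter list \<Rightarrow> 'x letter list" where
  "nf w = foldr cancel_cons w []"

abbreviation FU :: "'x letter list monoid" where
  "FU \<equiv> free_group UNIV"

lemma letter_inv_eq_iff [simp]: "letter_inv l = letter_inv m \<longleftrightarrow> l = m"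
  by (metis letter_inv_inv)

lemma letter_inv_neq [simp]: "letter_inv l \<noteq> l" "l \<noteq> letter_inv l"
  by (auto simp: letter_inv_def prod_eq_iff)

lemma letter_inv_eq: "letter_inv l = m \<longleftrightarrow> l = letter_inv m" by auto

lemma letter_inv_comp [simp]: "letter_inv \<circ> letter_inv = id" by auto

lemma same_fst_letter: "fst l = fst m \<Longrightarrow> l = m \<or> l = letter_inv m"
  by (cases l; cases m) (auto simp: letter_inv_def)

lemma reduced_append:
  "reduced (u @ v) \<longleftrightarrow> reduced u \<and> reduced v \<and> (u \<noteq> [] \<and> v \<noteq> [] \<longrightarrow> hd v \<noteq> letter_inv (last u))"
  by (auto simp: reduced_def successively_append_iff)

lemma reduced_singleton [simp]: "reduced [l]" by (simp add: reduced_def)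

lemma reduced_winv: "reduced w \<Longrightarrow> reduced (winv w)"
  by (induction w) (auto simp: reduced_append reduced_Cons last_rev hd_map letter_inv_eq)

lemma winv_winv [simp]: "winv (winv w) = w" by (simp add: rev_map)

lemma reduced_nf: "reduced (nf w)" by (simp add: nf_def reduced_foldr)

lemma nf_reduced: "reduced w \<Longrightarrow> nf w = w" by (simp add: nf_def foldr_cancel_cons_Nil)

lemma nf_Nil [simp]: "nf [] = []" by (simp add: nf_def)

lemma nf_Cons: "nf (l # w) = cancel_cons l (nf w)" by (simp add: nf_def)

lemma nf_append: "nf (u @ v) = foldr cancel_cons (nf u) (nf v)"
  by (induction u) (simp_all add: nf_def foldr_cancel_cons reduced_foldr)

lemma set_nf: "set (nf w) \<subseteq> set w"
  using set_foldr_cancel_cons[of w "[]"] by (simp add: nf_def)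

lemma foldr_cancel_cons_eq_nf: "reduced v \<Longrightarrow> foldr cancel_cons u v = nf (u @ v)"
  by (simp add: nf_def foldr_cancel_cons_Nil)

lemma free_group_carrier: "w \<in> carrier (free_group S) \<longleftrightarrow> reduced w \<and> fst ` set w \<subseteq> S"
  by (simp add: free_group_def)

lemma free_group_one: "\<one>\<^bsub>free_group S\<^esub> = []" by (simp add: free_group_def)

lemma free_group_mult: "u \<otimes>\<^bsub>free_group S\<^esub> v = foldr cancel_cons u v"
  by (simp add: free_group_def)

lemma free_group_mult_nf: "reduced v \<Longrightarrow> u \<otimes>\<^bsub>free_group S\<^esub> v = nf (u @ v)"
  by (simp add: free_group_mult foldr_cancel_cons_eq_nf)

lemma nf_mult: "nf u \<otimes>\<^bsub>free_group S\<^esub> nf v = nf (u @ v)"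
  by (simp add: free_group_mult nf_append)

lemma nf_carrier: "fst ` set w \<subseteq> S \<Longrightarrow> nf w \<in> carrier (free_group S)"
  using set_nf[of w] by (auto simp: free_group_carrier reduced_nf)

lemma nf_winv: "nf (w @ winv w) = []"
proof (induction w)
  case (Cons l w)
  have "nf ((l # w) @ winv (l # w)) = cancel_cons l (nf ((w @ winv w) @ [letter_inv l]))"
    by (simp add: nf_Cons)
  also have "nf ((w @ winv w) @ [letter_inv l]) = [letter_inv l]"
    by (subst nf_append) (simp only: Cons, simp add: nf_Cons)
  finally have "nf ((l # w) @ winv (l # w)) = cancel_cons l [letter_inv l]" .
  then show ?case by simp
qed simp

lemma free_group_inv:
  assumes "w \<in> carrier (free_group S)"
  shows "inv\<^bsub>free_group S\<^esub> w = winv w"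
proof -
  interpret group "free_group S" by (rule group_free_group)
  have r: "reduced (winv w)" "winv w \<in> carrier (free_group S)"
    using assms by (auto simp: free_group_carrier reduced_winv image_image)
  have "winv w \<otimes>\<^bsub>free_group S\<^esub> w = nf (winv w @ winv (winv w))"
    using assms by (simp add: free_group_carrier free_group_mult_nf)
  also have "\<dots> = \<one>\<^bsub>free_group S\<^esub>" by (simp only: nf_winv free_group_one)
  finally show ?thesis using r assms inv_equality by simp
qed

context
  fixes G (structure) and f
  assumes grp: "group G" and f: "\<And>x. f x \<in> carrier G"
begin

interpretation group G by (rule grp)

lemma eval_letter_closed [simp]: "eval_letter G f l \<in> carrier G"
  using f by (simp add: eval_letter_def)

lemma eval_word_Nil: "eval_word G f [] = \<one>" by (simp add: eval_word_def)

lemma eval_word_Cons: "eval_word G f (l # w) = eval_letter G f l \<otimes> eval_word G f w"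
  by (simp add: eval_word_def)

lemma eval_word_closed [simp]: "eval_word G f w \<in> carrier G"
  by (induction w) (simp_all add: eval_word_Nil eval_word_Cons)

lemma eval_word_append: "eval_word G f (u @ v) = eval_word G f u \<otimes> eval_word G f v"
  by (induction u) (simp_all add: eval_word_Nil eval_word_Cons m_assoc)

lemma eval_letter_inv: "eval_letter G f (letter_inv l) = inv (eval_letter G f l)"
  using f by (simp add: eval_letter_def letter_inv_def)

lemma eval_word_hom: "eval_word G f \<in> hom (free_group S) G"
  using free_group_extend(1)[OF grp, of f S] f by simp

lemma eval_word_gen: "eval_word G f (free_gen x) = f x"
  using f by (simp add: eval_word_def free_gen_def eval_letter_def)

lemma eval_word_cancel_cons: "eval_word G f (cancel_cons l w) = eval_letter G f l \<otimes> eval_word G f w"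
proof (cases w)
  case (Cons m v)
  then show ?thesis by (auto simp: eval_word_Cons eval_letter_inv m_assoc[symmetric])
qed (simp add: eval_word_Cons)

lemma eval_word_nf: "eval_word G f (nf w) = eval_word G f w"
  by (induction w) (simp_all add: nf_Cons eval_word_cancel_cons eval_word_Cons)

end


lemma hom_eval_word:
  assumes "group G" "h \<in> hom (free_group S) G" "w \<in> carrier (free_group S)"
    and "\<And>x. x \<in> S \<Longrightarrow> f x = h (free_gen x)" and f: "\<And>x. f x \<in> carrier G"
  shows "h w = eval_word G f w"
  by (rule free_group_extend_unique[OF assms(1,2) eval_word_hom[OF assms(1) f] _ assms(3)])
     (simp_all add: assms eval_word_gen)

lemma eval_word_cong:
  assumes "\<And>x. x \<in> fst ` set w \<Longrightarrow> f x = g x"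
  shows "eval_word G f w = eval_word G g w"
  using assms by (induction w) (auto simp: eval_word_def eval_letter_def)

lemma eval_word_UNIV_nf: "eval_word FU free_gen w = nf w"
proof (induction w)
  case Nil
  then show ?case by (simp add: eval_word_def free_group_one)
next
  case (Cons l w)
  have "eval_letter FU free_gen l = [l]" by (cases l)
       (auto simp: eval_letter_def free_gen_def free_group_inv free_group_carrier letter_inv_def)
  then show ?case using Cons by (simp add: eval_word_def free_group_mult nf_Cons)
qed

section \<open>Products of commutators\<close>

inductive is_cp :: "('a, 'b) monoid_scheme \<Rightarrow> nat \<Rightarrow> 'a \<Rightarrow> bool" for G where
  zero: "is_cp G 0 \<one>\<^bsub>G\<^esub>"
| Suc: "a \<in> carrier G \<Longrightarrow> b \<in> carrier G \<Longrightarrow> is_cp G n x \<Longrightarrow>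
    is_cp G (Suc n) (commutator G a b \<otimes>\<^bsub>G\<^esub> x)"

lemma (in group) commutator_closed [simp]:
  "a \<in> carrier G \<Longrightarrow> b \<in> carrier G \<Longrightarrow> commutator G a b \<in> carrier G"
  by (simp add: commutator_def)

lemma (in group) is_cp_closed: "is_cp G n x \<Longrightarrow> x \<in> carrier G"
  by (induction rule: is_cp.induct) auto

lemma (in group) is_cp_mult:
  assumes "is_cp G m x" "is_cp G n y"
  shows "is_cp G (m + n) (x \<otimes> y)" using assms(1)
proof (induction rule: is_cp.induct)
  case zero
  then show ?case using assms(2) is_cp_closed[OF assms(2)] by simp
next
  case (Suc a b n x)
  then show ?case
    using is_cp.Suc[OF Suc.hyps(1,2) Suc.IH] is_cp_closed[OF assms(2)] is_cp_closed[OF Suc.hyps(3)]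
    by (simp add: m_assoc)
qed

lemma hom_commutator:
  assumes "group G" "group K" "h \<in> hom G K" "a \<in> carrier G" "b \<in> carrier G"
  shows "h (commutator G a b) = commutator K (h a) (h b)"
proof -
  interpret group_hom G K h using assms by (simp add: group_hom_def group_hom_axioms_def)
  show ?thesis using assms(4,5) by (simp add: commutator_def)
qed

lemma is_cp_hom:
  assumes "group G" "group K" "h \<in> hom G K" "is_cp G n x"
  shows "is_cp K n (h x)"
proof -
  interpret group_hom G K h using assms by (simp add: group_hom_def group_hom_axioms_def)
  show ?thesis using assms(4)
  proof (induction rule: is_cp.induct)
    case zero
    then show ?case by (simp add: is_cp.zero)
  next
    case (Suc a b n x)
    then show ?case using is_cp.Suc[of "h a" K "h b" n "h x"] G.is_cp_closed[OF Suc.hyps(3)]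
      by (simp add: hom_commutator[OF assms(1-3)])
  qed
qed

lemma (in group) is_cp_conj:
  assumes "is_cp G n x" "g \<in> carrier G"
  shows "is_cp G n (g \<otimes> x \<otimes> inv g)"
proof -
  have c: "(\<lambda>x. g \<otimes> x \<otimes> inv g) \<in> hom G G"
    using assms(2) by (auto simp: hom_def m_assoc inv_solve_left)
  show ?thesis using is_cp_hom[OF is_group is_group c assms(1)] .
qed

lemma is_cp_free_group_mono:
  assumes "is_cp (free_group S) n x" "S \<subseteq> S'"
  shows "is_cp (free_group S') n x"
proof -
  have "id \<in> hom (free_group S) (free_group S')"
    using assms(2) by (fastforce simp: hom_def free_group_mult free_group_carrier)
  from is_cp_hom[OF group_free_group group_free_group this assms(1)] show ?thesis by simp
qed

text \<open>Killing the generators outside \<open>S\<close> retracts onto the smaller free group, so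
  the genus does not depend on the ambient alphabet.\<close>

lemma is_cp_free_group_restrict:
  assumes "is_cp (free_group S') n x" "x \<in> carrier (free_group S)"
  shows "is_cp (free_group S) n x"
proof -
  define f where "f y = (if y \<in> S then free_gen y else [])" for y
  have f: "f y \<in> carrier (free_group S)" for y
    using free_gen_carrier[of y S] by (simp add: f_def free_group_carrier)
  have h: "eval_word (free_group S) f \<in> hom (free_group S') (free_group S)"
    by (rule eval_word_hom[OF group_free_group f])
  have "id x = eval_word (free_group S) f x"
    by (rule hom_eval_word[OF group_free_group _ assms(2) _ f])
       (auto simp: f_def hom_def free_group_mult free_group_carrier)
  with is_cp_hom[OF group_free_group group_free_group h assms(1)] show ?thesis by simp
qed

section \<open>Quadratic words\<close>

text \<open>Every generator present occurs exactly once with each sign, so the glued surface is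
  oriented.\<close>

definition quadratic :: "'e letter list \<Rightarrow> bool" where
  "quadratic W \<longleftrightarrow> distinct W \<and> letter_inv ` set W \<subseteq> set W"

definition lab :: "('e \<Rightarrow> 'x letter) \<Rightarrow> 'e letter \<Rightarrow> 'x letter" where
  "lab f l = (if snd l then letter_inv (f (fst l)) else f (fst l))"

text \<open>The labelling is letter by letter and \<open>w\<close> need not be reduced, so
  \<open>W\<close> amounts to a pairing of the positions of \<open>w\<close>. The genus is measured
  on \<open>W\<close>, where different pairs are independent generators.\<close>

definition quadratic_lift :: "nat \<Rightarrow> 'x letter list \<Rightarrow> bool" where
  "quadratic_lift g w \<longleftrightarrow> (\<exists>(W :: nat letter list) f.
     quadratic W \<and> map (lab f) W = w \<and> is_cp FU g (nf W))"

lemma lab_letter_inv [simp]: "lab f (letter_inv l) = letter_inv (lab f l)"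
  by (simp add: lab_def letter_inv_def)

lemma quadraticD: "quadratic W \<Longrightarrow> l \<in> set W \<Longrightarrow> letter_inv l \<in> set W"
  by (auto simp: quadratic_def)

lemma map_lab_winv: "map (lab f) (winv w) = winv (map (lab f) w)" by (simp add: rev_map)

lemma nf_cancel: "nf (u @ l # letter_inv l # v) = nf (u @ v)"
  using cancel_cons_letter_inv[OF reduced_nf[of v], of "letter_inv l"]
  by (subst (1 2) nf_append) (simp add: nf_Cons)

lemma inv_nf: "inv\<^bsub>FU\<^esub> (nf w) = nf (winv w)"
proof -
  interpret group "FU :: 'a letter list monoid" by (rule group_free_group)
  have "nf (winv w) \<otimes>\<^bsub>FU\<^esub> nf w = nf (winv w @ winv (winv w))"
    by (simp add: nf_mult)
  also have "\<dots> = \<one>\<^bsub>FU\<^esub>" by (simp only: nf_winv free_group_one)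
  finally show ?thesis
    using inv_equality[of "nf (winv w)" "nf w"] nf_carrier[of w UNIV] nf_carrier[of "winv w" UNIV]
    by simp
qed

lemma commutator_nf:
  "commutator FU (nf u) (nf v) = nf (u @ v @ winv u @ winv v)"
  by (simp add: commutator_def inv_nf nf_mult)

lemma commutator_free_group:
  assumes "a \<in> carrier (free_group S)" "b \<in> carrier (free_group S)"
  shows "commutator (free_group S) a b = nf (a @ b @ winv a @ winv b)"
proof -
  have a: "nf a = a" "nf b = b" "nf (winv a) = winv a" "nf (winv b) = winv b"
    using assms by (auto intro!: nf_reduced reduced_winv simp: free_group_carrier)
  have "commutator (free_group S) a b =
      nf a \<otimes>\<^bsub>free_group S\<^esub> nf b \<otimes>\<^bsub>free_group S\<^esub> nf (winv a) \<otimes>\<^bsub>free_group S\<^esub> nf (winv b)"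
    unfolding a by (simp add: commutator_def free_group_inv assms)
  then show ?thesis by (simp add: nf_mult)
qed

lemma quadratic_lift_Nil: "quadratic_lift 0 []" unfolding quadratic_lift_def
  by (rule exI[of _ "[]"]) (use is_cp.zero[of "FU"] in
      \<open>simp add: quadratic_def free_group_one\<close>)

text \<open>\<open>u\<close> and \<open>v\<close> are spelt with fresh generators numbered from
  \<open>m\<close> on, so the new commutator shares no letter with the old lift.\<close>

lemma quadratic_lift_commutator:
  assumes "quadratic_lift g w"
  shows "quadratic_lift (Suc g) (u @ v @ winv u @ winv v @ w)"
proof -
  obtain W :: "nat letter list" and f where W: "quadratic W" "map (lab f) W = w"
    "is_cp FU g (nf W)" using assms by (auto simp: quadratic_lift_def)
  obtain m where m: "\<And>l. l \<in> set W \<Longrightarrow> fst l < m"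
    using finite_nat_set_iff_bounded[of "fst ` set W"] by auto
  define p q where "p = length u" and "q = length v"
  define U where "U = map (\<lambda>i. (m + i, False)) [0..<p]"
  define V where "V = map (\<lambda>i. (m + (p + i), False)) [0..<q]"
  define f' where "f' y = (if y < m then f y else (u @ v) ! (y - m))" for y
  have "map (lab f') W = map (lab f) W" using m by (auto simp: lab_def f'_def)
  moreover have "map (lab f') U = u"
    by (rule nth_equalityI) (auto simp: U_def p_def lab_def f'_def nth_append)
  moreover have "map (lab f') V = v"
    by (rule nth_equalityI) (auto simp: V_def p_def q_def lab_def f'_def nth_append)
  ultimately have 1: "map (lab f') (U @ V @ winv U @ winv V @ W) = u @ v @ winv u @ winv v @ w"
    using W(2) by (simp only: map_append map_lab_winv)
  have "distinct (U @ V @ winv U @ winv V @ W)" using W(1) m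
    by (force simp: quadratic_def U_def V_def distinct_map inj_on_def letter_inv_def)
  then have 2: "quadratic (U @ V @ winv U @ winv V @ W)"
    using W(1) by (auto simp: quadratic_def image_Un image_image)
  have "nf (U @ V @ winv U @ winv V @ W) =
      commutator FU (nf U) (nf V) \<otimes>\<^bsub>FU\<^esub> nf W"
    by (simp add: commutator_nf nf_mult)
  then have "is_cp FU (Suc g) (nf (U @ V @ winv U @ winv V @ W))"
    using is_cp.Suc[OF nf_carrier nf_carrier W(3), of U V] by simp
  with 1 2 show ?thesis unfolding quadratic_lift_def by blast
qed

lemma quadratic_lift_insert:
  assumes "quadratic_lift g (w1 @ w2)"
  shows "quadratic_lift g (w1 @ l # letter_inv l # w2)"
proof -
  obtain W :: "nat letter list" and f where W: "quadratic W" "map (lab f) W = w1 @ w2"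
    "is_cp FU g (nf W)" using assms by (auto simp: quadratic_lift_def)
  then obtain W1 W2 where s: "W = W1 @ W2" "map (lab f) W1 = w1" "map (lab f) W2 = w2"
    by (auto simp: map_eq_append_conv)
  obtain m where m: "\<And>l. l \<in> set W \<Longrightarrow> fst l < m"
    using finite_nat_set_iff_bounded[of "fst ` set W"] by auto
  define f' where "f' = f(m := l)"
  have "map (lab f') W1 = map (lab f) W1" "map (lab f') W2 = map (lab f) W2"
    using m s by (fastforce simp: lab_def f'_def)+
  then have "map (lab f') (W1 @ (m, False) # letter_inv (m, False) # W2)
      = w1 @ l # letter_inv l # w2" using s by (simp, simp add: lab_def f'_def)
  moreover have "(m, False) \<notin> set W" "(m, True) \<notin> set W" using m by fastforce+
  then have "quadratic (W1 @ (m, False) # letter_inv (m, False) # W2)"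
    using W(1) s(1) by (auto simp: quadratic_def letter_inv_def)
  moreover have "is_cp FU g (nf (W1 @ (m, False) # letter_inv (m, False) # W2))"
    using W(3) s(1) by (simp add: nf_cancel)
  ultimately show ?thesis unfolding quadratic_lift_def by blast
qed

text \<open>If the two positions are glued to each other, they cancel in the lift. Otherwise
  substituting \<open>letter_inv e\<close> for \<open>k\<close> respects the labels, makes
  \<open>e\<close> and \<open>k\<close> cancel and glues their former partners to each other; being
  a homomorphism, it keeps a product of \<open>g\<close> commutators.\<close>

lemma quadratic_lift_delete:
  assumes "quadratic_lift g (w1 @ l # letter_inv l # w2)"
  shows "quadratic_lift g (w1 @ w2)"
proof -
  obtain W :: "nat letter list" and f where W: "quadratic W"
    "map (lab f) W = w1 @ l # letter_inv l # w2" "is_cp FU g (nf W)"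
    using assms by (auto simp: quadratic_lift_def)
  then obtain W1 e k W2 where s: "W = W1 @ e # k # W2" "map (lab f) W1 = w1"
      "map (lab f) W2 = w2" "lab f e = l" "lab f k = letter_inv l"
    by (auto simp: map_eq_append_conv map_eq_Cons_conv)
  show ?thesis
  proof (cases "k = letter_inv e")
    case True
    have "quadratic (W1 @ W2)"
      using W(1) True unfolding s(1) quadratic_def by (auto simp: letter_inv_eq image_iff)
    moreover have "nf (W1 @ W2) = nf W" unfolding s(1) True by (simp add: nf_cancel)
    ultimately show ?thesis using W(3) s unfolding quadratic_lift_def by (metis map_append)
  next
    case False
    have fst: "fst e \<noteq> fst k"
      using same_fst_letter[of k e] False W(1) by (auto simp: s(1) quadratic_def)
    define t where "t x = (if x = k then letter_inv e else if x = letter_inv k then e else x)" for x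
    define \<psi> where "\<psi> y = (if y = fst k then if snd k then [e] else [letter_inv e] else free_gen y)"
      for y
    have \<psi>: "\<psi> y \<in> carrier FU" for y
      by (simp add: \<psi>_def free_group_carrier free_gen_def)
    have "eval_letter FU \<psi> x = [t x]" for x by (cases x; cases k)
        (auto simp: eval_letter_def \<psi>_def t_def free_gen_def free_group_inv free_group_carrier
          letter_inv_def)
    then have ev: "eval_word FU \<psi> V = nf (map t V)" for V
      by (induction V) (simp_all add: eval_word_def free_group_one free_group_mult nf_Cons)
    have te: "t e = e" "t k = letter_inv e" using fst by (auto simp: t_def)
    have "is_cp FU g (eval_word FU \<psi> (nf W))"
      by (rule is_cp_hom[OF group_free_group group_free_group eval_word_hom[OF group_free_group \<psi>]
          W(3)])
    also have "eval_word FU \<psi> (nf W) = nf (map t (W1 @ W2))"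
      by (simp add: eval_word_nf[OF group_free_group \<psi>] ev s(1) te nf_cancel)
    finally have cp: "is_cp FU g (nf (map t (W1 @ W2)))" .
    have d: "distinct W" "k \<notin> set (W1 @ W2)" "e \<notin> set (W1 @ W2)"
      using W(1) by (auto simp: quadratic_def s(1))
    have "inj_on t (set (W1 @ W2))" using d by (auto simp: inj_on_def t_def)
    moreover have "distinct (W1 @ W2)" using d(1) by (auto simp: s(1))
    ultimately have "distinct (map t (W1 @ W2))" by (simp only: distinct_map)
    moreover have "letter_inv (t x) \<in> t ` set (W1 @ W2)" if x: "x \<in> set (W1 @ W2)" for x
    proof (cases "letter_inv x \<in> set (W1 @ W2)")
      case True
      have "x \<noteq> letter_inv k" using True d(2) by auto
      then have "letter_inv (t x) = t (letter_inv x)" using x d by (auto simp: t_def letter_inv_eq)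
      then show ?thesis using True by blast
    next
      case F: False
      have "letter_inv x \<in> set W" using quadraticD[OF W(1), of x] x by (auto simp: s(1))
      then have "letter_inv x = e \<or> letter_inv x = k" using F by (auto simp: s(1))
      then show ?thesis
      proof
        assume x': "letter_inv x = e"
        have "letter_inv k \<in> set W" using quadraticD[OF W(1), of k] by (auto simp: s(1))
        then have "letter_inv k \<in> set (W1 @ W2)" using False by (auto simp: s(1) letter_inv_eq)
        moreover have "letter_inv (t x) = t (letter_inv k)"
          using x' fst x d by (auto simp: t_def letter_inv_eq)
        ultimately show ?thesis by blast
      next
        assume x': "letter_inv x = k"
        have "letter_inv e \<in> set W" using quadraticD[OF W(1), of e] by (auto simp: s(1))
        then have "letter_inv e \<in> set (W1 @ W2)" using False by (auto simp: s(1) letter_inv_eq)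
        moreover have "letter_inv (t x) = t (letter_inv e)"
          using x' fst x d False by (auto simp: t_def letter_inv_eq)
        ultimately show ?thesis by blast
      qed
    qed
    ultimately have "quadratic (map t (W1 @ W2))"
      unfolding quadratic_def by (simp only: set_map) blast
    moreover have "lab f (t x) = lab f x" if "x \<in> set (W1 @ W2)" for x
      using that d s(4,5) by (auto simp: t_def)
    then have "map (lab f) (map t (W1 @ W2)) = w1 @ w2" using s(2,3) by auto
    ultimately show ?thesis using cp unfolding quadratic_lift_def by blast
  qed
qed

lemma quadratic_lift_nf: "quadratic_lift g (u @ w) \<longleftrightarrow> quadratic_lift g (u @ nf w)"
proof (induction w arbitrary: u)
  case (Cons l w)
  have "quadratic_lift g (u @ l # w) \<longleftrightarrow> quadratic_lift g (u @ l # nf w)"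
    using Cons[of "u @ [l]"] by simp
  also have "\<dots> \<longleftrightarrow> quadratic_lift g (u @ cancel_cons l (nf w))"
  proof (cases "nf w")
    case (Cons m v)
    then show ?thesis
      using quadratic_lift_insert[of g u v l] quadratic_lift_delete[of g u l v] by auto
  qed simp
  finally show ?case by (simp add: nf_Cons)
qed simp

text \<open>The lift is built on the unreduced word spelt by the commutators and then carried over
  to \<open>w\<close>, which has the same reduced form.\<close>

lemma is_cp_imp_quadratic_lift:
  assumes "is_cp (free_group S) g (nf w)"
  shows "quadratic_lift g w"
proof -
  have "\<exists>v. quadratic_lift g v \<and> nf v = x" if "is_cp (free_group S) g x" for x
    using that
  proof (induction rule: is_cp.induct)
    case zero
    show ?case using quadratic_lift_Nil by (auto simp: free_group_one intro: exI[of _ "[]"])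
  next
    case (Suc a b n x)
    then obtain v where v: "quadratic_lift n v" "nf v = x" by blast
    have "nf (a @ b @ winv a @ winv b @ v) = commutator (free_group S) a b \<otimes>\<^bsub>free_group S\<^esub> x"
      using commutator_free_group[OF Suc.hyps(1,2)] v(2)
        nf_mult[where u = "a @ b @ winv a @ winv b" and v = v and S = S] by simp
    then show ?case using quadratic_lift_commutator[OF v(1), of a b] by blast
  qed
  from this[OF assms] obtain v where "quadratic_lift g v" "nf v = nf w" by blast
  then show ?thesis using quadratic_lift_nf[of g "[]" v] quadratic_lift_nf[of g "[]" w] by simp
qed

section \<open>Handles and the normal form of a quadratic word\<close>

primrec cprod :: "('a, 'b) monoid_scheme \<Rightarrow> nat \<Rightarrow> (nat \<Rightarrow> 'a) \<Rightarrow> (nat \<Rightarrow> 'a) \<Rightarrow> 'a" where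
  "cprod G 0 a b = \<one>\<^bsub>G\<^esub>"
| "cprod G (Suc n) a b = commutator G (a 0) (b 0) \<otimes>\<^bsub>G\<^esub> cprod G n (\<lambda>i. a (Suc i)) (\<lambda>i. b (Suc i))"

lemma (in group) cprod_closed [simp]:
  "(\<And>i. i < n \<Longrightarrow> a i \<in> carrier G) \<Longrightarrow> (\<And>i. i < n \<Longrightarrow> b i \<in> carrier G) \<Longrightarrow>
    cprod G n a b \<in> carrier G" by (induction n arbitrary: a b) auto

lemma (in group) cprod_add:
  assumes "\<And>i. a i \<in> carrier G" "\<And>i. b i \<in> carrier G"
  shows "cprod G (m + n) a b = cprod G m a b \<otimes> cprod G n (\<lambda>i. a (m + i)) (\<lambda>i. b (m + i))"
  using assms by (induction m arbitrary: a b) (simp_all add: m_assoc)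

lemma is_cp_cprod:
  assumes "\<And>i. i < n \<Longrightarrow> a i \<in> carrier G" "\<And>i. i < n \<Longrightarrow> b i \<in> carrier G"
  shows "is_cp G n (cprod G n a b)"
  using assms by (induction n arbitrary: a b) (auto intro: is_cp.intros)

lemma is_cp_obtain_cprod:
  assumes "group G" "is_cp G n x"
  shows "\<exists>a b. (\<forall>i. a i \<in> carrier G) \<and> (\<forall>i. b i \<in> carrier G) \<and> x = cprod G n a b"
  using assms(2)
proof (induction rule: is_cp.induct)
  case zero
  interpret group G by fact
  show ?case by (auto intro: exI[of _ "\<lambda>_. \<one>\<^bsub>G\<^esub>"])
next
  case (Suc a b n x)
  then obtain a' b' where "\<forall>i. a' i \<in> carrier G" "\<forall>i. b' i \<in> carrier G" "x = cprod G n a' b'"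
    by blast
  then show ?case using Suc.hyps(1,2)
    by (intro exI[of _ "case_nat a a'"] exI[of _ "case_nat b b'"]) (auto split: nat.split)
qed

text \<open>The right-hand side is the word \<open>e B k C e^-1 D k^-1 E\<close> with
  \<open>x\<close>, \<open>y\<close> in place of \<open>e\<close>, \<open>k\<close>: cutting and
  regluing isolates one handle and leaves the shorter word \<open>D C B E\<close>.\<close>

lemma (in group) commutator_handle:
  assumes "x \<in> carrier G" "y \<in> carrier G" "b \<in> carrier G" "c \<in> carrier G" "d \<in> carrier G"
    "r \<in> carrier G"
  shows "commutator G (x \<otimes> inv c \<otimes> inv d) (d \<otimes> c \<otimes> b \<otimes> y \<otimes> inv d) \<otimes> (d \<otimes> (c \<otimes> (b \<otimes> r)))
    = x \<otimes> (b \<otimes> (y \<otimes> (c \<otimes> (inv x \<otimes> (d \<otimes> (inv y \<otimes> r))))))"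
proof -
  have [simp]: "inv u \<otimes> (u \<otimes> z) = z" "u \<otimes> (inv u \<otimes> z) = z"
    if "u \<in> carrier G" "z \<in> carrier G" for u z
    using that by (simp_all add: m_assoc[symmetric])
  show ?thesis using assms by (simp add: commutator_def m_assoc inv_mult_group)
qed

text \<open>The two entries of the handle in \<open>commutator_handle\<close> can be prescribed
  arbitrarily: these identities solve for the values of \<open>e\<close> and
  \<open>k\<close>.\<close>

lemma (in group) handle_solve:
  assumes "a \<in> carrier G" "b \<in> carrier G" "x \<in> carrier G" "y \<in> carrier G" "z \<in> carrier G"
  shows "a \<otimes> x \<otimes> y \<otimes> inv y \<otimes> inv x = a"
    and "x \<otimes> y \<otimes> z \<otimes> (inv (x \<otimes> y \<otimes> z) \<otimes> b \<otimes> x) \<otimes> inv x = b"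
proof -
  have [simp]: "inv u \<otimes> (u \<otimes> v) = v" "u \<otimes> (inv u \<otimes> v) = v"
    if "u \<in> carrier G" "v \<in> carrier G" for u v
    using that by (simp_all add: m_assoc[symmetric])
  show "a \<otimes> x \<otimes> y \<otimes> inv y \<otimes> inv x = a"
    "x \<otimes> y \<otimes> z \<otimes> (inv (x \<otimes> y \<otimes> z) \<otimes> b \<otimes> x) \<otimes> inv x = b"
    using assms by (simp_all add: m_assoc inv_mult_group)
qed

text \<open>Classification of one-vertex surfaces: handles \<open>e\<dots>k\<dots>e\<^sup>-\<^sup>1\<dots>k\<^sup>-\<^sup>1\<close> are split off one at a
  time, and every other pair \<open>e X e\<^sup>-\<^sup>1 Y\<close> separates the word into two quadratic words. The
  second conjunct says that the genus found this way cannot be lowered.\<close>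

lemma quadratic_normal_form:
  fixes W :: "'e letter list" and G :: "('a, 'm) monoid_scheme" and K :: "('b, 'n) monoid_scheme"
  assumes "group G" "group K" "quadratic W"
  shows "\<exists>g. (\<forall>f. (\<forall>x. f x \<in> carrier G) \<longrightarrow> is_cp G g (eval_word G f W)) \<and>
    (\<forall>(a :: nat \<Rightarrow> 'b) b. (\<forall>i. a i \<in> carrier K) \<and> (\<forall>i. b i \<in> carrier K) \<longrightarrow>
       (\<exists>\<rho>. (\<forall>x. \<rho> x \<in> carrier K) \<and> eval_word K \<rho> W = cprod K g a b))"
  (is "\<exists>g. ?P g W \<and> ?Q g W") using assms(3)
proof (induction W rule: length_induct)
  case (1 W)
  interpret G: group G by fact
  interpret K: group K by fact
  note evG = eval_word_Cons[OF assms(1)] eval_word_append[OF assms(1)] eval_letter_inv[OF assms(1)]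
    eval_word_closed[OF assms(1)] eval_letter_closed[OF assms(1)]
  note evK = eval_word_Cons[OF assms(2)] eval_word_append[OF assms(2)] eval_letter_inv[OF assms(2)]
    eval_word_closed[OF assms(2)] eval_letter_closed[OF assms(2)]
  show ?case
  proof (cases W)
    case Nil
    have "?P 0 W \<and> ?Q 0 W"
      using is_cp.zero[of G] by (auto simp: Nil eval_word_def intro!: exI[of _ "\<lambda>_. \<one>\<^bsub>K\<^esub>"])
    then show ?thesis by blast
  next
    case (Cons e W1)
    have "letter_inv e \<in> set W1" using quadraticD[OF 1(2), of e] by (auto simp: Cons)
    then obtain X Y where XY: "W1 = X @ letter_inv e # Y" by (meson split_list)
    have W: "W = e # X @ letter_inv e # Y" by (simp add: Cons XY)
    have d: "distinct W" using 1(2) by (simp add: quadratic_def)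
    have Wi: "letter_inv l \<in> insert e (insert (letter_inv e) (set X \<union> set Y))"
      if "l \<in> set X \<union> set Y" for l using quadraticD[OF 1(2), of l] that by (auto simp: W)
    show ?thesis
    proof (cases "\<exists>k \<in> set X. letter_inv k \<notin> set X")
      case True
      then obtain k where k: "k \<in> set X" "letter_inv k \<notin> set X" by blast
      then have "letter_inv k \<in> set Y" using Wi[of k] d by (auto simp: W letter_inv_eq)
      then obtain B C D E where X: "X = B @ k # C" and Y: "Y = D @ letter_inv k # E"
        using k(1) by (meson split_list)
      have W: "W = e # B @ k # C @ letter_inv e # D @ letter_inv k # E" by (simp add: W X Y)
      define V where "V = D @ C @ B @ E"
      have V: "e \<notin> set V" "k \<notin> set V" "letter_inv e \<notin> set V" "letter_inv k \<notin> set V"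
        using d by (auto simp: W V_def)
      have fst: "fst e \<noteq> fst k" using same_fst_letter[of e k] d by (auto simp: W)
      have fstV: "fst l \<noteq> fst e \<and> fst l \<noteq> fst k" if "l \<in> set V" for l
        using same_fst_letter[of l e] same_fst_letter[of l k] V that by auto
      have "distinct V" using d by (auto simp: W V_def)
      moreover have "letter_inv l \<in> set V" if "l \<in> set V" for l
        using quadraticD[OF 1(2), of l] that V by (auto simp: W V_def letter_inv_eq)
      ultimately have "quadratic V" by (auto simp: quadratic_def)
      moreover have "length V < length W" by (simp add: V_def W)
      ultimately obtain g where P: "?P g V" and Q: "?Q g V" using 1(1) by blast
      have "?P (Suc g) W"
      proof (intro allI impI)
        fix f :: "'e \<Rightarrow> 'a" assume f: "\<forall>x. f x \<in> carrier G"
        let ?e = "eval_word G f" and ?l = "eval_letter G f"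
        have "is_cp G (Suc g) (commutator G (?l e \<otimes>\<^bsub>G\<^esub> inv\<^bsub>G\<^esub> ?e C \<otimes>\<^bsub>G\<^esub> inv\<^bsub>G\<^esub> ?e D)
            (?e D \<otimes>\<^bsub>G\<^esub> ?e C \<otimes>\<^bsub>G\<^esub> ?e B \<otimes>\<^bsub>G\<^esub> ?l k \<otimes>\<^bsub>G\<^esub> inv\<^bsub>G\<^esub> ?e D) \<otimes>\<^bsub>G\<^esub> ?e V)"
          by (intro is_cp.Suc) (use P f in \<open>auto simp: evG\<close>)
        also have "?e V = ?e D \<otimes>\<^bsub>G\<^esub> (?e C \<otimes>\<^bsub>G\<^esub> (?e B \<otimes>\<^bsub>G\<^esub> ?e E))"
          using f by (simp add: V_def evG)
        finally show "is_cp G (Suc g) (?e W)" using f by (simp add: G.commutator_handle evG W)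
      qed
      moreover have "?Q (Suc g) W"
      proof (intro allI impI)
        fix a b :: "nat \<Rightarrow> 'b" assume ab: "(\<forall>i. a i \<in> carrier K) \<and> (\<forall>i. b i \<in> carrier K)"
        then obtain \<sigma> where \<sigma>: "\<forall>x. \<sigma> x \<in> carrier K"
          "eval_word K \<sigma> V = cprod K g (\<lambda>i. a (Suc i)) (\<lambda>i. b (Suc i))"
          using Q[rule_format, of "\<lambda>i. a (Suc i)" "\<lambda>i. b (Suc i)"] by blast
        let ?s = "eval_word K \<sigma>"
        define x where "x = a 0 \<otimes>\<^bsub>K\<^esub> ?s D \<otimes>\<^bsub>K\<^esub> ?s C"
        define y where "y = inv\<^bsub>K\<^esub> (?s D \<otimes>\<^bsub>K\<^esub> ?s C \<otimes>\<^bsub>K\<^esub> ?s B) \<otimes>\<^bsub>K\<^esub> b 0 \<otimes>\<^bsub>K\<^esub> ?s D"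
        have sc: "?s D \<in> carrier K" "?s C \<in> carrier K" "?s B \<in> carrier K" "?s E \<in> carrier K"
          using \<sigma>(1) by (auto simp: evK)
        have xy: "x \<in> carrier K" "y \<in> carrier K" using ab sc by (auto simp: x_def y_def)
        \<comment> \<open>If \<open>e\<close> or \<open>k\<close> is an inverse letter, its
          generator receives the inverse, so that the letter itself takes the value \<open>x\<close>
          or \<open>y\<close>.\<close>
        define \<rho> where "\<rho> = \<sigma>(fst e := (if snd e then inv\<^bsub>K\<^esub> x else x),
            fst k := (if snd k then inv\<^bsub>K\<^esub> y else y))"
        have \<rho>: "\<rho> z \<in> carrier K" for z
          using \<sigma>(1) xy by (auto simp: \<rho>_def)
        have le: "eval_letter K \<rho> e = x" "eval_letter K \<rho> k = y"
          using fst xy by (auto simp: \<rho>_def eval_letter_def)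
        have \<rho>\<sigma>: "\<rho> z = \<sigma> z" if zV: "z \<in> fst ` set V" for z
        proof -
          obtain l where "z = fst l" "l \<in> set V" using zV by (rule imageE)
          then have "z \<noteq> fst e" "z \<noteq> fst k" using fstV[of l] by simp_all
          then show ?thesis by (simp add: \<rho>_def)
        qed
        have eq: "eval_word K \<rho> D = ?s D" "eval_word K \<rho> C = ?s C" "eval_word K \<rho> B = ?s B"
            "eval_word K \<rho> E = ?s E"
          by (rule eval_word_cong, rule \<rho>\<sigma>, simp add: V_def image_Un)+
        note hs = K.handle_solve[OF _ _ sc(1-3), of "a 0" "b 0", folded x_def y_def]
        have "eval_word K \<rho> W = cprod K (Suc g) a b"
          using K.commutator_handle[OF xy sc(3,2,1,4)] hs ab
          by (simp add: W evK \<rho> eq le V_def \<sigma>(1) flip: \<sigma>(2))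
        then show "\<exists>\<rho>. (\<forall>x. \<rho> x \<in> carrier K) \<and> eval_word K \<rho> W = cprod K (Suc g) a b"
          using \<rho> by blast
      qed
      ultimately show ?thesis by blast
    next
      case False
      then have X: "letter_inv l \<in> set X" if "l \<in> set X" for l using that by blast
      have Y: "letter_inv l \<in> set Y" if "l \<in> set Y" for l
      proof -
        have "letter_inv l \<notin> set X" using X[of "letter_inv l"] that d by (auto simp: W)
        then show ?thesis using Wi[of l] that d by (auto simp: W letter_inv_eq)
      qed
      have "quadratic X" "quadratic Y" using X Y d by (auto simp: quadratic_def W)
      then obtain g g' where P: "?P g X" "?P g' Y" and Q: "?Q g X" "?Q g' Y"
        using 1(1)[rule_format, of X] 1(1)[rule_format, of Y] by (auto simp: W)
      have fst: "fst l \<noteq> fst m" if "l \<in> set X" "m \<in> set Y" for l m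
      proof -
        have "set X \<inter> set Y = {}" using d by (auto simp: W)
        then have "m \<notin> set X" using that by blast
        then have "l \<noteq> m" "l \<noteq> letter_inv m" using that X[of l] by auto
        then show ?thesis using same_fst_letter[of l m] by blast
      qed
      have fste: "fst l \<noteq> fst e" if "l \<in> set X \<union> set Y" for l
        using same_fst_letter[of l e] that d by (auto simp: W)
      have "?P (g + g') W"
      proof (intro allI impI)
        fix f :: "'e \<Rightarrow> 'a" assume f: "\<forall>x. f x \<in> carrier G"
        then show "is_cp G (g + g') (eval_word G f W)"
          using G.is_cp_mult[OF G.is_cp_conj[of g "eval_word G f X" "eval_letter G f e"],
              of g' "eval_word G f Y"] P by (simp add: W evG G.m_assoc)
      qed
      moreover have "?Q (g + g') W"
      proof (intro allI impI)
        fix a b :: "nat \<Rightarrow> 'b" assume ab: "(\<forall>i. a i \<in> carrier K) \<and> (\<forall>i. b i \<in> carrier K)"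
        then obtain \<sigma> where \<sigma>: "\<forall>x. \<sigma> x \<in> carrier K" "eval_word K \<sigma> X = cprod K g a b"
          using Q(1)[rule_format, of a b] by blast
        obtain \<tau> where \<tau>: "\<forall>x. \<tau> x \<in> carrier K"
            "eval_word K \<tau> Y = cprod K g' (\<lambda>i. a (g + i)) (\<lambda>i. b (g + i))"
          using Q(2)[rule_format, of "\<lambda>i. a (g + i)" "\<lambda>i. b (g + i)"] ab by blast
        \<comment> \<open>\<open>X\<close> and \<open>Y\<close> share no generator, so
          \<open>\<sigma>\<close> and \<open>\<tau>\<close> combine; with \<open>e\<close> trivial,
          the conjugation of \<open>X\<close> by \<open>e\<close> disappears.\<close>
        define \<rho> where "\<rho> z = (if z = fst e then \<one>\<^bsub>K\<^esub> else if z \<in> fst ` set X then \<sigma> z else \<tau> z)"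
          for z
        have \<rho>: "\<rho> z \<in> carrier K" for z
          using \<sigma>(1) \<tau>(1) by (auto simp: \<rho>_def)
        have "eval_word K \<rho> X = eval_word K \<sigma> X"
        proof (rule eval_word_cong)
          fix z assume z: "z \<in> fst ` set X"
          then obtain m where "m \<in> set X" "z = fst m" by blast
          then show "\<rho> z = \<sigma> z" using fste[of m] z by (simp add: \<rho>_def)
        qed
        moreover have "eval_word K \<rho> Y = eval_word K \<tau> Y"
        proof (rule eval_word_cong)
          fix z assume "z \<in> fst ` set Y"
          then obtain m where m: "m \<in> set Y" "z = fst m" by blast
          then have "z \<notin> fst ` set X" using fst by fastforce
          then show "\<rho> z = \<tau> z" using fste[of m] m by (simp add: \<rho>_def)
        qed
        moreover have "eval_letter K \<rho> e = \<one>\<^bsub>K\<^esub>"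
          by (simp add: eval_letter_def \<rho>_def)
        ultimately have "eval_word K \<rho> W = cprod K (g + g') a b"
          using ab \<sigma> \<tau> by (simp add: W evK \<rho> K.cprod_add)
        then show "\<exists>\<rho>. (\<forall>x. \<rho> x \<in> carrier K) \<and> eval_word K \<rho> W = cprod K (g + g') a b"
          using \<rho> by blast
      qed
      ultimately show ?thesis by blast
    qed
  qed
qed

section \<open>The intersection form\<close>

text \<open>Upper unitriangular 3 by 3 matrices mod 2; the centre coordinate of a commutator is the
  standard symplectic form.\<close>

definition heis :: "(bool \<times> bool \<times> bool) monoid" where
  "heis = \<lparr>carrier = UNIV,
     monoid.mult = (\<lambda>(x, y, z) (x', y', z'). (x \<noteq> x', y \<noteq> y', (z \<noteq> z') \<noteq> (x \<and> y'))),
     one = (False, False, False)\<rparr>"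

primrec par :: "'e set \<Rightarrow> 'e letter list \<Rightarrow> bool" where
  "par C [] = False"
| "par C (l # w) = ((fst l \<in> C) \<noteq> par C w)"

text \<open>On a product of commutators the centre coordinate evaluates the intersection form at the
  two mod 2 classes \<open>par C\<close> and \<open>par D\<close>.\<close>

definition heis_rep :: "'e set \<Rightarrow> 'e set \<Rightarrow> 'e letter list \<Rightarrow> bool \<times> bool \<times> bool" where
  "heis_rep C D = eval_word heis (\<lambda>x. (x \<in> C, x \<in> D, False))"

lemma heis_simps [simp]:
  "carrier heis = UNIV" "\<one>\<^bsub>heis\<^esub> = (False, False, False)"
  "(x, y, z) \<otimes>\<^bsub>heis\<^esub> (x', y', z') = (x \<noteq> x', y \<noteq> y', (z \<noteq> z') \<noteq> (x \<and> y'))"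
  by (simp_all add: heis_def)

lemma group_heis: "group heis"
proof (rule groupI)
  fix p assume "p \<in> carrier heis"
  show "\<exists>q\<in>carrier heis. q \<otimes>\<^bsub>heis\<^esub> p = \<one>\<^bsub>heis\<^esub>"
  proof (cases p)
    case (fields x y z)
    then show ?thesis by (intro bexI[of _ "(x, y, z \<noteq> (x \<and> y))"]) auto
  qed
qed (auto simp: split_paired_all)

lemma heis_inv [simp]: "inv\<^bsub>heis\<^esub> (x, y, z) = (x, y, z \<noteq> (x \<and> y))"
proof -
  interpret group heis by (rule group_heis)
  show ?thesis by (rule inv_equality) auto
qed

lemma heis_commutator:
  "commutator heis (x, y, z) (x', y', z') = (False, False, (x \<and> y') \<noteq> (x' \<and> y))"
  by (auto simp: commutator_def)

lemma par_append: "par C (u @ v) = (par C u \<noteq> par C v)" by (induction u) auto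

lemma heis_rep_hom: "heis_rep C D \<in> hom FU heis"
  unfolding heis_rep_def by (rule eval_word_hom[OF group_heis]) simp

lemma heis_rep_nf: "heis_rep C D (nf w) = heis_rep C D w"
  unfolding heis_rep_def by (rule eval_word_nf[OF group_heis]) simp

lemma heis_rep_append: "heis_rep C D (u @ v) = heis_rep C D u \<otimes>\<^bsub>heis\<^esub> heis_rep C D v"
  unfolding heis_rep_def by (rule eval_word_append[OF group_heis]) simp

lemma heis_rep_Nil [simp]: "heis_rep C D [] = (False, False, False)"
  by (simp add: heis_rep_def eval_word_def)

lemma heis_rep_Cons: "heis_rep C D (l # w) =
   (fst l \<in> C, fst l \<in> D, snd l \<and> fst l \<in> C \<and> fst l \<in> D) \<otimes>\<^bsub>heis\<^esub> heis_rep C D w"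
  by (simp add: heis_rep_def eval_word_def eval_letter_def)

lemma fst_heis_rep: "fst (heis_rep C D w) = par C w"
  by (induction w) (auto simp: heis_rep_Cons heis_def split: prod.splits)

lemma heis_rep_disjoint:
  "fst ` set w \<inter> D = {} \<Longrightarrow> heis_rep C D w = (par C w, False, False)"
  by (induction w) (auto simp: heis_rep_Cons)

text \<open>A product of \<open>g\<close> commutators has an intersection form of rank at most \<open>2g\<close>: the
  homomorphisms \<open>par C\<close> vanishing on the \<open>2g\<close> commutator entries are in its radical.\<close>

lemma is_cp_radical:
  assumes "is_cp FU g x"
  shows "\<exists>T. finite T \<and> card T \<le> 2 * g \<and>
    (\<forall>C D. (\<forall>u\<in>T. \<not> par C u) \<longrightarrow> heis_rep C D x = (False, False, False))"
  using assms
proof (induction rule: is_cp.induct)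
  case zero
  show ?case by (intro exI[of _ "{}"]) (simp add: free_group_one)
next
  case (Suc a b n x)
  then obtain T where T: "finite T" "card T \<le> 2 * n"
    "\<And>C D. (\<forall>u\<in>T. \<not> par C u) \<Longrightarrow> heis_rep C D x = (False, False, False)"
    by blast
  have x: "x \<in> carrier FU" by (rule group.is_cp_closed[OF group_free_group Suc.hyps(3)])
  interpret F: group "FU :: 'a letter list monoid" by (rule group_free_group)
  have "heis_rep C D (commutator FU a b \<otimes>\<^bsub>FU\<^esub> x)
      = (False, False, False)"
    if "\<forall>u\<in>insert a (insert b T). \<not> par C u" for C D
  proof -
    have "heis_rep C D (commutator FU a b \<otimes>\<^bsub>FU\<^esub> x)
        = commutator heis (heis_rep C D a) (heis_rep C D b) \<otimes>\<^bsub>heis\<^esub> heis_rep C D x"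
      using x Suc.hyps(1,2) hom_mult[OF heis_rep_hom, of _ x C D]
      by (simp add: hom_commutator[OF group_free_group group_heis heis_rep_hom])
    also have "commutator heis (heis_rep C D a) (heis_rep C D b) = (False, False, False)"
      using that fst_heis_rep[of C D a] fst_heis_rep[of C D b]
      by (cases "heis_rep C D a"; cases "heis_rep C D b") (simp add: heis_commutator)
    finally show ?thesis using T(3)[of C D] that by simp
  qed
  moreover have "card (insert a (insert b T)) \<le> 2 * Suc n"
    using T(1,2) by (simp add: card_insert_if)
  ultimately show ?case using T(1) by (intro exI[of _ "insert a (insert b T)"]) simp
qed

lemma par_sym_diff: "par (A - B \<union> (B - A)) u = (par A u \<noteq> par B u)"
  by (induction u) auto

text \<open>The subsets of \<open>X\<close> form a vector space over the field with two elements,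
  and \<open>T\<close> imposes \<open>card T\<close> linear equations. Instead of dimensions one
  counts fibres, each of which is empty or injected into the kernel by a translation, i.e. a
  symmetric difference.\<close>

lemma card_radical:
  assumes "finite X" "finite T"
  shows "2 ^ card X \<le> 2 ^ card T * card {C. C \<subseteq> X \<and> (\<forall>u\<in>T. \<not> par C u)}"
    (is "_ \<le> _ * card ?K")
proof -
  define fib where "fib s = {C. C \<subseteq> X \<and> {u \<in> T. par C u} = s}" for s
  have K: "finite ?K" using assms(1) by (auto intro: finite_subset[of _ "Pow X"])
  have le: "card (fib s) \<le> card ?K" for s
  proof (cases "fib s = {}")
    case False
    then obtain C0 where C0: "C0 \<in> fib s" by blast
    show ?thesis
    proof (rule card_inj_on_le[OF _ _ K])
      show "inj_on (\<lambda>C. C - C0 \<union> (C0 - C)) (fib s)" by (rule inj_onI) blast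
      show "(\<lambda>C. C - C0 \<union> (C0 - C)) ` fib s \<subseteq> ?K"
        using C0 by (auto simp: fib_def par_sym_diff)
    qed
  qed simp
  have "2 ^ card X = card (Pow X)" using assms(1) by (simp add: card_Pow)
  also have "Pow X = (\<Union>s\<in>Pow T. fib s)" by (auto simp: fib_def)
  also have "card \<dots> \<le> (\<Sum>s\<in>Pow T. card (fib s))"
    using assms(2) by (intro card_UN_le) simp
  also have "\<dots> \<le> (\<Sum>s\<in>Pow T. card ?K)" by (intro sum_mono le)
  also have "\<dots> = 2 ^ card T * card ?K" using assms(2) by (simp add: card_Pow)
  finally show ?thesis .
qed

text \<open>With the single generator of \<open>e\<close> as second class, the centre coordinate
  adds the values of \<open>par C\<close> on the prefixes before \<open>e\<close> and before its
  inverse. They differ by \<open>par C Q\<close> and a contribution of \<open>e\<close> itself,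
  which cancels against the correction for the inverse letter.\<close>

lemma heis_rep_interval:
  assumes "distinct (P @ e # Q @ letter_inv e # R)"
    and "heis_rep C {fst e} (P @ e # Q @ letter_inv e # R) = (False, False, False)"
  shows "\<not> par C Q"
proof -
  have "fst l \<noteq> fst e" if "l \<in> set P \<union> set Q \<union> set R" for l
    using same_fst_letter[of l e] that assms(1) by auto
  then have "fst ` set P \<inter> {fst e} = {}" "fst ` set Q \<inter> {fst e} = {}"
      "fst ` set R \<inter> {fst e} = {}" by fastforce+
  then show ?thesis using assms(2)
    by (cases "snd e") (auto simp: heis_rep_append heis_rep_Cons heis_rep_disjoint letter_inv_def)
qed

lemma hom_cprod:
  assumes "group G" "group K" "h \<in> hom G K"
    "\<And>i. i < n \<Longrightarrow> a i \<in> carrier G" "\<And>i. i < n \<Longrightarrow> b i \<in> carrier G"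
  shows "h (cprod G n a b) = cprod K n (\<lambda>i. h (a i)) (\<lambda>i. h (b i))" using assms(4,5)
proof (induction n arbitrary: a b)
  case 0
  then show ?case using hom_one[OF assms(3,1,2)] by simp
next
  case (Suc n)
  interpret group G by fact
  show ?case using Suc by (simp add: hom_mult[OF assms(3)] hom_commutator[OF assms(1-3)])
qed

lemma cprod_single:
  assumes "group G" "j < n" "commutator G (a j) (b j) \<in> carrier G"
    and "\<And>i. i < n \<Longrightarrow> i \<noteq> j \<Longrightarrow> commutator G (a i) (b i) = \<one>\<^bsub>G\<^esub>"
  shows "cprod G n a b = commutator G (a j) (b j)"
proof -
  interpret group G by fact
  have one: "cprod G n a b = \<one>\<^bsub>G\<^esub>" if "\<forall>i<n. commutator G (a i) (b i) = \<one>\<^bsub>G\<^esub>" for n a b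
    using that by (induction n arbitrary: a b) auto
  show ?thesis using assms(2-4)
  proof (induction n arbitrary: a b j)
    case (Suc n)
    show ?case
    proof (cases j)
      case 0
      then show ?thesis using Suc.prems one[of n "\<lambda>i. a (Suc i)" "\<lambda>i. b (Suc i)"] by simp
    next
      case j: (Suc j')
      then have "cprod G n (\<lambda>i. a (Suc i)) (\<lambda>i. b (Suc i)) = commutator G (a j) (b j)"
        using Suc.IH[of j' "\<lambda>i. a (Suc i)" "\<lambda>i. b (Suc i)"] Suc.prems by simp
      then show ?thesis using Suc.prems j by simp
    qed
  qed simp
qed

text \<open>The form of the standard product is nondegenerate of rank \<open>2 * n\<close>. With
  fewer commutators some nonempty set \<open>C\<close> lies in the radical, and the generator dual
  to an element of \<open>C\<close> detects it.\<close>

lemma is_cp_standard_lower: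
  assumes "is_cp FU g
    (cprod FU n (\<lambda>i. free_gen (SA i)) (\<lambda>i. free_gen (SB i)))"
  shows "n \<le> g"
proof (rule ccontr)
  assume n: "\<not> n \<le> g"
  obtain T where T: "finite T" "card T \<le> 2 * g"
    "\<And>C D. (\<forall>u\<in>T. \<not> par C u) \<Longrightarrow> heis_rep C D
       (cprod FU n (\<lambda>i. free_gen (SA i)) (\<lambda>i. free_gen (SB i)))
       = (False, False, False)" using is_cp_radical[OF assms] by blast
  define X where "X = SA ` {..<n} \<union> SB ` {..<n}"
  define K where "K = {C. C \<subseteq> X \<and> (\<forall>u\<in>T. \<not> par C u)}"
  have "card X = card (SA ` {..<n}) + card (SB ` {..<n})"
    unfolding X_def by (rule card_Un_disjoint) auto
  also have "\<dots> = 2 * n" by (simp add: card_image inj_on_def)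
  finally have X: "card X = 2 * n" "finite X" by (simp_all add: X_def)
  have "(2::nat) ^ card T < 2 ^ card X" using T(2) n X by (intro power_strict_increasing) auto
  also have "\<dots> \<le> 2 ^ card T * card K"
    using card_radical[OF X(2) T(1)] by (simp add: K_def)
  finally have "1 < card K" using mult_less_cancel1[of "2 ^ card T" 1 "card K"] by simp
  then have "\<not> K \<subseteq> {{}}" using card_mono[of "{{}}" K] by auto
  then obtain C where C: "C \<in> K" "C \<noteq> {}" by blast
  have ev: "cprod heis n (\<lambda>i. (SA i \<in> C, SA i \<in> D, False)) (\<lambda>i. (SB i \<in> C, SB i \<in> D, False))
      = (False, False, False)" for D
  proof -
    have "cprod heis n (\<lambda>i. heis_rep C D (free_gen (SA i))) (\<lambda>i. heis_rep C D (free_gen (SB i)))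
        = (False, False, False)"
      using T(3)[of C D] C(1) hom_cprod[OF group_free_group group_heis heis_rep_hom,
          where a = "\<lambda>i. free_gen (SA i)" and b = "\<lambda>i. free_gen (SB i)" and n = n]
      by (simp add: K_def free_gen_carrier)
    then show ?thesis by (simp add: free_gen_def heis_rep_Cons)
  qed
  from C obtain x where x: "x \<in> C" "x \<in> X" by (auto simp: K_def)
  then consider j where "j < n" "x = SA j" | j where "j < n" "x = SB j" by (auto simp: X_def)
  then show False
  proof cases
    case 1
    then show ?thesis using ev[of "{SB j}"] x(1) cprod_single[OF group_heis, of j n
          "\<lambda>i. (SA i \<in> C, SA i \<in> {SB j}, False)" "\<lambda>i. (SB i \<in> C, SB i \<in> {SB j}, False)"]
      by (simp add: heis_commutator)
  next
    case 2
    then show ?thesis using ev[of "{SA j}"] x(1) cprod_single[OF group_heis, of j n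
          "\<lambda>i. (SA i \<in> C, SA i \<in> {SA j}, False)" "\<lambda>i. (SB i \<in> C, SB i \<in> {SA j}, False)"]
      by (simp add: heis_commutator)
  qed
qed

lemma quadratic_split:
  assumes "quadratic (W1 @ W2)" "\<And>l. l \<in> set W1 \<Longrightarrow> letter_inv l \<notin> set W2"
  shows "quadratic W1" "quadratic W2"
proof -
  have "letter_inv l \<notin> set W1" if "l \<in> set W2" for l
    using assms(2)[of "letter_inv l"] that by auto
  then show "quadratic W1" "quadratic W2" using assms by (auto simp: quadratic_def)
qed

text \<open>Disjoint labels force the lift of \<open>u @ v\<close> to consist of two separate
  gluings. Giving their generators values that produce \<open>m\<close> and \<open>n\<close>
  different standard handles turns the lift into a standard product of \<open>m + n\<close>
  commutators, which is not a product of fewer.\<close>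

lemma is_cp_additive:
  fixes u v :: "'x letter list"
  assumes "is_cp FU g (nf (u @ v))"
    and "fst ` set u \<inter> fst ` set v = {}"
  shows "\<exists>m n. m + n \<le> g \<and> is_cp FU m (nf u) \<and> is_cp FU n (nf v)"
proof -
  obtain W :: "nat letter list" and f where W: "quadratic W" "map (lab f) W = u @ v"
    "is_cp FU g (nf W)"
    using is_cp_imp_quadratic_lift[OF assms(1)] by (auto simp: quadratic_lift_def)
  then obtain W1 W2 where s: "W = W1 @ W2" "map (lab f) W1 = u" "map (lab f) W2 = v"
    by (auto simp: map_eq_append_conv)
  have disj: "fst l \<noteq> fst m" if "l \<in> set W1" "m \<in> set W2" for l m
  proof
    assume eq: "fst l = fst m"
    have "fst (lab f l) \<in> fst ` set u" "fst (lab f m) \<in> fst ` set v"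
      using that s(2,3) by auto
    moreover have "fst (lab f l) = fst (lab f m)" using eq by (simp add: lab_def)
    ultimately show False using assms(2) by auto
  qed
  have q: "quadratic W1" "quadratic W2"
    using quadratic_split[of W1 W2] W(1) s(1) disj by (metis fst_letter_inv)+
  define G where "G = (FU :: 'x letter list monoid)"
  define H where "H = (FU :: surface_gen letter list monoid)"
  have grp: "group G" "group H" by (simp_all add: G_def H_def group_free_group)
  have gen: "free_gen y \<in> carrier H" for y by (simp add: H_def free_gen_carrier)
  obtain m where m: "\<forall>f. (\<forall>x. f x \<in> carrier G) \<longrightarrow> is_cp G m (eval_word G f W1)"
    "\<forall>a b. (\<forall>i. a i \<in> carrier H) \<and> (\<forall>i. b i \<in> carrier H) \<longrightarrow>
       (\<exists>\<rho>. (\<forall>x. \<rho> x \<in> carrier H) \<and> eval_word H \<rho> W1 = cprod H m a b)"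
    using quadratic_normal_form[OF grp q(1)] by blast
  obtain n where n: "\<forall>f. (\<forall>x. f x \<in> carrier G) \<longrightarrow> is_cp G n (eval_word G f W2)"
    "\<forall>a b. (\<forall>i. a i \<in> carrier H) \<and> (\<forall>i. b i \<in> carrier H) \<longrightarrow>
       (\<exists>\<rho>. (\<forall>x. \<rho> x \<in> carrier H) \<and> eval_word H \<rho> W2 = cprod H n a b)"
    using quadratic_normal_form[OF grp q(2)] by blast
  define f' where "f' y = [f y]" for y
  have f': "f' y \<in> carrier G" for y by (simp add: f'_def G_def free_group_carrier)
  have "eval_letter G f' l = [lab f l]" for l
    by (auto simp: eval_letter_def f'_def lab_def G_def free_group_inv free_group_carrier)
  then have ev: "eval_word G f' w = nf (map (lab f) w)" for w
    by (induction w) (simp_all add: eval_word_def G_def free_group_one free_group_mult nf_Cons)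
  have "is_cp G m (nf u)" "is_cp G n (nf v)"
    using m(1)[rule_format, of f'] n(1)[rule_format, of f'] f' by (simp_all add: ev s)
  moreover have "m + n \<le> g"
  proof -
    obtain \<rho> where \<rho>: "\<And>x. \<rho> x \<in> carrier H"
        "eval_word H \<rho> W1 = cprod H m (\<lambda>i. free_gen (SA i)) (\<lambda>i. free_gen (SB i))"
      using m(2)[rule_format, of "\<lambda>i. free_gen (SA i)" "\<lambda>i. free_gen (SB i)"] gen by blast
    obtain \<sigma> where \<sigma>: "\<And>x. \<sigma> x \<in> carrier H"
        "eval_word H \<sigma> W2 = cprod H n (\<lambda>i. free_gen (SA (m + i))) (\<lambda>i. free_gen (SB (m + i)))"
      using n(2)[rule_format, of "\<lambda>i. free_gen (SA (m + i))" "\<lambda>i. free_gen (SB (m + i))"] gen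
      by blast
    define \<tau> where "\<tau> y = (if y \<in> fst ` set W1 then \<rho> y else \<sigma> y)" for y
    have \<tau>: "\<tau> y \<in> carrier H" for y using \<rho>(1) \<sigma>(1) by (simp add: \<tau>_def)
    have "eval_word H \<tau> W1 = eval_word H \<rho> W1"
      by (rule eval_word_cong) (simp add: \<tau>_def)
    moreover have "eval_word H \<tau> W2 = eval_word H \<sigma> W2"
    proof (rule eval_word_cong)
      fix y assume "y \<in> fst ` set W2"
      then have "y \<notin> fst ` set W1" using disj by fastforce
      then show "\<tau> y = \<sigma> y" by (simp add: \<tau>_def)
    qed
    ultimately have "eval_word H \<tau> W = cprod H (m + n) (\<lambda>i. free_gen (SA i)) (\<lambda>i. free_gen (SB i))"
      by (simp add: s(1) eval_word_append[OF grp(2) \<tau>] \<rho>(2) \<sigma>(2) group.cprod_add[OF grp(2)] gen)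
    moreover have "is_cp H g (eval_word H \<tau> (nf W))"
      by (rule is_cp_hom[OF group_free_group grp(2) eval_word_hom[OF grp(2) \<tau>] W(3)])
    ultimately have "is_cp H g (cprod H (m + n) (\<lambda>i. free_gen (SA i)) (\<lambda>i. free_gen (SB i)))"
      by (simp add: eval_word_nf[OF grp(2) \<tau>])
    then show ?thesis unfolding H_def by (rule is_cp_standard_lower)
  qed
  ultimately show ?thesis unfolding G_def by blast
qed

section \<open>Counting the corners of a quadratic word\<close>

lemma split_at_two_positions:
  assumes "i < j" "j < length W"
  shows "W = take i W @ W ! i # take (j - Suc i) (drop (Suc i) W) @ W ! j # drop (Suc j) W"
    and "take j W = take (Suc i) W @ take (j - Suc i) (drop (Suc i) W)"
proof -
  show 2: "take j W = take (Suc i) W @ take (j - Suc i) (drop (Suc i) W)"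
    using assms by (metis Suc_leI le_add_diff_inverse take_add)
  have "W = take j W @ W ! j # drop (Suc j) W" using assms(2) by (rule id_take_nth_drop)
  also have "take j W = take i W @ W ! i # take (j - Suc i) (drop (Suc i) W)"
    using assms unfolding 2 by (simp add: take_Suc_conv_app_nth)
  finally show "W = take i W @ W ! i # take (j - Suc i) (drop (Suc i) W) @ W ! j # drop (Suc j) W"
    by simp
qed

text \<open>The corners of the polygon with boundary word \<open>W\<close> are the cut points \<open>0, \<dots>, n\<close>, and gluing
  letter \<open>k\<close> to letter \<open>p k\<close> identifies corner \<open>k + 1\<close> with corner \<open>p k\<close>. Instead of vertices
  we use the possibly coarser classes of corners on which all the height functions \<open>h C\<close>
  given by the radical agree. A class with at most two elements forces \<open>p (k - 1) = p k + 1\<close>,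
  and the Euler characteristic bounds the number of the remaining corners.\<close>

lemma card_bad_corners:
  assumes "quadratic W" "is_cp FU g (nf W)"
    and p: "\<And>k. k < length W \<Longrightarrow> p k < length W \<and> W ! p k = letter_inv (W ! k)"
  shows "card {k. 0 < k \<and> k < length W \<and> p (k - 1) \<noteq> p k + 1}
    \<le> 3 * (4 * g + card {k. 0 < k \<and> k < length W \<and> p (k - 1) = k})"
    (is "card ?bad \<le> 3 * (4 * g + card ?sing)")
proof (cases "W = []")
  case False
  define n where "n = length W"
  have n: "0 < n" using False by (simp add: n_def)
  have d: "distinct W" using assms(1) by (simp add: quadratic_def)
  have pp: "p (p k) = k" if "k < n" for k
    using p[of k] p[of "p k"] that d nth_eq_iff_index_eq[of W "p (p k)" k] by (auto simp: n_def)
  have pn: "p k < n" "W ! p k = letter_inv (W ! k)" if "k < n" for k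
    using p[of k] that by (auto simp: n_def)
  have pneq: "p k \<noteq> k" if "k < n" for k using pn(2)[OF that] by (metis letter_inv_neq(1))
  obtain T where T: "finite T" "card T \<le> 2 * g"
    "\<And>C D. (\<forall>u\<in>T. \<not> par C u) \<Longrightarrow> heis_rep C D W = (False, False, False)"
    using is_cp_radical[OF assms(2)] by (auto simp: heis_rep_nf)
  define X where "X = fst ` set W"
  define K where "K = {C. C \<subseteq> X \<and> (\<forall>u\<in>T. \<not> par C u)}"
  define h where "h C k = par C (take k W)" for C k
  define sig where "sig k = {C \<in> K. h C k}" for k
  define Q where "Q = sig ` {0..n}"
  have K: "finite K" unfolding K_def X_def by (rule finite_subset[of _ "Pow (fst ` set W)"]) auto
  have hstep: "h C (Suc k) = (h C k \<noteq> (fst (W ! k) \<in> C))" if "k < n" for C k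
    using that by (simp add: h_def n_def take_Suc_conv_app_nth par_append)
  \<comment> \<open>The letters strictly between two glued sides have even \<open>C\<close>-parity,
    because \<open>C\<close> pairs trivially with the generator of these sides.\<close>
  have lt: "h C (p i) = h C (Suc i)" if C: "C \<in> K" and i: "i < n" "i < p i" for C i
  proof -
    define M where "M = take (p i - Suc i) (drop (Suc i) W)"
    note s = split_at_two_positions[OF i(2), of W, folded M_def]
    have "W = take i W @ W ! i # M @ letter_inv (W ! i) # drop (Suc (p i)) W"
      using s(1) pn[OF i(1)] by (simp add: n_def)
    then have "\<not> par C M"
      using heis_rep_interval[of "take i W" "W ! i" M "drop (Suc (p i)) W" C] d
        T(3)[of C "{fst (W ! i)}"] C by (simp add: K_def)
    then show ?thesis using s(2) pn(1)[OF i(1)] by (simp add: h_def par_append n_def)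
  qed
  have key: "h C (Suc k) = h C (p k)" if C: "C \<in> K" and k: "k < n" for C k
  proof (cases "k < p k")
    case False
    then have "p k < k" using pneq[OF k] by simp
    then have "h C k = h C (Suc (p k))" using lt[OF C pn(1)[OF k]] pp[OF k] by simp
    then show ?thesis using hstep[OF k, of C] hstep[OF pn(1)[OF k], of C] pn(2)[OF k] by auto
  qed (use lt[OF C k] in simp)
  have sig: "sig (Suc k) = sig (p k)" if "k < n" for k using key that by (auto simp: sig_def)
  have Q: "finite Q" "sig 0 \<in> Q" "\<And>k. k \<le> n \<Longrightarrow> sig k \<in> Q"
    by (auto simp: Q_def)
  \<comment> \<open>The heights at all corners determine \<open>C\<close>, as consecutive heights
    differ by one letter. They are recorded by the set of classes that contain \<open>C\<close>, and
    the class of corner 0 never does.\<close>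
  have "card K \<le> card (Pow (Q - {sig 0}))"
  proof (rule card_inj_on_le)
    show "finite (Pow (Q - {sig 0}))" using Q(1) by simp
    have "sig 0 = {}" by (simp add: sig_def h_def)
    then show "(\<lambda>C. {s \<in> Q. C \<in> s}) ` K \<subseteq> Pow (Q - {sig 0})" by auto
    show "inj_on (\<lambda>C. {s \<in> Q. C \<in> s}) K"
    proof (rule inj_onI)
      fix C D assume CD: "C \<in> K" "D \<in> K" "{s \<in> Q. C \<in> s} = {s \<in> Q. D \<in> s}"
      have heq: "h C k = h D k" if "k \<le> n" for k
      proof -
        have "h C k \<longleftrightarrow> sig k \<in> {s \<in> Q. C \<in> s}" "h D k \<longleftrightarrow> sig k \<in> {s \<in> Q. D \<in> s}"
          using Q(3)[OF that] CD(1,2) by (auto simp: sig_def)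
        then show ?thesis using CD(3) by simp
      qed
      have "x \<in> C \<longleftrightarrow> x \<in> D" if x: "x \<in> X" for x
      proof -
        obtain k where k: "k < n" "x = fst (W ! k)"
          using x by (auto simp: X_def in_set_conv_nth n_def)
        show ?thesis
          using hstep[OF k(1), of C] hstep[OF k(1), of D] heq[of k] heq[of "Suc k"] k by auto
      qed
      then show "C = D" using CD(1,2) by (auto simp: K_def)
    qed
  qed
  also have "\<dots> = 2 ^ (card Q - 1)" using Q by (simp add: card_Pow)
  finally have cK: "card K \<le> 2 ^ (card Q - 1)" .
  have "(2::nat) ^ card X \<le> 2 ^ card T * card K"
    unfolding K_def by (rule card_radical) (use T(1) in \<open>simp_all add: X_def\<close>)
  also have "\<dots> \<le> 2 ^ (2 * g) * 2 ^ (card Q - 1)"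
    by (intro mult_mono cK power_increasing T(2)) auto
  also have "\<dots> = 2 ^ (2 * g + (card Q - 1))" by (simp add: power_add)
  finally have "card X \<le> 2 * g + (card Q - 1)" by simp
  moreover have "0 < card Q" using Q(1,2) by (auto simp: card_gt_0_iff)
  \<comment> \<open>The Euler characteristic estimate: with one face and \<open>card X\<close> edges
    there are at least \<open>card X + 1 - 2 * g\<close> classes.\<close>
  ultimately have V: "card X + 1 \<le> 2 * g + card Q" by simp
  have "set W = X \<times> UNIV"
  proof -
    have "(x, b) \<in> set W" if "(x, c) \<in> set W" for x b c
      using quadraticD[OF assms(1) that] that by (cases "b = c") (auto simp: letter_inv_def)
    then show ?thesis by (force simp: X_def)
  qed
  then have nX: "n = 2 * card X"
    using distinct_card[OF d] by (simp add: n_def card_cartesian_product)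
  define fib where "fib s = {k \<in> {0..n}. sig k = s}" for s
  define c where "c s = card (fib s)" for s
  have sum: "n + 1 = (\<Sum>s\<in>Q. c s)"
    using sum.image_gen[of "{0..n}" "\<lambda>_. 1::nat" sig] by (simp add: Q_def c_def fib_def)
  have ffib: "finite (fib s)" for s by (simp add: fib_def)
  have c1: "1 \<le> c s" if s: "s \<in> Q" for s
  proof -
    have "fib s \<noteq> {}" using s by (auto simp: Q_def fib_def)
    then show ?thesis using ffib[of s] by (simp add: c_def Suc_le_eq card_gt_0_iff)
  qed
  \<comment> \<open>The corners \<open>k\<close>, \<open>p (k - 1)\<close> and
    \<open>p k + 1\<close> always share a class; at a bad corner they are three different
    ones.\<close>
  have "?bad \<subseteq> (\<Union>s\<in>{s \<in> Q. 3 \<le> c s}. fib s)"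
  proof
    fix k assume "k \<in> ?bad"
    then have k: "0 < k" "k < n" "p (k - 1) \<noteq> p k + 1" by (auto simp: n_def)
    then have k1: "k - 1 < n" by simp
    have s1: "sig (p (k - 1)) = sig k" using sig[OF k1] k(1) by simp
    have s2: "sig (Suc (p k)) = sig k" using sig[OF pn(1)[OF k(2)]] pp[OF k(2)] by simp
    have "p (k - 1) \<noteq> k" using pp[OF k1] k by auto
    moreover have "Suc (p k) \<noteq> k"
    proof
      assume e: "Suc (p k) = k"
      then have "k - 1 = p k" by simp
      then show False using pp[OF k(2)] k(3) e by simp
    qed
    moreover have "{k, p (k - 1), Suc (p k)} \<subseteq> fib (sig k)"
      using k(2) pn(1)[OF k1] pn(1)[OF k(2)] s1 s2 by (auto simp: fib_def)
    ultimately have "3 \<le> c (sig k)"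
      using card_mono[OF ffib[of "sig k"], of "{k, p (k - 1), Suc (p k)}"] k(3)
      by (auto simp: c_def card_insert_if split: if_splits)
    then show "k \<in> (\<Union>s\<in>{s \<in> Q. 3 \<le> c s}. fib s)"
      using k(2) by (auto simp: fib_def Q_def)
  qed
  then have "card ?bad \<le> card (\<Union>s\<in>{s \<in> Q. 3 \<le> c s}. fib s)"
    by (rule card_mono[rotated]) (use Q(1) ffib in auto)
  also have "\<dots> \<le> (\<Sum>s\<in>{s \<in> Q. 3 \<le> c s}. c s)"
    unfolding c_def by (rule card_UN_le) (use Q(1) in simp)
  also have "\<dots> = (\<Sum>s\<in>Q. if 3 \<le> c s then c s else 0)"
    using Q(1) by (simp add: sum.If_cases Int_def)
  finally have "int (card ?bad) \<le> (\<Sum>s\<in>Q. int (if 3 \<le> c s then c s else 0))"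
    by (simp flip: of_nat_sum)
  \<comment> \<open>A class of size \<open>c\<close> at least 3 satisfies
    \<open>c \<le> 3 * (c - 2)\<close>, a class of size 2 contributes 0, and the last term
    compensates a class of size 1. The sum of \<open>c s - 2\<close> is governed by the Euler
    characteristic.\<close>
  also have "\<dots> \<le> (\<Sum>s\<in>Q. 3 * (int (c s) - 2) + 3 * (if c s = 1 then 1 else 0))"
  proof (rule sum_mono)
    fix s assume "s \<in> Q"
    from c1[OF this] have "c s = 1 \<or> c s = 2 \<or> 3 \<le> c s" by linarith
    then show "int (if 3 \<le> c s then c s else 0)
      \<le> 3 * (int (c s) - 2) + 3 * (if c s = 1 then 1 else 0)" by auto
  qed
  also have "\<dots> = 3 * ((\<Sum>s\<in>Q. int (c s)) - 2 * int (card Q))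
      + 3 * (\<Sum>s\<in>Q. if c s = 1 then 1 else 0)"
    by (simp add: sum.distrib sum_subtractf flip: sum_distrib_left)
  also have "(\<Sum>s\<in>Q. int (c s)) = int n + 1" using sum by (simp flip: of_nat_sum)
  also have "(\<Sum>s\<in>Q. if c s = 1 then 1 else 0) = int (card {s \<in> Q. c s = 1})"
    using Q(1) by (simp add: sum.If_cases Int_def)
  also have "card {s \<in> Q. c s = 1} \<le> card ?sing"
  proof -
    \<comment> \<open>A class \<open>{k}\<close> forces \<open>p (k - 1) = k\<close>, i.e. two
      adjacent sides glued to each other. Corner 0 is never alone, as it shares its class with
      \<open>Suc (p 0)\<close>.\<close>
    have "{s \<in> Q. c s = 1} \<subseteq> sig ` ?sing"
    proof
      fix s assume s: "s \<in> {s \<in> Q. c s = 1}"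
      then obtain k where k: "fib s = {k}" by (auto simp: c_def card_1_singleton_iff)
      then have "k \<in> fib s" by simp
      then have kn: "k \<le> n" "sig k = s" by (auto simp: fib_def)
      have un: "j = k" if "j \<le> n" "sig j = s" for j using k that by (auto simp: fib_def)
      have "k \<noteq> 0"
      proof
        assume "k = 0"
        then have "sig (Suc (p 0)) = s" using sig[OF pn(1)[OF n]] pp[OF n] kn by simp
        then show False using un[of "Suc (p 0)"] pn(1)[OF n] \<open>k = 0\<close> by simp
      qed
      then have k1: "k - 1 < n" "Suc (k - 1) = k" using kn(1) by auto
      have "sig (p (k - 1)) = s" using sig[OF k1(1)] unfolding k1(2) kn(2) by (rule sym)
      then have "p (k - 1) = k" by (rule un[rotated]) (use pn(1)[OF k1(1)] in simp)
      moreover have "p (k - 1) < n" by (rule pn(1)[OF k1(1)])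
      ultimately show "s \<in> sig ` ?sing" using \<open>k \<noteq> 0\<close> kn(2) by (auto simp: n_def)
    qed
    then have "card {s \<in> Q. c s = 1} \<le> card (sig ` ?sing)" by (rule card_mono[rotated]) simp
    also have "\<dots> \<le> card ?sing" by (rule card_image_le) simp
    finally show ?thesis .
  qed
  finally have "int (card ?bad) \<le> 3 * (int n + 1 - 2 * int (card Q)) + 3 * int (card ?sing)"
    by simp
  also have "\<dots> \<le> 3 * (4 * int g) + 3 * int (card ?sing)"
    using V nX by (intro add_right_mono mult_left_mono) auto
  also have "\<dots> = int (3 * (4 * g + card ?sing))" by simp
  finally show ?thesis by (simp only: of_nat_le_iff)
qed simp

section \<open>A genus-preserving embedding\<close>

locale two_letters =
  fixes \<alpha> \<beta> :: 'x
  assumes ab: "\<alpha> \<noteq> \<beta>"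
begin

definition pat :: "nat \<Rightarrow> 'x letter list" where
  "pat d = (\<alpha>, False) # replicate d (\<beta>, False) @ [(\<alpha>, False)]"

definition core :: "nat list \<Rightarrow> 'x letter list" where
  "core ds = (\<alpha>, False) # concat (map (\<lambda>d. replicate d (\<beta>, False) @ [(\<alpha>, False)]) ds)"

definition blk :: "nat \<Rightarrow> nat list \<Rightarrow> nat \<Rightarrow> 'x letter list" where
  "blk s ds t = replicate s (\<beta>, False) @ core ds @ replicate t (\<beta>, True)"

definition occ :: "nat \<Rightarrow> 'x letter list \<Rightarrow> nat \<Rightarrow> bool" where
  "occ d w k \<longleftrightarrow> (\<exists>P Q. w = P @ pat d @ Q \<and> length P = k)"

lemma length_pat [simp]: "length (pat d) = d + 2" by (simp add: pat_def)

lemma occ_nth: "occ d w k \<longleftrightarrow> k + d + 2 \<le> length w \<and> (\<forall>j<d+2. w ! (k + j) = pat d ! j)"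
proof
  assume "occ d w k"
  then show "k + d + 2 \<le> length w \<and> (\<forall>j<d+2. w ! (k + j) = pat d ! j)"
    by (auto simp: occ_def nth_append)
next
  assume a: "k + d + 2 \<le> length w \<and> (\<forall>j<d+2. w ! (k + j) = pat d ! j)"
  have "take (d + 2) (drop k w) = pat d" by (rule nth_equalityI) (use a in auto)
  then have "w = take k w @ pat d @ drop (d + 2) (drop k w)" by (metis append_take_drop_id)
  then show "occ d w k" using a unfolding occ_def by (metis add_leD1 length_take min.absorb2)
qed

lemma core_Nil [simp]: "core [] = [(\<alpha>, False)]" by (simp add: core_def)

lemma core_Cons: "core (d # ds) = (\<alpha>, False) # replicate d (\<beta>, False) @ core ds"
  by (simp add: core_def)

text \<open>Neighbouring patterns share the letter \<open>\<alpha>\<close> between them, hence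
  \<open>butlast\<close> and \<open>tl\<close>.\<close>

lemma core_append: "core (ds1 @ d # ds2) =
   butlast (core ds1) @ pat d @ tl (core ds2)"
proof (induction ds1)
  case Nil
  show ?case by (simp add: core_Cons pat_def) (simp add: core_def)
next
  case (Cons d1 ds1)
  have "core ds1 \<noteq> []" by (simp add: core_def)
  then show ?case using Cons by (simp add: core_Cons butlast_append)
qed

lemma strip_replicate:
  assumes "replicate s b @ X = P @ a # Y" "a \<noteq> b"
  shows "\<exists>P'. P = replicate s b @ P' \<and> X = P' @ a # Y" using assms
proof (induction s arbitrary: P)
  case (Suc s)
  then show ?case by (cases P) auto
qed simp

lemma replicate_append_inject:
  "replicate m b @ a # X = replicate n b @ a # Y \<Longrightarrow> a \<noteq> b \<Longrightarrow> m = n"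
proof (induction m arbitrary: n)
  case 0
  then show ?case by (cases n) auto
next
  case (Suc m)
  then show ?case by (cases n) auto
qed

lemma core_occ:
  assumes "core ds @ replicate t (\<beta>, True) = P @ pat d @ Q"
  shows "\<exists>ds1 ds2. ds = ds1 @ d # ds2 \<and> P @ [(\<alpha>, False)] = core ds1" using assms
proof (induction ds arbitrary: P)
  case Nil
  have "(\<alpha>, False) \<notin> set (replicate t (\<beta>, True))" by auto
  moreover have "(\<alpha>, False) \<in> set (replicate t (\<beta>, True))"
  proof (cases P)
    case Nil
    then have "replicate t (\<beta>, True) = replicate d (\<beta>, False) @ (\<alpha>, False) # Q"
      using Nil.prems by (simp add: pat_def)
    then show ?thesis by (metis in_set_conv_decomp)
  next
    case (Cons x P')
    then have "replicate t (\<beta>, True)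
        = P' @ (\<alpha>, False) # replicate d (\<beta>, False) @ (\<alpha>, False) # Q"
      using Nil.prems by (simp add: pat_def)
    then show ?thesis by (metis in_set_conv_decomp)
  qed
  ultimately show ?case by blast
next
  case (Cons d0 ds)
  have eq: "(\<alpha>, False) # replicate d0 (\<beta>, False) @ core ds @ replicate t (\<beta>, True)
      = P @ (\<alpha>, False) # replicate d (\<beta>, False) @ (\<alpha>, False) # Q"
    using Cons.prems by (simp add: core_Cons pat_def)
  show ?case
  proof (cases P)
    case Nil
    obtain C where "core ds = (\<alpha>, False) # C" by (simp add: core_def)
    then have "replicate d0 (\<beta>, False) @ (\<alpha>, False) # (C @ replicate t (\<beta>, True))
        = replicate d (\<beta>, False) @ (\<alpha>, False) # Q" using eq Nil by simp
    then have "d0 = d" by (rule replicate_append_inject) (use ab in simp)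
    then show ?thesis using Nil by (intro exI[of _ "[]"] exI[of _ ds]) simp
  next
    case P: (Cons x P3)
    then have "replicate d0 (\<beta>, False) @ (core ds @ replicate t (\<beta>, True))
        = P3 @ (\<alpha>, False) # replicate d (\<beta>, False) @ (\<alpha>, False) # Q"
      using eq by simp
    then obtain P4 where P4: "P3 = replicate d0 (\<beta>, False) @ P4"
      "core ds @ replicate t (\<beta>, True)
        = P4 @ (\<alpha>, False) # replicate d (\<beta>, False) @ (\<alpha>, False) # Q"
      using strip_replicate[of d0 "(\<beta>, False)" _ P3 "(\<alpha>, False)"] ab by fastforce
    then obtain ds1 ds2 where "ds = ds1 @ d # ds2" "P4 @ [(\<alpha>, False)] = core ds1"
      using Cons.IH[of P4] by (auto simp: pat_def)
    moreover have "x = (\<alpha>, False)" using eq P by simp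
    ultimately show ?thesis using P P4(1)
      by (intro exI[of _ "d0 # ds1"] exI[of _ ds2]) (simp add: core_Cons)
  qed
qed

text \<open>The leading letters precede the first \<open>\<alpha>\<close> and the trailing ones have
  the wrong sign, so only a listed gap gives an occurrence. The \<open>+ 1\<close> is due to the
  last letter of \<open>core ds1\<close>, which is also the first letter of the pattern.\<close>

lemma blk_occ:
  assumes "blk s ds t = P @ pat d @ Q"
  shows "\<exists>ds1 ds2. ds = ds1 @ d # ds2 \<and> length P + 1 = s + length (core ds1)"
proof -
  obtain P' where P': "P = replicate s (\<beta>, False) @ P'"
    "core ds @ replicate t (\<beta>, True) = P' @ pat d @ Q"
    using strip_replicate[of s "(\<beta>, False)" "core ds @ replicate t (\<beta>, True)" P "(\<alpha>, False)"
        "replicate d (\<beta>, False) @ (\<alpha>, False) # Q"] assms ab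
    by (auto simp: blk_def pat_def)
  obtain ds1 ds2 where d: "ds = ds1 @ d # ds2" "P' @ [(\<alpha>, False)] = core ds1"
    using core_occ[OF P'(2)] by blast
  from arg_cong[OF d(2), of length] show ?thesis using d(1) P'(1) by auto
qed

lemma reduced_same_sign: "\<forall>l\<in>set w. snd l = b \<Longrightarrow> reduced w"
proof (induction w)
  case (Cons l w)
  then have "w \<noteq> [] \<Longrightarrow> snd (hd w) = b" "snd l = b" by auto
  then have "w \<noteq> [] \<Longrightarrow> hd w \<noteq> letter_inv l" by (auto simp: letter_inv_def)
  then show ?case using Cons by (simp add: reduced_Cons)
qed simp

lemma core_sign: "l \<in> set (core ds) \<Longrightarrow> snd l = False"
  by (auto simp: core_def split: if_splits)

lemma last_core: "last (core ds) = (\<alpha>, False)"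
proof (induction ds)
  case (Cons d ds)
  have "core ds \<noteq> []" by (simp add: core_def)
  then show ?case using Cons by (simp add: core_Cons)
qed simp

lemma reduced_blk: "reduced (blk s ds t)"
proof -
  have 1: "reduced (replicate s (\<beta>, False) @ core ds)"
    by (rule reduced_same_sign[of _ False]) (auto dest: core_sign)
  have 2: "reduced (replicate t (\<beta>, True))" by (rule reduced_same_sign[of _ True]) auto
  have "last (replicate s (\<beta>, False) @ core ds) = (\<alpha>, False)"
    using last_core[of ds] by (simp add: core_def)
  then have "reduced ((replicate s (\<beta>, False) @ core ds) @ replicate t (\<beta>, True))"
    using ab 1 2 by (subst reduced_append) (auto simp: letter_inv_def)
  then show ?thesis by (simp add: blk_def)
qed

end

definition backtracks :: "'x letter list \<Rightarrow> nat set" where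
  "backtracks w = {k. 0 < k \<and> k < length w \<and> w ! k = letter_inv (w ! (k - 1))}"

text \<open>No letter of a reduced block is followed in it by its inverse, so besides
  \<open>v\<close> only the seam at \<open>length u\<close> counts.\<close>

lemma card_backtracks_append:
  assumes "reduced u"
  shows "card (backtracks (u @ v)) \<le> 1 + card (backtracks v)"
proof -
  have "backtracks (u @ v) \<subseteq> insert (length u) ((+) (length u) ` backtracks v)"
  proof
    fix k assume k: "k \<in> backtracks (u @ v)"
    show "k \<in> insert (length u) ((+) (length u) ` backtracks v)"
    proof (cases "k < length u")
      case True
      then have "u ! Suc (k - 1) \<noteq> letter_inv (u ! (k - 1))"
        using k assms successively_nth[of "\<lambda>l m. m \<noteq> letter_inv l" u "k - 1"]
        by (simp add: backtracks_def reduced_def)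
      moreover have "k - 1 < length u" using True by simp
      ultimately show ?thesis using k True by (simp add: backtracks_def nth_append)
    next
      case False
      define j where "j = k - length u"
      have j: "k = length u + j" using False by (simp add: j_def)
      show ?thesis
      proof (cases j)
        case (Suc i)
        then have "j \<in> backtracks v" using k j by (simp add: backtracks_def nth_append)
        then show ?thesis using j by simp
      qed (use j in simp)
    qed
  qed
  moreover have "finite (backtracks v)" by (simp add: backtracks_def)
  ultimately have "card (backtracks (u @ v)) \<le> card (insert (length u) ((+) (length u) ` backtracks v))"
    by (intro card_mono) auto
  also have "\<dots> \<le> 1 + card (backtracks v)"
    using \<open>finite (backtracks v)\<close> card_image_le[of "backtracks v" "(+) (length u)"]
    by (simp add: card_insert_if)
  finally show ?thesis .
qed

lemma card_backtracks_concat: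
  "\<forall>l\<in>set z. reduced (f l) \<Longrightarrow> card (backtracks (concat (map f z))) \<le> length z"
proof (induction z)
  case Nil
  show ?case by (simp add: backtracks_def)
next
  case (Cons l z)
  then show ?case using card_backtracks_append[of "f l" "concat (map f z)"] by simp
qed

text \<open>The generator \<open>i\<close> is sent to \<open>b\<^sup>s a b\<^bsup>d\<^sub>0\<^esup> a \<dots> b\<^bsup>d\<^sub>K\<^sub>-\<^sub>1\<^esup> a b\<^sup>-\<^sup>t\<close> where all the gaps \<open>d\<^sub>r\<close>, over all
  generators, are distinct and exceed all the exponents \<open>s\<close>. The total exponent of \<open>b\<close> vanishes.\<close>

locale block_code = two_letters \<alpha> \<beta> for \<alpha> \<beta> :: 'x +
  fixes I :: "'i set" and idx :: "'i \<Rightarrow> nat" and N K :: nat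
  assumes idx_inj: "inj_on idx I" and idx_less: "i \<in> I \<Longrightarrow> idx i < N"
begin

text \<open>Dividing \<open>gap i r - 1\<close> by \<open>N\<close> gives remainder
  \<open>idx i\<close> and quotient \<open>r + 1\<close>, so all gaps differ. The shift to
  \<open>r + 1\<close> makes them exceed \<open>N\<close>, hence every leading exponent
  \<open>idx i + 1\<close>.\<close>

definition gap :: "'i \<Rightarrow> nat \<Rightarrow> nat" where
  "gap i r = N * (r + 1) + idx i + 1"

definition gaps :: "'i \<Rightarrow> nat list" where
  "gaps i = map (gap i) [0..<K]"

definition code :: "'i \<Rightarrow> 'x letter list" where
  "code i = blk (idx i + 1) (gaps i) (idx i + 1 + sum_list (gaps i))"

definition lcode :: "'i letter \<Rightarrow> 'x letter list" where
  "lcode l = (if snd l then winv (code (fst l)) else code (fst l))"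

abbreviation "enc z \<equiv> concat (map lcode z)"

lemma gap_inj:
  assumes "gap i r = gap j q" "i \<in> I" "j \<in> I"
  shows "i = j" "r = q"
proof -
  have e: "N * (r + 1) + idx i = N * (q + 1) + idx j" using assms(1) by (simp add: gap_def)
  have "(N * (r + 1) + idx i) mod N = idx i" "(N * (q + 1) + idx j) mod N = idx j"
    by (simp_all only: mod_mult_self4 mod_less idx_less assms(2,3))
  then have "idx i = idx j" using e by metis
  then show "i = j" using assms(2,3) idx_inj by (auto simp: inj_on_def)
  have "N \<noteq> 0" using idx_less[OF assms(2)] by auto
  then show "r = q" using e \<open>idx i = idx j\<close> by simp
qed

lemma reduced_code: "reduced (code i)" by (simp add: code_def reduced_blk)

lemma reduced_lcode: "reduced (lcode l)" by (simp add: lcode_def reduced_code reduced_winv)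

lemma lcode_letter_inv: "lcode (letter_inv l) = winv (lcode l)"
  by (simp add: lcode_def letter_inv_def rev_map)

lemma winv_enc: "winv (enc z) = enc (winv z)" by (induction z) (simp_all add: lcode_letter_inv)

lemma last_lcode: "last (lcode l) = (\<beta>, True)"
  by (simp add: lcode_def code_def blk_def last_rev hd_append letter_inv_def)

lemma negative_lcode: "(\<alpha>, False) \<notin> set (winv (code i))"
  using ab core_sign[of "(\<alpha>, True)" "gaps i"] by (auto simp: code_def blk_def letter_inv_def)

lemma pat_set: "(\<alpha>, False) \<in> set (pat d)" "(\<beta>, True) \<notin> set (pat d)"
  by (auto simp: pat_def)

text \<open>An occurrence cannot straddle two blocks: every block, inverted or not, ends in the
  inverse of \<open>\<beta>\<close>, a letter absent from the pattern. Nor can it lie in an inverted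
  block, which contains no positive \<open>\<alpha>\<close>.\<close>

lemma enc_occ:
  assumes "enc z = P @ pat d @ Q"
  shows "\<exists>z1 i z2 P' Q'. z = z1 @ (i, False) # z2 \<and> P = enc z1 @ P' \<and> code i = P' @ pat d @ Q'"
  using assms
proof (induction z arbitrary: P)
  case Nil
  then show ?case by (simp add: pat_def)
next
  case (Cons l z)
  have step: ?case if P: "P = lcode l @ us" and z: "enc z = us @ pat d @ Q" for us
  proof -
    obtain z1 i z2 P' Q' where "z = z1 @ (i, False) # z2" "us = enc z1 @ P'"
        "code i = P' @ pat d @ Q'" using Cons.IH[OF z] by blast
    then show ?thesis using P
      by (intro exI[of _ "l # z1"] exI[of _ i] exI[of _ z2] exI[of _ P'] exI[of _ Q']) simp
  qed
  have inside: ?case if "lcode l = P @ pat d @ vs" for vs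
  proof -
    have "(\<alpha>, False) \<in> set (lcode l)" using that pat_set by simp
    then have "snd l = False" using negative_lcode by (auto simp: lcode_def)
    then have "l = (fst l, False)" "lcode l = code (fst l)" by (auto simp: lcode_def prod_eq_iff)
    then show ?thesis using that
      by (intro exI[of _ "[]"] exI[of _ "fst l"] exI[of _ z] exI[of _ P] exI[of _ vs]) simp
  qed
  from Cons.prems have "lcode l @ enc z = P @ pat d @ Q" by simp
  then consider us where "lcode l = P @ us" "us @ enc z = pat d @ Q"
    | us where "P = lcode l @ us" "enc z = us @ pat d @ Q" by (auto simp: append_eq_append_conv2)
  then show ?case
  proof cases
    case 1
    from 1(2) consider vs where "us = pat d @ vs"
      | vs where "us @ vs = pat d" "enc z = vs @ Q"
      using append_eq_append_conv2[of us "enc z" "pat d" Q] by blast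
    then show ?thesis
    proof cases
      case (2 vs)
      show ?thesis
      proof (cases "us = []")
        case True
        then show ?thesis using step[of "[]"] 1 by simp
      next
        case False
        then have "last us = (\<beta>, True)" using last_lcode[of l] 1(1) by simp
        then have "(\<beta>, True) \<in> set us" using False last_in_set by metis
        then have "(\<beta>, True) \<in> set (pat d)" by (simp flip: 2(1))
        then show ?thesis using pat_set by blast
      qed
    qed (use inside 1 in simp)
  qed (use step in blast)
qed

section \<open>Annotations: one marked letter per block\<close>

definition mark :: "nat \<Rightarrow> 'i \<Rightarrow> nat" where
  "mark r i = idx i + length (core (take r (gaps i)))"

text \<open>A list parallel to \<open>code i\<close>, carrying the generator at the first letter of
  the \<open>r\<close>-th gap pattern and nothing elsewhere. Keeping only the marked letters of
  \<open>enc z\<close> recovers \<open>z\<close>, see \<open>concat_anns\<close>.\<close>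

definition ann :: "nat \<Rightarrow> 'i \<Rightarrow> 'i letter list list" where
  "ann r i = (replicate (length (code i)) [])[mark r i := [(i, False)]]"

text \<open>In an inverted block the mark stays on the inverse of the same letter, now at the end of
  the inverted pattern.\<close>

definition lann :: "nat \<Rightarrow> 'i letter \<Rightarrow> 'i letter list list" where
  "lann r l = (if snd l then rev (map winv (ann r (fst l))) else ann r (fst l))"

abbreviation "anns r z \<equiv> concat (map (lann r) z)"

lemma length_lann: "length (lann r l) = length (lcode l)" by (simp add: lann_def lcode_def ann_def)

lemma length_anns: "length (anns r z) = length (enc z)" by (induction z) (simp_all add: length_lann)

lemma lann_letter_inv: "lann r (letter_inv l) = rev (map winv (lann r l))"
proof -
  have "rev (map winv (rev (map winv A))) = A" for A :: "'i letter list list"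
    by (induction A) simp_all
  then show ?thesis by (simp add: lann_def letter_inv_def)
qed

lemma anns_winv: "anns r (winv z) = rev (map winv (anns r z))"
  by (induction z) (simp_all add: lann_letter_inv)

lemma code_split:
  assumes "r < K"
  shows "\<exists>P Q. code i = P @ pat (gap i r) @ Q \<and> length P = mark r i"
proof -
  have "gaps i = take r (gaps i) @ gap i r # drop (Suc r) (gaps i)"
    using assms id_take_nth_drop[of r "gaps i"] by (simp add: gaps_def)
  then have "core (gaps i) = butlast (core (take r (gaps i))) @ pat (gap i r)
      @ tl (core (drop (Suc r) (gaps i)))" by (metis core_append)
  then have "code i = (replicate (idx i + 1) (\<beta>, False) @ butlast (core (take r (gaps i))))
      @ pat (gap i r) @ (tl (core (drop (Suc r) (gaps i))) @
      replicate (idx i + 1 + sum_list (gaps i)) (\<beta>, True))" by (simp add: code_def blk_def)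
  moreover have "0 < length (core (take r (gaps i)))" by (simp add: core_def)
  then have "length (replicate (idx i + 1) (\<beta>, False) @ butlast (core (take r (gaps i))))
      = mark r i" by (simp add: mark_def)
  ultimately show ?thesis by blast
qed

lemma mark_less: "r < K \<Longrightarrow> mark r i < length (code i)"
  using code_split[of r i] by auto

lemma concat_lann: "r < K \<Longrightarrow> concat (lann r l) = [l]"
proof -
  assume r: "r < K"
  have 1: "ann r i = replicate (mark r i) [] @ [(i, False)] # replicate (length (code i) - Suc (mark r i)) []"
    for i using mark_less[OF r, of i] by (simp add: ann_def upd_conv_take_nth_drop)
  have 2: "concat (replicate n []) = ([] :: 'i letter list)" for n by simp
  show ?thesis by (cases l) (auto simp: lann_def 1 2 letter_inv_def)
qed

lemma concat_anns: "r < K \<Longrightarrow> concat (anns r z) = z"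
  by (induction z) (simp_all add: concat_lann)

lemma anns_values:
  assumes "k < length (anns r z)"
  shows "anns r z ! k = [] \<or> (\<exists>i. i \<in> fst ` set z \<and>
     (anns r z ! k = [(i, False)] \<or> anns r z ! k = [(i, True)]))"
proof -
  obtain l where l: "l \<in> set z" "anns r z ! k \<in> set (lann r l)"
    using nth_mem[OF assms] by auto
  have "x \<in> {[], [(i, False)]}" if "x \<in> set (ann r i)" for x i
    using that set_update_subset_insert[of "replicate (length (code i)) []" "mark r i" "[(i, False)]"]
    by (auto simp: ann_def)
  then have "anns r z ! k \<in> {[], [(fst l, False)], [(fst l, True)]}"
    using l(2) by (fastforce simp: lann_def letter_inv_def split: if_splits)
  then show ?thesis using l(1) by auto
qed

text \<open>All gaps are distinct, so a pattern determines its generator and its place in the block.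
  The marks can thus be read off from the bare word, which is why a gluing of that word can respect
  them.\<close>

lemma anns_iff_occ:
  assumes "r < K" "fst ` set z \<subseteq> I" "i \<in> I" "k < length (enc z)"
  shows "anns r z ! k = [(i, False)] \<longleftrightarrow> occ (gap i r) (enc z) k"
proof
  assume "anns r z ! k = [(i, False)]"
  then show "occ (gap i r) (enc z) k" using assms(4)
  proof (induction z arbitrary: k)
    case (Cons l z)
    show ?case
    proof (cases "k < length (lcode l)")
      case True
      then have lk: "lann r l ! k = [(i, False)]"
        using Cons.prems by (simp add: nth_append length_lann)
      have l: "\<not> snd l"
      proof
        assume "snd l"
        then have "[(i, False)] \<in> winv ` set (ann r (fst l))"
          using lk True nth_mem[of k "lann r l"] by (simp add: length_lann) (simp add: lann_def)
        moreover have "set (ann r (fst l)) \<subseteq> {[], [(fst l, False)]}"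
          using set_update_subset_insert[of "replicate (length (code (fst l))) []" "mark r (fst l)"
              "[(fst l, False)]"] by (auto simp: ann_def)
        ultimately show False by (auto simp: letter_inv_def)
      qed
      then have "ann r (fst l) ! k = [(i, False)]" using lk by (simp add: lann_def)
      then have k: "k = mark r (fst l)" "fst l = i"
        using True l by (cases "k = mark r (fst l)"; simp add: ann_def lcode_def)+
      obtain P Q where "code i = P @ pat (gap i r) @ Q" "length P = mark r i"
        using code_split[OF assms(1)] by blast
      then show ?thesis
        using k l unfolding occ_def by (intro exI[of _ P] exI[of _ "Q @ enc z"]) (simp add: lcode_def)
    next
      case False
      then have "occ (gap i r) (enc z) (k - length (lcode l))"
        using Cons.prems by (intro Cons.IH) (auto simp: nth_append length_lann)
      then obtain P Q where "enc z = P @ pat (gap i r) @ Q" "length P = k - length (lcode l)"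
        by (auto simp: occ_def)
      then show ?thesis
        using False unfolding occ_def by (intro exI[of _ "lcode l @ P"] exI[of _ Q]) simp
    qed
  qed simp
next
  assume "occ (gap i r) (enc z) k"
  then obtain P Q where PQ: "enc z = P @ pat (gap i r) @ Q" "length P = k" by (auto simp: occ_def)
  obtain z1 j z2 P' Q' where z: "z = z1 @ (j, False) # z2" "P = enc z1 @ P'"
      "code j = P' @ pat (gap i r) @ Q'" using enc_occ[OF PQ(1)] by blast
  obtain ds1 ds2 where ds: "gaps j = ds1 @ gap i r # ds2"
      "length P' + 1 = idx j + 1 + length (core ds1)"
    using blk_occ[OF z(3)[unfolded code_def]] by blast
  have j: "j \<in> I" using assms(2) z(1) by auto
  have l: "length ds1 < length (gaps j)" using ds(1) by simp
  have "gap j (length ds1) = gaps j ! length ds1" using l by (simp add: gaps_def)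
  also have "\<dots> = gap i r" by (simp add: ds(1))
  finally have e: "i = j" "length ds1 = r" using gap_inj j assms(3) by auto
  then have "take r (gaps i) = ds1" using ds(1) by simp
  then have "length P' = mark r i" using ds(2) e by (simp add: mark_def)
  then have "k = length (anns r z1) + mark r i" using PQ(2) z(2) by (simp add: length_anns)
  then show "anns r z ! k = [(i, False)]" using mark_less[OF assms(1), of i] e
    by (simp add: z(1) nth_append length_lann lcode_def lann_def ann_def)
qed

text \<open>Ignoring signs covers the inverted occurrences as well, because the pattern is a
  palindrome.\<close>

definition uocc :: "nat \<Rightarrow> 'x letter list \<Rightarrow> nat \<Rightarrow> bool" where
  "uocc d w k \<longleftrightarrow> k + d + 2 \<le> length w \<and> (\<forall>j<d+2. fst (w ! (k + j)) = fst (pat d ! j))"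

lemma nth_pat: "j < d + 2 \<Longrightarrow>
    pat d ! j = (if j = 0 \<or> j = Suc d then (\<alpha>, False) else (\<beta>, False))"
  by (auto simp: pat_def nth_Cons nth_append split: nat.split)

lemma pat_palindrome: "j \<le> d + 1 \<Longrightarrow> pat d ! (d + 1 - j) = pat d ! j"
  by (auto simp: nth_pat)

text \<open>The ends are letters \<open>\<alpha>\<close> and everything between is
  \<open>\<beta>\<close>, so two occurrences around a common inner corner \<open>c\<close>
  coincide.\<close>

lemma uocc_unique:
  assumes u: "uocc d w k" "uocc d' w k'"
    and c: "k < c" "c \<le> k + d + 1" "k' < c" "c \<le> k' + d' + 1"
  shows "d = d'"
proof -
  have end0: "fst (w ! k) = \<alpha>" if "uocc d w k" for d k
    using that by (auto simp: uocc_def nth_pat dest: spec[of _ 0])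
  have end1: "fst (w ! (k + d + 1)) = \<alpha>" if "uocc d w k" for d k
    using that by (auto simp: uocc_def nth_pat dest: spec[of _ "Suc d"])
  have mid: "fst (w ! m) = \<beta>" if m: "uocc d w k" "k < m" "m < k + d + 1" for d k m
  proof -
    have "fst (w ! (k + (m - k))) = fst (pat d ! (m - k))"
      using m unfolding uocc_def by (metis (no_types, lifting) add_diff_inverse_nat add.assoc
          less_imp_le_nat linorder_not_le nat_add_left_cancel_less one_add_one trans_less_add1)
    then show ?thesis using m by (auto simp: nth_pat)
  qed
  have "k = k'"
  proof (rule linorder_cases[of k k'])
    assume "k < k'"
    then show ?thesis using mid[OF u(1), of k'] end0[OF u(2)] ab c by simp
  next
    assume "k' < k"
    then show ?thesis using mid[OF u(2), of k] end0[OF u(1)] ab c by simp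
  qed
  show ?thesis
  proof (rule linorder_cases[of d d'])
    assume "d < d'"
    then show ?thesis using mid[OF u(2), of "k + d + 1"] end1[OF u(1)] ab \<open>k = k'\<close> by simp
  next
    assume "d' < d"
    then show ?thesis using mid[OF u(1), of "k + d' + 1"] end1[OF u(2)] ab \<open>k = k'\<close> by simp
  qed
qed

text \<open>Pigeonhole over the \<open>K\<close> gap numbers: by \<open>uocc_unique\<close> a corner
  of \<open>B\<close> spoils at most one \<open>r\<close>.\<close>

lemma exists_good_gap:
  assumes "finite B" "card B < K"
  shows "\<exists>r<K. \<forall>i\<in>I. \<forall>k c. uocc (gap i r) w k \<and> k < c \<and> c \<le> k + gap i r + 1 \<longrightarrow> c \<notin> B"
proof (rule ccontr)
  assume "\<not> ?thesis"
  then have "\<forall>r. \<exists>i k c. r < K \<longrightarrow>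
      i \<in> I \<and> uocc (gap i r) w k \<and> k < c \<and> c \<le> k + gap i r + 1 \<and> c \<in> B"
    by blast
  then obtain i k c where c: "\<And>r. r < K \<Longrightarrow> i r \<in> I \<and> uocc (gap (i r) r) w (k r) \<and> k r < c r
      \<and> c r \<le> k r + gap (i r) r + 1 \<and> c r \<in> B" by metis
  have "inj_on c {..<K}"
  proof (rule inj_onI)
    fix r q assume rq: "r \<in> {..<K}" "q \<in> {..<K}" "c r = c q"
    then have "gap (i r) r = gap (i q) q"
      using c[of r] c[of q] uocc_unique[of "gap (i r) r" w "k r" "gap (i q) q" "k q" "c r"] by simp
    then show "r = q" using gap_inj(2) c rq(1,2) by blast
  qed
  then have "card {..<K} \<le> card B" using c assms(1) by (intro card_inj_on_le) auto
  then show False using assms(2) by simp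
qed

text \<open>Without bad corners inside an occurrence, \<open>p\<close> runs backwards along it, so
  the partners spell the inverse pattern of the same gap and the mark is glued to the mark of an
  oppositely oriented copy. Unmarked letters then have unmarked partners because \<open>p\<close> is
  an involution.\<close>

lemma pairing_anns:
  assumes p: "\<And>k. k < length (enc z) \<Longrightarrow> p k < length (enc z) \<and> p (p k) = k \<and>
      enc z ! p k = letter_inv (enc z ! k)"
    and "r < K" "fst ` set z \<subseteq> I"
    and good: "\<And>i k c. i \<in> I \<Longrightarrow> uocc (gap i r) (enc z) k \<Longrightarrow> k < c \<Longrightarrow> c \<le> k + gap i r + 1 \<Longrightarrow>
      p (c - 1) = p c + 1"
    and "k < length (enc z)"
  shows "anns r z ! p k = winv (anns r z ! k)"
proof -
  define w where "w = enc z"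
  define n where "n = length w"
  define A where "A = anns r z"
  have pn: "p k < n" "p (p k) = k" "w ! p k = letter_inv (w ! k)" if "k < n" for k
    using p[of k] that by (auto simp: w_def n_def)
  have An: "length A = n" by (simp add: A_def n_def w_def length_anns)
  have run: "p (k + j) + j = p k" if i: "i \<in> I" and u: "uocc (gap i r) w k" and j: "j \<le> gap i r + 1"
    for i k j using j
  proof (induction j)
    case (Suc j)
    then have "p (k + j) = p (k + Suc j) + 1" using good[OF i, of k "k + Suc j"] u by (simp add: w_def)
    then show ?case using Suc by simp
  qed simp
  have rev_nth': "winv xs ! (length xs - 1 - m) = letter_inv (xs ! m)"
    if "m < length xs" for xs :: "'x letter list" and m using that by (simp add: rev_nth)
  have Arev: "anns r (winv z) ! (n - 1 - m) = winv (A ! m)" if "m < n" for m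
    using that An unfolding anns_winv A_def[symmetric] by (simp add: rev_nth)
  have iff1: "A ! m = [(i, False)] \<longleftrightarrow> occ (gap i r) w m" if "m < n" "i \<in> I" for m i
    using anns_iff_occ[OF assms(2,3) that(2), of m] that(1) by (simp add: A_def w_def n_def)
  have len: "length (enc (winv z)) = n" unfolding winv_enc[symmetric] by (simp add: n_def w_def)
  have winvz: "fst ` set (winv z) \<subseteq> I" using assms(3) by (auto simp: image_image)
  have iff2: "A ! m = [(i, True)] \<longleftrightarrow> occ (gap i r) (winv w) (n - 1 - m)"
    if m: "m < n" "i \<in> I" for m i
  proof -
    have "A ! m = [(i, True)] \<longleftrightarrow> winv (A ! m) = winv [(i, True)]"
      by (metis winv_winv)
    also have "\<dots> \<longleftrightarrow> anns r (winv z) ! (n - 1 - m) = [(i, False)]"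
      unfolding Arev[OF m(1)] by (simp add: letter_inv_def)
    also have "\<dots> \<longleftrightarrow> occ (gap i r) (enc (winv z)) (n - 1 - m)"
      using anns_iff_occ[OF assms(2) winvz m(2), of "n - 1 - m"] m(1) len by simp
    finally show ?thesis unfolding w_def winv_enc .
  qed
  have F: "A ! p k = [(i, True)]" if k: "k < n" and i: "i \<in> I" and Ak: "A ! k = [(i, False)]" for k i
  proof -
    let ?d = "gap i r"
    have o: "occ ?d w k" using iff1[OF k i] Ak by simp
    then have u: "uocc ?d w k" by (simp add: occ_nth uocc_def)
    have "occ ?d (winv w) (n - 1 - p k)" unfolding occ_nth
    proof (intro conjI allI impI)
      have "p (k + (?d + 1)) + (?d + 1) = p k" by (rule run[OF i u]) simp
      then show "n - 1 - p k + ?d + 2 \<le> length (winv w)" using pn(1)[OF k] by (simp add: n_def)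
      fix j assume j: "j < ?d + 2"
      then have kj: "k + j < n" using o by (simp add: occ_nth n_def)
      have pj: "p (k + j) + j = p k" by (rule run[OF i u]) (use j in simp)
      then have "n - 1 - p k + j = length w - 1 - p (k + j)" using pn(1)[OF k] by (simp add: n_def)
      then have "winv w ! (n - 1 - p k + j) = letter_inv (w ! p (k + j))"
        using rev_nth'[of "p (k + j)" w] pn(1)[OF kj] by (simp add: n_def)
      also have "\<dots> = w ! (k + j)" using pn(3)[OF kj] by simp
      also have "\<dots> = pat ?d ! j" using o j by (simp add: occ_nth)
      finally show "winv w ! (n - 1 - p k + j) = pat ?d ! j" .
    qed
    then show ?thesis using iff2[OF pn(1)[OF k] i] by simp
  qed
  have T: "A ! p k = [(i, False)]" if k: "k < n" and i: "i \<in> I" and Ak: "A ! k = [(i, True)]" for k i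
  proof -
    let ?d = "gap i r"
    have o: "occ ?d (winv w) (n - 1 - k)" using iff2[OF k i] Ak by simp
    then have "n - 1 - k + ?d + 2 \<le> n" by (simp add: occ_nth n_def)
    then have kd: "?d + 1 \<le> k" using k by linarith
    have wk: "letter_inv (w ! (k - j)) = pat ?d ! j" if j: "j < ?d + 2" for j
    proof -
      have "n - 1 - k + j = length w - 1 - (k - j)" using j kd k by (simp add: n_def)
      moreover have "winv w ! (length w - 1 - (k - j)) = letter_inv (w ! (k - j))"
        by (rule rev_nth') (use k in \<open>simp add: n_def\<close>)
      moreover have "winv w ! (n - 1 - k + j) = pat ?d ! j" using o j unfolding occ_nth by blast
      ultimately show ?thesis by (simp only:)
    qed
    \<comment> \<open>The mark of an inverted occurrence is its last letter, so \<open>m\<close> is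
      where the occurrence starts.\<close>
    define m where "m = k - (?d + 1)"
    have m: "k = m + (?d + 1)" using kd by (simp add: m_def)
    have "uocc ?d w m" unfolding uocc_def
    proof (intro conjI allI impI)
      show "m + ?d + 2 \<le> length w" using k m by (simp add: n_def)
      fix j assume j: "j < ?d + 2"
      then have "letter_inv (w ! (m + j)) = pat ?d ! j"
        using wk[of "?d + 1 - j"] pat_palindrome[of j ?d] by (simp add: m)
      then show "fst (w ! (m + j)) = fst (pat ?d ! j)" by (metis fst_letter_inv)
    qed
    note run = run[OF i this]
    have mn: "m < n" using k m by simp
    have "p k + (?d + 1) = p m" using run[of "?d + 1"] m by simp
    have "occ ?d w (p k)" unfolding occ_nth
    proof (intro conjI allI impI)
      show "p k + ?d + 2 \<le> length w"
        using \<open>p k + (?d + 1) = p m\<close> pn(1)[OF mn] by (simp add: n_def)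
      fix j assume j: "j < ?d + 2"
      have "p (m + (?d + 1 - j)) + (?d + 1 - j) = p m" by (rule run) simp
      moreover have "m + (?d + 1 - j) = k - j" using m j by simp
      ultimately have "p k + j = p (k - j)" using \<open>p k + (?d + 1) = p m\<close> j by simp
      then show "w ! (p k + j) = pat ?d ! j" using pn(3)[of "k - j"] k wk[OF j] by simp
    qed
    then show ?thesis using iff1[OF pn(1)[OF k] i] by simp
  qed
  have FT: "A ! p k = winv (A ! k)" if k: "k < n" and ne: "A ! k \<noteq> []" for k
  proof -
    obtain i where i: "i \<in> I" "A ! k = [(i, False)] \<or> A ! k = [(i, True)]"
      using anns_values[of k r z] k ne An assms(3) unfolding A_def[symmetric] by auto
    then show ?thesis using F[OF k i(1)] T[OF k i(1)] by (auto simp: letter_inv_def)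
  qed
  have k: "k < n" using assms(5) by (simp add: n_def w_def)
  show ?thesis
  proof (cases "A ! k = []")
    case True
    have "A ! p k = []"
    proof (rule ccontr)
      assume "A ! p k \<noteq> []"
      then have "A ! p (p k) \<noteq> []" using FT[OF pn(1)[OF k]] by simp
      then show False using True pn(2)[OF k] by simp
    qed
    then show ?thesis using True by (simp add: A_def)
  qed (use FT[OF k] in \<open>simp add: A_def\<close>)
qed

text \<open>In a quadratic lift of \<open>enc z\<close>, some gap \<open>r\<close> meets no bad corner, so the letters starting the
  \<open>r\<close>-th gap are paired among themselves. Killing all other letters maps the lift to \<open>z\<close>.\<close>

lemma is_cp_decode:
  assumes "is_cp (free_group S) g (nf (enc z))" "fst ` set z \<subseteq> I" "3 * (4 * g + length z) < K"
  shows "is_cp FU g (nf z)"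
proof -
  obtain W :: "nat letter list" and f where W: "quadratic W" "map (lab f) W = enc z"
    "is_cp FU g (nf W)"
    using is_cp_imp_quadratic_lift[OF assms(1)] by (auto simp: quadratic_lift_def)
  define n where "n = length W"
  have n: "length (enc z) = n" using W(2) by (metis length_map n_def)
  have d: "distinct W" using W(1) by (simp add: quadratic_def)
  have "\<exists>j<n. W ! j = letter_inv (W ! k)" if "k < n" for k
    using quadraticD[OF W(1), of "W ! k"] that by (auto simp: n_def in_set_conv_nth)
  then obtain p where p: "\<And>k. k < n \<Longrightarrow> p k < n \<and> W ! p k = letter_inv (W ! k)" by metis
  have pp: "p (p k) = k" if "k < n" for k
    using p[of k] p[of "p k"] that d nth_eq_iff_index_eq[of W "p (p k)" k] by (auto simp: n_def)
  have enc: "enc z ! k = lab f (W ! k)" if "k < n" for k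
    using that by (simp add: W(2)[symmetric] n_def)
  define B where "B = {k. 0 < k \<and> k < n \<and> p (k - 1) \<noteq> p k + 1}"
  \<comment> \<open>The lift lives on the unreduced word \<open>enc z\<close>, whose adjacent sides
    can be glued to each other only at the seams between blocks.\<close>
  have "{k. 0 < k \<and> k < n \<and> p (k - 1) = k} \<subseteq> backtracks (enc z)"
  proof
    fix k assume "k \<in> {k. 0 < k \<and> k < n \<and> p (k - 1) = k}"
    then have k: "0 < k" "k < n" "p (k - 1) = k" by auto
    then have "W ! k = letter_inv (W ! (k - 1))" using p[of "k - 1"] by auto
    then show "k \<in> backtracks (enc z)"
      using k n enc[of k] enc[of "k - 1"] by (simp add: backtracks_def)
  qed
  then have "card {k. 0 < k \<and> k < n \<and> p (k - 1) = k} \<le> card (backtracks (enc z))"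
    by (rule card_mono[rotated]) (simp add: backtracks_def)
  also have "\<dots> \<le> length z" by (rule card_backtracks_concat) (simp add: reduced_lcode)
  finally have "card B \<le> 3 * (4 * g + length z)"
    using card_bad_corners[OF W(1,3), of p] p unfolding B_def n_def by fastforce
  then have "card B < K" using assms(3) by simp
  then obtain r where r: "r < K" "\<And>i k c. i \<in> I \<Longrightarrow> uocc (gap i r) (enc z) k \<Longrightarrow> k < c \<Longrightarrow>
      c \<le> k + gap i r + 1 \<Longrightarrow> c \<notin> B"
    using exists_good_gap[of B "enc z"] by (auto simp: B_def)
  have good: "p (c - 1) = p c + 1"
    if "i \<in> I" "uocc (gap i r) (enc z) k" "k < c" "c \<le> k + gap i r + 1" for i k c
    using r(2)[OF that] that n by (auto simp: B_def uocc_def)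
  have anns: "anns r z ! p k = winv (anns r z ! k)" if "k < n" for k
  proof (rule pairing_anns)
    show "p j < length (enc z) \<and> p (p j) = j \<and> enc z ! p j = letter_inv (enc z ! j)"
      if "j < length (enc z)" for j using that n p pp enc by simp
  qed (use r(1) assms(2) good that n in auto)
  define pos where "pos l = (SOME k. k < n \<and> W ! k = l)" for l
  have pos: "pos (W ! k) = k" if "k < n" for k
  proof -
    have "pos (W ! k) < n \<and> W ! pos (W ! k) = W ! k"
      unfolding pos_def by (rule someI) (use that in simp)
    then show ?thesis using d that nth_eq_iff_index_eq[of W "pos (W ! k)" k] by (simp add: n_def)
  qed
  \<comment> \<open>The annotation is read at the positive copy of a generator; agreement at the
    inverse copy is the pairing of annotations. Generators absent from \<open>W\<close> get the
    empty word.\<close>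
  define \<psi> where "\<psi> e = nf (if (e, False) \<in> set W then anns r z ! pos (e, False) else [])" for e
  have \<psi>: "\<psi> e \<in> carrier FU" for e
    by (simp add: \<psi>_def free_group_carrier reduced_nf)
  have nfA: "nf (anns r z ! k) = anns r z ! k" if "k < n" for k
    using anns_values[of k r z] that n by (auto simp: length_anns intro!: nf_reduced)
  have el: "eval_letter FU \<psi> (W ! k) = anns r z ! k" if k: "k < n" for k
  proof (cases "snd (W ! k)")
    case False
    then have e: "(fst (W ! k), False) = W ! k" by (simp add: prod_eq_iff)
    then have "(fst (W ! k), False) \<in> set W" using k by (simp add: n_def)
    then show ?thesis using False pos[OF k] nfA[OF k] by (simp add: eval_letter_def \<psi>_def e)
  next
    case True
    have pk: "p k < n" "W ! p k = letter_inv (W ! k)" using p[OF k] by auto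
    have e: "(fst (W ! k), False) = W ! p k" using True pk(2) by (simp add: letter_inv_def)
    then have "(fst (W ! k), False) \<in> set W" using pk(1) by (simp add: n_def)
    then have "\<psi> (fst (W ! k)) = winv (anns r z ! k)"
      using pos[OF pk(1)] anns[OF k] nfA[OF pk(1)] by (simp add: \<psi>_def e)
    then have "eval_letter FU \<psi> (W ! k) = winv (winv (anns r z ! k))"
      using True \<psi>[of "fst (W ! k)"] by (simp add: eval_letter_def free_group_inv)
    then show ?thesis by simp
  qed
  have ev: "eval_word FU \<psi> V = nf (concat (map (eval_letter FU \<psi>) V))"
    for V
  proof (induction V)
    case (Cons l V)
    then show ?case using eval_word_Cons[of "FU" \<psi> l V]
      by (simp add: eval_word_def free_group_mult nf_def foldr_cancel_cons_assoc)
  qed (simp add: eval_word_def free_group_one)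
  have "map (eval_letter FU \<psi>) W = anns r z"
    by (rule nth_equalityI) (use el n in \<open>auto simp: n_def length_anns\<close>)
  then have "eval_word FU \<psi> W = nf z" using ev[of W] concat_anns[OF r(1), of z] by simp
  moreover have "is_cp FU g (eval_word FU \<psi> (nf W))"
    by (rule is_cp_hom[OF group_free_group group_free_group
        eval_word_hom[OF group_free_group \<psi>] W(3)])
  ultimately show ?thesis by (simp add: eval_word_nf[OF group_free_group \<psi>])
qed

end

section \<open>Roots in free groups\<close>

lemma cyclic_reduction:
  assumes "reduced t" "t \<noteq> []"
  shows "\<exists>u c. t = u @ c @ winv u \<and> c \<noteq> [] \<and> reduced (c @ c)" using assms
proof (induction t rule: length_induct)
  case (1 t)
  show ?case
  proof (cases "hd t = letter_inv (last t)")
    case False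
    then show ?thesis using 1(2,3) by (intro exI[of _ "[]"] exI[of _ t]) (simp add: reduced_append)
  next
    case True
    obtain l t' where l: "t = l # t'" using 1(3) by (cases t) auto
    then have "t' \<noteq> []" using True by auto
    then obtain t'' m where m: "t' = t'' @ [m]" by (metis append_butlast_last_id)
    have t: "t = l # t'' @ [letter_inv l]" using True l m by auto
    then have "t'' \<noteq> []" using 1(2) by (auto simp: reduced_Cons)
    moreover have "reduced t''" using 1(2) t by (simp add: reduced_append reduced_Cons)
    ultimately obtain u c where "t'' = u @ c @ winv u" "c \<noteq> []" "reduced (c @ c)"
      using 1(1)[rule_format, of t''] t by auto
    then show ?thesis using t by (intro exI[of _ "l # u"] exI[of _ c]) simp
  qed
qed

lemma nf_cancel_word: "nf (a @ winv u @ u @ b) = nf (a @ b)"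
proof -
  have "nf (winv u @ winv (winv u)) = []" by (rule nf_winv)
  then have "nf ((winv u @ u) @ b) = nf b"
    unfolding winv_winv by (subst nf_append) (simp add: nf_def)
  then show ?thesis by (subst (1 2) nf_append) simp
qed

lemma hd_concat_replicate: "c \<noteq> [] \<Longrightarrow> hd (concat (replicate (Suc n) c)) = hd c"
  by simp

lemma last_concat_replicate: "c \<noteq> [] \<Longrightarrow> last (concat (replicate (Suc n) c)) = last c"
  by (induction n) auto

lemma reduced_concat_replicate:
  assumes "c \<noteq> []" "reduced (c @ c)"
  shows "reduced (concat (replicate (Suc n) c))"
proof (induction n)
  case (Suc n)
  then show ?case using assms hd_concat_replicate[OF assms(1), of n]
    by (simp only: replicate_Suc[of "Suc n"] concat.simps reduced_append) auto
qed (use assms in \<open>simp add: reduced_append\<close>)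

lemma reduced_conj_power:
  assumes "reduced (u @ c @ winv u)" "c \<noteq> []" "reduced (c @ c)"
  shows "reduced (u @ concat (replicate (Suc n) c) @ winv u)"
  using assms reduced_concat_replicate[OF assms(2,3), of n] hd_concat_replicate[OF assms(2), of n]
    last_concat_replicate[OF assms(2), of n] by (auto simp: reduced_append simp del: replicate_Suc)

lemma free_group_power:
  assumes "u @ c @ winv u \<in> carrier (free_group S)" "c \<noteq> []" "reduced (c @ c)"
  shows "(u @ c @ winv u) [^]\<^bsub>free_group S\<^esub> Suc n = u @ concat (replicate (Suc n) c) @ winv u"
proof (induction n)
  case 0
  interpret group "free_group S" by (rule group_free_group)
  show ?case using assms(1) by simp
next
  case (Suc n)
  interpret group "free_group S" by (rule group_free_group)
  have r: "reduced (u @ c @ winv u)" using assms(1) by (simp add: free_group_carrier)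
  have "(u @ c @ winv u) [^]\<^bsub>free_group S\<^esub> Suc (Suc n)
      = nf ((u @ concat (replicate (Suc n) c)) @ winv u @ u @ (c @ winv u))"
    using Suc r by (simp add: free_group_mult_nf)
  also have "\<dots> = nf (u @ concat (replicate (Suc (Suc n)) c) @ winv u)"
  proof -
    have "concat (replicate m c) @ c = concat (replicate (Suc m) c)" for m by (induction m) simp_all
    from this[of "Suc n", symmetric] show ?thesis
      unfolding nf_cancel_word by (simp only: append_assoc)
  qed
  also have "\<dots> = u @ concat (replicate (Suc (Suc n)) c) @ winv u"
    by (rule nf_reduced, rule reduced_conj_power[OF r assms(2,3)])
  finally show ?case .
qed

text \<open>The last two conditions exclude cancellation around the cycle: if
  \<open>v = u @ e\<close> with \<open>e\<close> nonempty, then \<open>X\<close> would begin with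
  \<open>e\<close> and end with its inverse.\<close>

lemma conj_core_unique:
  assumes "u @ X @ winv u = v @ Y @ winv v" "X \<noteq> []" "Y \<noteq> []"
    and "hd X \<noteq> letter_inv (last X)" "hd Y \<noteq> letter_inv (last Y)"
  shows "u = v \<and> X = Y"
proof -
  have aux: "u = v" if eq: "u @ X @ winv u = v @ Y @ winv v" and len: "length u \<le> length v"
    and hd: "hd X \<noteq> letter_inv (last X)" for u v X Y :: "'a letter list"
  proof -
    obtain e where e: "v = u @ e"
      using eq len append_eq_append_conv_if[of u "X @ winv u" v "Y @ winv v"]
      by (metis append_take_drop_id)
    then have "X = e @ Y @ winv e" using eq by simp
    then have "e = []" using hd by (cases e) (auto simp: hd_append last_append split: if_splits)
    then show ?thesis using e by simp
  qed
  show ?thesis using aux[OF assms(1) _ assms(4)] aux[OF assms(1)[symmetric] _ assms(5)] assms(1)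
    by (metis append_same_eq same_append_eq nat_le_linear)
qed

text \<open>Write the roots as \<open>u c u^-1\<close> and \<open>v d v^-1\<close> with
  \<open>c\<close>, \<open>d\<close> cyclically reduced. Their powers just repeat \<open>c\<close>
  and \<open>d\<close>, without cancellation, so \<open>u = v\<close> by uniqueness of this form;
  equal lengths then make the first periods equal.\<close>

lemma free_group_unique_roots:
  assumes "x \<in> carrier (free_group S)" "y \<in> carrier (free_group S)" "n \<ge> 1"
    and "x [^]\<^bsub>free_group S\<^esub> (n :: nat) = y [^]\<^bsub>free_group S\<^esub> n"
  shows "x = y"
proof -
  interpret group "free_group S" by (rule group_free_group)
  obtain m where n: "n = Suc m" using assms(3) by (cases n) auto
  have nonempty: "z = []" if z: "z \<in> carrier (free_group S)" "z [^]\<^bsub>free_group S\<^esub> n = []" for z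
  proof (rule ccontr)
    assume "z \<noteq> []"
    then obtain u c where uc: "z = u @ c @ winv u" "c \<noteq> []" "reduced (c @ c)"
      using cyclic_reduction[of z] z(1) by (auto simp: free_group_carrier)
    show False
      using free_group_power[OF z(1)[unfolded uc(1)] uc(2,3), of m] z(2) uc by (simp add: n)
  qed
  have onepow: "[] [^]\<^bsub>free_group S\<^esub> n = []" using nat_pow_one by (simp add: free_group_one)
  show ?thesis
  proof (cases "x = [] \<or> y = []")
    case True
    then show ?thesis using nonempty assms(1,2,4) onepow by metis
  next
    case False
    obtain u c where uc: "x = u @ c @ winv u" "c \<noteq> []" "reduced (c @ c)"
      using cyclic_reduction[of x] assms(1) False by (auto simp: free_group_carrier)
    obtain v d where vd: "y = v @ d @ winv v" "d \<noteq> []" "reduced (d @ d)"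
      using cyclic_reduction[of y] assms(2) False by (auto simp: free_group_carrier)
    let ?C = "concat (replicate (Suc m) c)" and ?D = "concat (replicate (Suc m) d)"
    have eq: "u @ ?C @ winv u = v @ ?D @ winv v"
      using assms(4) free_group_power[OF assms(1)[unfolded uc(1)] uc(2,3), of m]
        free_group_power[OF assms(2)[unfolded vd(1)] vd(2,3), of m] by (simp add: uc(1) vd(1) n)
    have "hd ?C \<noteq> letter_inv (last ?C)" "hd ?D \<noteq> letter_inv (last ?D)"
      unfolding hd_concat_replicate[OF uc(2)] last_concat_replicate[OF uc(2)]
        hd_concat_replicate[OF vd(2)] last_concat_replicate[OF vd(2)]
      using uc(2,3) vd(2,3) by (auto simp: reduced_append)
    then have "u = v \<and> ?C = ?D" by (intro conj_core_unique[OF eq]) (use uc vd in auto)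
    then have uv: "u = v" and CD: "?C = ?D" by auto
    have "length ?C = Suc m * length c" "length ?D = Suc m * length d"
      by (simp_all add: length_concat sum_list_replicate)
    then have "length c = length d" using CD by (metis mult_cancel1 nat.distinct(1))
    then have "c = d" using CD by simp
    then show ?thesis using uv uc(1) vd(1) by simp
  qed
qed

section \<open>Wreath products and retractions\<close>

text \<open>The unrestricted wreath product: \<open>f\<close> may have infinite support, and the
  integer translates its argument.\<close>

definition wreath :: "('g, 'm) monoid_scheme \<Rightarrow> ((int \<Rightarrow> 'g) \<times> int) monoid" where
  "wreath H = \<lparr>carrier = {f. \<forall>j. f j \<in> carrier H} \<times> UNIV,
     monoid.mult = (\<lambda>(f, k) (f', k'). (\<lambda>j. f j \<otimes>\<^bsub>H\<^esub> f' (j + k), k + k')),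
     one = (\<lambda>_. \<one>\<^bsub>H\<^esub>, 0)\<rparr>"

lemma wreath_simps:
  "(f, k) \<in> carrier (wreath H) \<longleftrightarrow> (\<forall>j. f j \<in> carrier H)"
  "\<one>\<^bsub>wreath H\<^esub> = (\<lambda>_. \<one>\<^bsub>H\<^esub>, 0)"
  "(f, k) \<otimes>\<^bsub>wreath H\<^esub> (f', k') = (\<lambda>j. f j \<otimes>\<^bsub>H\<^esub> f' (j + k), k + k')"
  by (simp_all add: wreath_def)

lemma group_wreath:
  assumes "group H"
  shows "group (wreath H)"
proof -
  interpret H: group H by fact
  show ?thesis
  proof (rule groupI)
    fix p assume p: "p \<in> carrier (wreath H)"
    obtain f k where fk: "p = (f, k)" by (cases p)
    have "(\<lambda>j. inv\<^bsub>H\<^esub> f (j - k), - k) \<otimes>\<^bsub>wreath H\<^esub> p = \<one>\<^bsub>wreath H\<^esub>"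
      using p by (simp add: fk wreath_simps)
    moreover have "(\<lambda>j. inv\<^bsub>H\<^esub> f (j - k), - k) \<in> carrier (wreath H)"
      using p by (simp add: fk wreath_simps)
    ultimately show "\<exists>q\<in>carrier (wreath H). q \<otimes>\<^bsub>wreath H\<^esub> p = \<one>\<^bsub>wreath H\<^esub>" by blast
  qed (auto simp: split_paired_all wreath_simps H.m_assoc add.assoc)
qed

lemma wreath_inv:
  assumes "group H" "\<And>j. f j \<in> carrier H"
  shows "inv\<^bsub>wreath H\<^esub> (f, k) = (\<lambda>j. inv\<^bsub>H\<^esub> f (j - k), - k)"
proof -
  interpret H: group H by fact
  interpret group "wreath H" by (rule group_wreath[OF assms(1)])
  show ?thesis by (rule inv_equality) (use assms(2) in \<open>auto simp: wreath_simps\<close>)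
qed

lemma hom_power:
  assumes "group G" "group K" "h \<in> hom G K" "x \<in> carrier G"
  shows "h (x [^]\<^bsub>G\<^esub> (n :: nat)) = h x [^]\<^bsub>K\<^esub> n"
proof -
  interpret group_hom G K h using assms by (simp add: group_hom_def group_hom_axioms_def)
  show ?thesis by (rule hom_nat_pow[OF assms(4)])
qed

text \<open>A map into the wreath product by the integers retracts \<open>h\<close> at coordinate \<open>0\<close>. Since roots are
  unique in a free group, this makes the image of \<open>h\<close> primitive although it need not be a retract.\<close>

lemma wreath_retraction:
  assumes h: "h \<in> hom (free_group X) (free_group S)"
    and \<Theta>: "\<Theta> \<in> hom (free_group S) (wreath (free_group X))"
    and gen: "\<And>x. x \<in> X \<Longrightarrow> snd (\<Theta> (h (free_gen x))) = 0 \<and> fst (\<Theta> (h (free_gen x))) 0 = free_gen x"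
  shows "inj_on h (carrier (free_group X))"
    and "primitive_subgroup (free_group S) (h ` carrier (free_group X))"
    and "w \<in> carrier (free_group X) \<Longrightarrow> snd (\<Theta> (h w)) = 0"
proof -
  let ?X = "free_group X" and ?S = "free_group S"
  let ?Q = "wreath ?X"
  let ?Z = "\<lparr>carrier = UNIV :: int set, monoid.mult = (+), one = 0\<rparr>"
  interpret X: group ?X by (rule group_free_group)
  interpret S: group ?S by (rule group_free_group)
  interpret Q: group ?Q by (rule group_wreath[OF group_free_group])
  have Z: "group ?Z" by (rule groupI) (auto intro: exI[of _ "- _"])
  have \<Theta>h: "\<Theta> (h w) \<in> carrier ?Q" if "w \<in> carrier ?X" for w
    using hom_in_carrier[OF \<Theta> hom_in_carrier[OF h that]] .
  have mult: "\<Theta> (h (v \<otimes>\<^bsub>?X\<^esub> w)) = \<Theta> (h v) \<otimes>\<^bsub>?Q\<^esub> \<Theta> (h w)"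
    if "v \<in> carrier ?X" "w \<in> carrier ?X" for v w
    using that hom_mult[OF h that] hom_mult[OF \<Theta>] hom_in_carrier[OF h] by simp
  have z: "snd (\<Theta> (h w)) = 0" if "w \<in> carrier ?X" for w
  proof (rule free_group_extend_unique[OF Z _ _ _ that])
    show "(\<lambda>w. snd (\<Theta> (h w))) \<in> hom ?X ?Z"
      by (auto simp: hom_def mult wreath_def split: prod.splits)
    show "(\<lambda>w. 0) \<in> hom ?X ?Z" by (simp add: hom_def)
  qed (use gen in simp)
  \<comment> \<open>Evaluation at 0 is multiplicative only on elements with shift 0, hence the need
    for \<open>z\<close>.\<close>
  have id: "fst (\<Theta> (h w)) 0 = w" if "w \<in> carrier ?X" for w
  proof -
    have "fst (\<Theta> (h w)) 0 = id w"
    proof (rule free_group_extend_unique[OF group_free_group _ _ _ that])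
      have "fst (\<Theta> (h v) \<otimes>\<^bsub>?Q\<^esub> \<Theta> (h w)) 0 = fst (\<Theta> (h v)) 0 \<otimes>\<^bsub>?X\<^esub> fst (\<Theta> (h w)) 0"
        if "v \<in> carrier ?X" "w \<in> carrier ?X" for v w
        using z[OF that(1)] by (cases "\<Theta> (h v)"; cases "\<Theta> (h w)") (simp add: wreath_simps)
      moreover have "fst (\<Theta> (h w)) 0 \<in> carrier ?X" if "w \<in> carrier ?X" for w
        using \<Theta>h[OF that] by (cases "\<Theta> (h w)") (simp add: wreath_simps)
      ultimately show "(\<lambda>w. fst (\<Theta> (h w)) 0) \<in> hom ?X ?X"
        by (simp add: hom_def mult)
      show "id \<in> hom ?X ?X" by (simp add: hom_def)
    qed (use gen in simp)
    then show ?thesis by simp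
  qed
  show "inj_on h (carrier ?X)" by (rule inj_on_inverseI[of _ "\<lambda>v. fst (\<Theta> v) 0"]) (rule id)
  have "t \<in> h ` carrier ?X" if t: "t \<in> carrier ?S" "n \<ge> 1" "t [^]\<^bsub>?S\<^esub> n \<in> h ` carrier ?X"
    for t and n :: nat
  proof -
    obtain w where w: "w \<in> carrier ?X" "t [^]\<^bsub>?S\<^esub> n = h w" using t(3) by blast
    obtain f k where fk: "\<Theta> t = (f, k)" by (cases "\<Theta> t")
    have f: "f j \<in> carrier ?X" for j
      using hom_in_carrier[OF \<Theta> t(1)] by (simp add: fk wreath_simps)
    have pow: "\<Theta> t [^]\<^bsub>?Q\<^esub> m = (fst (\<Theta> t [^]\<^bsub>?Q\<^esub> m), int m * k)" for m :: nat
    proof (induction m)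
      case (Suc m)
      then show ?case
        by (cases "\<Theta> t [^]\<^bsub>?Q\<^esub> m") (simp add: fk wreath_simps algebra_simps)
    qed (simp add: wreath_simps)
    have eq: "\<Theta> (h w) = \<Theta> t [^]\<^bsub>?Q\<^esub> n"
      using hom_power[OF group_free_group Q.is_group \<Theta> t(1), of n] w(2) by simp
    \<comment> \<open>The integers are torsion free, so a root of an element of the image also has
      shift 0 and evaluation at 0 applies to its powers.\<close>
    have "int n * k = 0" using z[OF w(1)] eq pow[of n] by (metis snd_conv)
    then have k: "k = 0" using t(2) by simp
    have "fst (\<Theta> t [^]\<^bsub>?Q\<^esub> m) 0 = f 0 [^]\<^bsub>?X\<^esub> m" for m :: nat
    proof (induction m)
      case (Suc m)
      then show ?case using pow[of m] k
        by (cases "\<Theta> t [^]\<^bsub>?Q\<^esub> m") (simp add: fk wreath_simps)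
    qed (simp add: wreath_simps)
    then have "w = f 0 [^]\<^bsub>?X\<^esub> n" using id[OF w(1)] eq by simp
    then have "t [^]\<^bsub>?S\<^esub> n = h (f 0) [^]\<^bsub>?S\<^esub> n"
      using w(2) hom_power[OF group_free_group group_free_group h f] by simp
    then have "t = h (f 0)"
      using free_group_unique_roots[OF t(1) hom_in_carrier[OF h f] t(2)] by simp
    then show ?thesis using f by blast
  qed
  moreover have "subgroup (h ` carrier ?X) ?S"
  proof -
    interpret group_hom ?X ?S h using h by (simp add: group_hom_def group_hom_axioms_def
        group_free_group)
    show ?thesis by (rule img_is_subgroup)
  qed
  ultimately show "primitive_subgroup ?S (h ` carrier ?X)" by (simp add: primitive_subgroup_def)
  show "w \<in> carrier ?X \<Longrightarrow> snd (\<Theta> (h w)) = 0" by (rule z)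
qed

section \<open>Evaluating blocks in the wreath product\<close>

context two_letters
begin

text \<open>\<open>\<beta>\<close> is the unit shift, so coordinate 0 sends the conjugate of
  \<open>\<alpha>\<close> by the \<open>j\<close>-th power of \<open>\<beta>\<close> to
  \<open>\<pi> j\<close>.\<close>

definition wreath_gen :: "('g, 'm) monoid_scheme \<Rightarrow> (int \<Rightarrow> 'g) \<Rightarrow> 'x \<Rightarrow> (int \<Rightarrow> 'g) \<times> int" where
  "wreath_gen H \<pi> x =
     (if x = \<alpha> then (\<pi>, 0) else if x = \<beta> then (\<lambda>_. \<one>\<^bsub>H\<^esub>, 1) else (\<lambda>_. \<one>\<^bsub>H\<^esub>, 0))"

context
  fixes H (structure) and \<pi> :: "int \<Rightarrow> _"
  assumes H: "group H" and \<pi>: "\<And>j. \<pi> j \<in> carrier H"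
begin

interpretation H: group H by (rule H)

lemma wreath_gen_closed: "wreath_gen H \<pi> x \<in> carrier (wreath H)"
  by (simp add: wreath_gen_def wreath_simps \<pi>)

abbreviation "we \<equiv> eval_word (wreath H) (wreath_gen H \<pi>)"

lemma we_closed: "fst (we w) j \<in> carrier H"
  using eval_word_closed[OF group_wreath[OF H], where f = "wreath_gen H \<pi>" and w = w]
    wreath_gen_closed by (cases "we w") (simp add: wreath_simps)

lemma we_Nil: "we [] = (\<lambda>_. \<one>, 0)" by (simp add: eval_word_def wreath_simps)

lemma we_Cons:
  "we ((\<alpha>, False) # w) = (\<lambda>j. \<pi> j \<otimes> fst (we w) j, snd (we w))"
  "we ((\<alpha>, True) # w) = (\<lambda>j. inv (\<pi> j) \<otimes> fst (we w) j, snd (we w))"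
  "we ((\<beta>, False) # w) = (\<lambda>j. fst (we w) (j + 1), snd (we w) + 1)"
  "we ((\<beta>, True) # w) = (\<lambda>j. fst (we w) (j - 1), snd (we w) - 1)"
proof -
  obtain F k where Fk: "we w = (F, k)" by (cases "we w")
  have F: "F j \<in> carrier H" for j using we_closed[of w j] Fk by simp
  have we: "we (l # w) = eval_letter (wreath H) (wreath_gen H \<pi>) l \<otimes>\<^bsub>wreath H\<^esub> (F, k)" for l
    by (simp add: eval_word_def flip: Fk)
  show "we ((\<alpha>, False) # w) = (\<lambda>j. \<pi> j \<otimes> fst (we w) j, snd (we w))"
    "we ((\<alpha>, True) # w) = (\<lambda>j. inv (\<pi> j) \<otimes> fst (we w) j, snd (we w))"
    "we ((\<beta>, False) # w) = (\<lambda>j. fst (we w) (j + 1), snd (we w) + 1)"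
    "we ((\<beta>, True) # w) = (\<lambda>j. fst (we w) (j - 1), snd (we w) - 1)"
    unfolding we Fk using ab
    by (simp_all add: eval_letter_def wreath_gen_def wreath_inv[OF H] \<pi> wreath_simps F)
qed

lemma we_replicate:
  "we (replicate s (\<beta>, False) @ w) = (\<lambda>j. fst (we w) (j + int s), snd (we w) + int s)"
  "we (replicate s (\<beta>, True) @ w) = (\<lambda>j. fst (we w) (j - int s), snd (we w) - int s)"
  by (induction s) (simp_all add: we_Cons algebra_simps)

lemma we_gaps:
  assumes "\<And>j. j > N \<Longrightarrow> \<pi> j = \<one>" "\<forall>d\<in>set ds. int d > N" "j \<ge> 0"
  shows "fst (we (concat (map (\<lambda>d. replicate d (\<beta>, False) @ [(\<alpha>, False)]) ds) @ w)) j
      = fst (we w) (j + int (sum_list ds))"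
    and "snd (we (concat (map (\<lambda>d. replicate d (\<beta>, False) @ [(\<alpha>, False)]) ds) @ w))
      = snd (we w) + int (sum_list ds)"
proof -
  show "fst (we (concat (map (\<lambda>d. replicate d (\<beta>, False) @ [(\<alpha>, False)]) ds) @ w)) j
      = fst (we w) (j + int (sum_list ds))" using assms(2,3)
  proof (induction ds arbitrary: j)
    case (Cons d ds)
    then have "\<pi> (j + int d) = \<one>" using assms(1) by simp
    then show ?case using Cons by (simp add: we_replicate we_Cons we_closed add.assoc)
  qed simp
  show "snd (we (concat (map (\<lambda>d. replicate d (\<beta>, False) @ [(\<alpha>, False)]) ds) @ w))
      = snd (we w) + int (sum_list ds)" by (induction ds) (simp_all add: we_replicate we_Cons)
qed

text \<open>Read at coordinate 0, the first \<open>\<alpha>\<close> is met at height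
  \<open>s\<close> and gives \<open>\<pi> s\<close>. All later ones are met above \<open>N\<close>,
  where \<open>\<pi>\<close> is trivial, and the trailing letters bring the height back to
  0.\<close>

lemma we_blk:
  assumes "\<And>j. j > N \<Longrightarrow> \<pi> j = \<one>" "\<forall>d\<in>set ds. int d > N"
  shows "fst (we (blk s ds (s + sum_list ds))) 0 = \<pi> (int s)"
    and "snd (we (blk s ds (s + sum_list ds))) = 0"
proof -
  have w0: "we (replicate t (\<beta>, True)) = (\<lambda>_. \<one>, - int t)" for t
    using we_replicate(2)[of t "[]"] by (simp add: we_Nil)
  show "fst (we (blk s ds (s + sum_list ds))) 0 = \<pi> (int s)"
    using we_gaps(1)[OF assms, where j = "int s" and w = "replicate (s + sum_list ds) (\<beta>, True)"] \<pi>
    by (simp add: blk_def core_def we_replicate we_Cons w0)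
  show "snd (we (blk s ds (s + sum_list ds))) = 0"
    using we_gaps(2)[OF assms, where j = 0 and w = "replicate (s + sum_list ds) (\<beta>, True)"]
    by (simp add: blk_def core_def we_replicate we_Cons w0)
qed

end

end

context block_code
begin

definition code_hom :: "'x set \<Rightarrow> 'i letter list \<Rightarrow> 'x letter list" where
  "code_hom S = eval_word (free_group S) (\<lambda>i. if i \<in> I then code i else [])"

lemma code_carrier: "\<alpha> \<in> S \<Longrightarrow> \<beta> \<in> S \<Longrightarrow> code i \<in> carrier (free_group S)"
  by (auto simp: free_group_carrier reduced_code, auto simp: code_def blk_def core_def split: if_splits)

context
  fixes S assumes S: "\<alpha> \<in> S" "\<beta> \<in> S"
begin

lemma code_gen: "(if i \<in> I then code i else []) \<in> carrier (free_group S)"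
  using code_carrier[OF S] by (simp add: free_group_carrier)

lemma code_hom_hom: "code_hom S \<in> hom (free_group I) (free_group S)"
  unfolding code_hom_def by (rule eval_word_hom[OF group_free_group code_gen])

lemma code_hom_gen: "i \<in> I \<Longrightarrow> code_hom S (free_gen i) = code i"
  unfolding code_hom_def by (simp add: eval_word_gen[OF group_free_group code_gen])

lemma code_hom_enc:
  assumes "fst ` set z \<subseteq> I"
  shows "code_hom S z = nf (enc z)" using assms
proof (induction z)
  case Nil
  then show ?case by (simp add: code_hom_def eval_word_def free_group_one)
next
  case (Cons l z)
  have "eval_letter (free_group S) (\<lambda>i. if i \<in> I then code i else []) l = lcode l"
    using Cons.prems code_carrier[OF S] by (auto simp: eval_letter_def lcode_def free_group_inv)
  then have "code_hom S (l # z) = lcode l \<otimes>\<^bsub>free_group S\<^esub> code_hom S z"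
    by (simp add: code_hom_def eval_word_def)
  also have "\<dots> = nf (lcode l @ enc z)"
    using Cons nf_mult[where u = "lcode l" and S = S and v = "enc z"] nf_reduced[OF reduced_lcode] by simp
  finally show ?case by simp
qed

lemma code_hom_embedding:
  shows "inj_on (code_hom S) (carrier (free_group I))"
    and "primitive_subgroup (free_group S) (code_hom S ` carrier (free_group I))"
proof -
  \<comment> \<open>The value at height \<open>idx i + 1\<close> is \<open>free_gen i\<close>, so
    evaluation at 0 recovers a generator from the leading exponent of its block.\<close>
  define \<pi> where "\<pi> j = (if \<exists>i\<in>I. j = int (idx i + 1)
      then free_gen (THE i. i \<in> I \<and> j = int (idx i + 1)) else [])" for j
  have \<pi>i: "\<pi> (int (idx i + 1)) = free_gen i" if "i \<in> I" for i
  proof -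
    have "(THE k. k \<in> I \<and> int (idx i + 1) = int (idx k + 1)) = i"
      using that idx_inj by (intro the_equality) (auto simp: inj_on_def)
    then show ?thesis using that by (auto simp: \<pi>_def)
  qed
  have \<pi>: "\<pi> j \<in> carrier (free_group I)" for j
  proof (cases "\<exists>i\<in>I. j = int (idx i + 1)")
    case True
    then show ?thesis using \<pi>i free_gen_carrier by auto
  qed (simp add: \<pi>_def free_group_carrier)
  have \<pi>N: "\<pi> j = \<one>\<^bsub>free_group I\<^esub>" if "j > int N" for j
    using that idx_less by (fastforce simp: \<pi>_def free_group_one)
  have gaps: "\<forall>d\<in>set (gaps i). int d > int N" for i by (auto simp: gaps_def gap_def)
  let ?\<Theta> = "eval_word (wreath (free_group I)) (wreath_gen (free_group I) \<pi>)"
  have \<Theta>: "?\<Theta> \<in> hom (free_group S) (wreath (free_group I))"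
    by (rule eval_word_hom[OF group_wreath[OF group_free_group]
        wreath_gen_closed[OF group_free_group \<pi>]])
  have gen: "snd (?\<Theta> (code_hom S (free_gen i))) = 0 \<and>
      fst (?\<Theta> (code_hom S (free_gen i))) 0 = free_gen i" if "i \<in> I" for i
    using that we_blk[OF group_free_group \<pi> \<pi>N gaps, where s = "idx i + 1"] \<pi>i[OF that]
    by (simp add: code_hom_gen code_def)
  show "inj_on (code_hom S) (carrier (free_group I))"
    "primitive_subgroup (free_group S) (code_hom S ` carrier (free_group I))"
    by (rule wreath_retraction[OF code_hom_hom \<Theta> gen], assumption)+
qed

end

end

section \<open>Genus and admissible representations\<close>

lemma foldr_eq_cprod:
  "foldr (\<lambda>i z. commutator G (a i) (b i) \<otimes>\<^bsub>G\<^esub> z) [k..<k + n] \<one>\<^bsub>G\<^esub>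
    = cprod G n (\<lambda>i. a (k + i)) (\<lambda>i. b (k + i))"
proof (induction n arbitrary: k)
  case (Suc n)
  have "[k..<k + Suc n] = k # [Suc k..<Suc k + n]" by (simp add: upt_conv_Cons)
  then show ?case using Suc[of "Suc k"] by simp
qed simp

lemma surface_boundary_eq:
  "surface_boundary g =
    cprod (surface_group g) g (\<lambda>i. free_gen (SA (Suc i))) (\<lambda>i. free_gen (SB (Suc i)))"
  using foldr_eq_cprod[of "surface_group g" "\<lambda>i. free_gen (SA i)" "\<lambda>i. free_gen (SB i)" 1 g]
  by (simp add: surface_boundary_def)

lemma group_surface_group: "group (surface_group g)"
  by (simp add: surface_group_def group_free_group)

lemma surface_gen_carrier:
  assumes "i < g"
  shows "free_gen (SA (Suc i)) \<in> carrier (surface_group g)"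
    and "free_gen (SB (Suc i)) \<in> carrier (surface_group g)"
  unfolding surface_group_def using assms by (auto intro!: free_gen_carrier)

lemma genus_rep_iff:
  assumes "group F"
  shows "genus_rep F g x h \<longleftrightarrow> h \<in> hom (surface_group g) F \<and>
    cprod F g (\<lambda>i. h (free_gen (SA (Suc i)))) (\<lambda>i. h (free_gen (SB (Suc i)))) = x"
  using hom_cprod[OF group_surface_group assms, of h g g "\<lambda>i. free_gen (SA (Suc i))"
      "\<lambda>i. free_gen (SB (Suc i))"] surface_gen_carrier
  by (auto simp: genus_rep_def surface_boundary_eq)

lemma ex_genus_rep_iff:
  assumes "group F"
  shows "(\<exists>h. genus_rep F g x h) \<longleftrightarrow> is_cp F g x"
proof
  assume "\<exists>h. genus_rep F g x h"
  then obtain h where h: "h \<in> hom (surface_group g) F"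
    "cprod F g (\<lambda>i. h (free_gen (SA (Suc i)))) (\<lambda>i. h (free_gen (SB (Suc i)))) = x"
    by (auto simp: genus_rep_iff[OF assms])
  show "is_cp F g x" unfolding h(2)[symmetric]
    by (rule is_cp_cprod) (auto intro: hom_in_carrier[OF h(1)] surface_gen_carrier)
next
  assume "is_cp F g x"
  then obtain a b where ab: "\<forall>i. a i \<in> carrier F" "\<forall>i. b i \<in> carrier F" "x = cprod F g a b"
    using is_cp_obtain_cprod[OF assms] by blast
  \<comment> \<open>The basis of the surface group is numbered from 1, the entries of
    \<open>cprod\<close> from 0.\<close>
  define f where "f y = (case y of SA i \<Rightarrow> a (i - 1) | SB i \<Rightarrow> b (i - 1))" for y
  have f: "f y \<in> carrier F" for y using ab by (simp add: f_def split: surface_gen.split)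
  have "genus_rep F g x (eval_word F f)" unfolding genus_rep_iff[OF assms]
    using eval_word_hom[where f = f, OF assms f] ab(3)
    by (simp add: eval_word_gen[OF assms f] surface_group_def) (simp add: f_def)
  then show "\<exists>h. genus_rep F g x h" by blast
qed

lemma (in group) commutator_one_is_cp:
  assumes "a \<in> carrier G" "b \<in> carrier G"
  shows "is_cp G 1 (commutator G a b)" using is_cp.Suc[OF assms is_cp.zero] assms by simp

lemma (in group) inv_commutator:
  "a \<in> carrier G \<Longrightarrow> b \<in> carrier G \<Longrightarrow> inv (commutator G a b) = commutator G b a"
  by (simp add: commutator_def inv_mult_group m_assoc)

lemma (in group) derived_iff_is_cp: "x \<in> derived G (carrier G) \<longleftrightarrow> (\<exists>g. is_cp G g x)"
proof
  assume "x \<in> derived G (carrier G)"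
  then have "x \<in> generate G (\<Union>a\<in>carrier G. \<Union>b\<in>carrier G. {a \<otimes> b \<otimes> inv a \<otimes> inv b})"
    by (simp add: derived_def)
  then show "\<exists>g. is_cp G g x"
  proof (induction rule: generate.induct)
    case one
    show ?case using is_cp.zero by blast
  next
    case (incl h)
    then show ?case using commutator_one_is_cp by (auto simp: commutator_def)
  next
    case (inv h)
    then obtain a b where "a \<in> carrier G" "b \<in> carrier G" "h = commutator G a b"
      by (auto simp: commutator_def)
    then show ?case using commutator_one_is_cp[of b a] inv_commutator[of a b] by auto
  next
    case (eng h1 h2)
    then show ?case using is_cp_mult by blast
  qed
next
  assume "\<exists>g. is_cp G g x"
  then obtain g where "is_cp G g x" by blast
  then show "x \<in> derived G (carrier G)"
  proof (induction rule: is_cp.induct)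
    case zero
    show ?case unfolding derived_def by (rule generate.one)
  next
    case (Suc a b n x)
    have "commutator G a b \<in> generate G (\<Union>a\<in>carrier G. \<Union>b\<in>carrier G. {a \<otimes> b \<otimes> inv a \<otimes> inv b})"
      using Suc.hyps(1,2) by (auto simp: commutator_def intro: generate.incl)
    then show ?case using Suc.IH unfolding derived_def by (rule generate.eng)
  qed
qed

lemma a_genus_eq_Least: "group F \<Longrightarrow> a_genus F x = (LEAST g. is_cp F g x)"
  by (simp add: a_genus_def ex_genus_rep_iff)

text \<open>Membership in the derived subgroup guarantees that the \<open>LEAST\<close> in the genus
  is attained.\<close>

lemma genus_set_iff:
  assumes "group F"
  shows "x \<in> derived F (carrier F) \<and> a_genus F x = g \<longleftrightarrow> is_cp F g x \<and> (\<forall>k. is_cp F k x \<longrightarrow> g \<le> k)"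
proof -
  interpret group F by fact
  show ?thesis
  proof (intro iffI conjI allI impI; (elim conjE)?)
    assume x: "x \<in> derived F (carrier F)" "a_genus F x = g"
    show "is_cp F g x"
      using x LeastI_ex[of "\<lambda>g. is_cp F g x"] by (simp add: derived_iff_is_cp a_genus_eq_Least[OF assms])
    show "g \<le> k" if "is_cp F k x" for k
      using x(2) Least_le[of "\<lambda>g. is_cp F g x", OF that] by (simp add: a_genus_eq_Least[OF assms])
  next
    assume x: "is_cp F g x" "\<forall>k. is_cp F k x \<longrightarrow> g \<le> k"
    show "x \<in> derived F (carrier F)" using x(1) derived_iff_is_cp by blast
    show "a_genus F x = g"
      unfolding a_genus_eq_Least[OF assms] by (rule Least_equality) (use x in auto)
  qed
qed

definition genus_elems :: "('a, 'b) monoid_scheme \<Rightarrow> nat \<Rightarrow> 'a set" where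
  "genus_elems F g = {x. is_cp F g x \<and> (\<forall>k. is_cp F k x \<longrightarrow> g \<le> k)}"

definition images :: "('a, 'b) monoid_scheme \<Rightarrow> nat \<Rightarrow> 'a \<Rightarrow> 'a set set" where
  "images F g x = {h ` carrier (surface_group g) | h. admissible_rep F g x h}"

lemma f_hat'_eq:
  assumes "group F"
  shows "f_hat' F g = (SUP x \<in> genus_elems F g. num' F x)"
  by (simp add: f_hat'_def genus_set_iff[OF assms] genus_elems_def)

lemma num'_eq:
  assumes "group F" "x \<in> genus_elems F g"
  shows "num' F x = ecard (images F g x)"
proof -
  have "a_genus F x = g"
    using genus_set_iff[OF assms(1), of x g] assms(2) by (simp add: genus_elems_def)
  then have "{h ` carrier (surface_group g') | g' h. minimal_rep F g' x h \<and> admissible_rep F g' x h}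
      = images F g x" by (auto simp: minimal_rep_def admissible_rep_def images_def)
  then show ?thesis by (simp add: num'_def)
qed

lemma num'_le_f_hat': "group F \<Longrightarrow> x \<in> genus_elems F g \<Longrightarrow> num' F x \<le> f_hat' F g"
  by (simp add: f_hat'_eq SUP_upper)

lemma ecard_le:
  assumes "inj_on f A" "f ` A \<subseteq> B"
  shows "ecard A \<le> ecard B"
  using assms card_inj_on_le[OF assms] inj_on_finite[OF assms] by (auto simp: ecard_def)

lemma ecard_times: "ecard (A \<times> B) = ecard A * ecard B"
proof (cases "A = {} \<or> B = {}")
  case True
  then show ?thesis by (auto simp: ecard_def zero_enat_def[symmetric])
next
  case False
  then show ?thesis
    by (auto simp: ecard_def finite_cartesian_product_iff card_cartesian_product zero_enat_def
        card_gt_0_iff imult_is_infinity)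
qed

lemma inj_hom_power_cancel:
  assumes "group G" "group K" "h \<in> hom G K" "inj_on h (carrier G)" "s \<in> carrier G" "w \<in> carrier G"
    and "h s [^]\<^bsub>K\<^esub> (n :: nat) = h w"
  shows "s [^]\<^bsub>G\<^esub> n = w"
proof -
  interpret G: group G by fact
  show ?thesis
    using inj_onD[OF assms(4), of "s [^]\<^bsub>G\<^esub> n" w] hom_power[OF assms(1-3,5), of n] assms(5-7)
    by simp
qed

text \<open>Primitivity is transitive: a root in \<open>K\<close> lies in the image of
  \<open>\<phi>\<close>, which is primitive, and its preimage is a root in \<open>G\<close> by
  injectivity.\<close>

lemma admissible_rep_comp:
  assumes "group G" "group K" "\<phi> \<in> hom G K" "inj_on \<phi> (carrier G)"
    and prim: "primitive_subgroup K (\<phi> ` carrier G)"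
    and h: "admissible_rep G g x h"
  shows "admissible_rep K g (\<phi> x) (\<phi> \<circ> h)"
proof -
  have hh: "h \<in> hom (surface_group g) G" "h (surface_boundary g) = x"
    "inj_on h (carrier (surface_group g))" "primitive_subgroup G (h ` carrier (surface_group g))"
    using h by (auto simp: admissible_rep_def genus_rep_def)
  have hom: "\<phi> \<circ> h \<in> hom (surface_group g) K"
    using hom_compose[OF hh(1) assms(3)] by (simp add: comp_def)
  have sub: "h ` carrier (surface_group g) \<subseteq> carrier G"
    using hom_in_carrier[OF hh(1)] by auto
  have "inj_on (\<phi> \<circ> h) (carrier (surface_group g))"
    using hh(3) assms(4) sub by (auto intro: comp_inj_on inj_on_subset)
  moreover have "subgroup ((\<phi> \<circ> h) ` carrier (surface_group g)) K"
  proof -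
    interpret group_hom "surface_group g" K "\<phi> \<circ> h"
      using hom assms(2) by (simp add: group_hom_def group_hom_axioms_def group_surface_group)
    show ?thesis by (rule img_is_subgroup)
  qed
  moreover have "t \<in> (\<phi> \<circ> h) ` carrier (surface_group g)"
    if t: "t \<in> carrier K" "n \<ge> 1" "t [^]\<^bsub>K\<^esub> n \<in> (\<phi> \<circ> h) ` carrier (surface_group g)"
    for t and n :: nat
  proof -
    obtain w where w: "w \<in> carrier (surface_group g)" "t [^]\<^bsub>K\<^esub> n = \<phi> (h w)"
      using t(3) by auto
    have hw: "h w \<in> carrier G" by (rule hom_in_carrier[OF hh(1) w(1)])
    then obtain s where s: "s \<in> carrier G" "t = \<phi> s"
      using prim t(1,2) w(2) unfolding primitive_subgroup_def by (metis (no_types, lifting) imageE imageI)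
    have "s [^]\<^bsub>G\<^esub> n = h w"
      by (rule inj_hom_power_cancel[OF assms(1-4) s(1) hw]) (use s(2) w(2) in simp)
    then have "s \<in> h ` carrier (surface_group g)"
      using hh(4) s(1) t(2) w(1) unfolding primitive_subgroup_def by (metis imageI)
    then show ?thesis using s(2) by auto
  qed
  ultimately show ?thesis
    using hom hh(2) by (simp add: admissible_rep_def genus_rep_def primitive_subgroup_def)
qed

lemma num'_transfer:
  assumes "group G" "group K" "\<phi> \<in> hom G K" "inj_on \<phi> (carrier G)"
    and "primitive_subgroup K (\<phi> ` carrier G)"
    and x: "x \<in> genus_elems G g" "\<phi> x \<in> genus_elems K g"
  shows "num' G x \<le> num' K (\<phi> x)"
  unfolding num'_eq[OF assms(1) x(1)] num'_eq[OF assms(2) x(2)]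
proof (rule ecard_le)
  have sub: "A \<subseteq> carrier G" if "A \<in> images G g x" for A
    using that by (auto simp: images_def admissible_rep_def genus_rep_def hom_def)
  show "inj_on ((`) \<phi>) (images G g x)"
    by (rule inj_onI) (use sub assms(4) in \<open>simp add: inj_on_image_eq_iff\<close>)
  show "(`) \<phi> ` images G g x \<subseteq> images K g (\<phi> x)"
  proof
    fix B assume "B \<in> (`) \<phi> ` images G g x"
    then obtain h where h: "admissible_rep G g x h" "B = \<phi> ` h ` carrier (surface_group g)"
      by (auto simp: images_def)
    have "B = (\<phi> \<circ> h) ` carrier (surface_group g)" by (simp add: h(2) image_comp)
    then show "B \<in> images K g (\<phi> x)"
      using admissible_rep_comp[OF assms(1-5) h(1)] unfolding images_def by blast
  qed
qed

lemma f_hat'_iso_le: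
  assumes "group G" "group K" "\<phi> \<in> iso G K"
  shows "f_hat' G g \<le> f_hat' K g"
proof -
  interpret G: group G by fact
  interpret K: group K by fact
  have \<phi>: "\<phi> \<in> hom G K" "bij_betw \<phi> (carrier G) (carrier K)"
    using assms(3) by (auto simp: iso_def)
  have \<psi>: "inv_into (carrier G) \<phi> \<in> hom K G"
    using G.iso_set_sym[OF assms(3)] by (simp add: iso_def)
  have surj: "\<phi> ` carrier G = carrier K" and inj: "inj_on \<phi> (carrier G)"
    using \<phi>(2) by (auto simp: bij_betw_def)
  have prim: "primitive_subgroup K (\<phi> ` carrier G)"
    unfolding surj primitive_subgroup_def using K.subgroup_self by simp
  have "num' G x \<le> f_hat' K g" if x: "x \<in> genus_elems G g" for x
  proof -
    have xG: "x \<in> carrier G" using x G.is_cp_closed by (auto simp: genus_elems_def)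
    have "g \<le> k" if "is_cp K k (\<phi> x)" for k
      using is_cp_hom[OF assms(2,1) \<psi> that] x xG inj by (simp add: genus_elems_def)
    then have "\<phi> x \<in> genus_elems K g"
      using is_cp_hom[OF assms(1,2) \<phi>(1)] x by (auto simp: genus_elems_def)
    then show ?thesis
      using num'_transfer[OF assms(1,2) \<phi>(1) inj prim x] num'_le_f_hat'[OF assms(2)]
      by (metis order_trans)
  qed
  then show ?thesis by (simp add: f_hat'_eq[OF assms(1)] SUP_least)
qed

section \<open>Free products\<close>

text \<open>The letters are coloured, and \<open>A q\<close> is a subgroup of words of colour \<open>q\<close>. The alternating
  words are the normal forms of the elements of the subgroup generated by both.\<close>

inductive_set alt :: "('x \<Rightarrow> bool) \<Rightarrow> (bool \<Rightarrow> 'x letter list set) \<Rightarrow> 'x letter list set"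
  for col A where
  Nil: "[] \<in> alt col A"
| step: "a \<in> A q \<Longrightarrow> a \<noteq> [] \<Longrightarrow> w \<in> alt col A \<Longrightarrow> w = [] \<or> col (fst (hd w)) \<noteq> q \<Longrightarrow>
    a @ w \<in> alt col A"

locale coloured_subgroups =
  fixes X :: "'x set" and col :: "'x \<Rightarrow> bool" and A :: "bool \<Rightarrow> 'x letter list set"
  assumes sub: "\<And>q. subgroup (A q) (free_group X)"
    and colour: "\<And>q a l. a \<in> A q \<Longrightarrow> l \<in> set a \<Longrightarrow> col (fst l) = q"
begin

lemmas alt_step = alt.step[where A = A and col = col]

lemma A_carrier: "a \<in> A q \<Longrightarrow> reduced a \<and> fst ` set a \<subseteq> X"
  using subgroup.mem_carrier[OF sub] by (simp add: free_group_carrier)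

lemma A_last: "a \<in> A q \<Longrightarrow> a \<noteq> [] \<Longrightarrow> col (fst (last a)) = q"
  using colour last_in_set by blast

lemma A_hd: "a \<in> A q \<Longrightarrow> a \<noteq> [] \<Longrightarrow> col (fst (hd a)) = q"
  using colour hd_in_set by blast

lemma alt_carrier: "w \<in> alt col A \<Longrightarrow> w \<in> carrier (free_group X)"
proof (induction rule: alt.induct)
  case Nil
  show ?case by (simp add: free_group_carrier)
next
  case (step a q w)
  have "hd w \<noteq> letter_inv (last a)" if "w \<noteq> []"
    using step.hyps that A_last[OF step.hyps(1,2)] by (metis fst_letter_inv)
  then show ?case
    using A_carrier[OF step.hyps(1)] step.IH by (auto simp: free_group_carrier reduced_append)
qed

lemma A_in_alt: "a \<in> A q \<Longrightarrow> a \<in> alt col A"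
  using alt_step[of a q "[]"] by (cases "a = []") (auto intro: alt.Nil)

lemma nf_nf_append: "nf (nf u @ v) = nf (u @ v)" by (simp add: nf_append nf_reduced reduced_nf)

text \<open>Either the colours alternate and the words are concatenated, or the first syllable
  absorbs \<open>a\<close>; should that product vanish, the remainder is already
  alternating.\<close>

lemma alt_mult:
  assumes a: "a \<in> A q" and w: "w \<in> alt col A"
  shows "a \<otimes>\<^bsub>free_group X\<^esub> w \<in> alt col A" using w
proof (cases rule: alt.cases)
  case Nil
  then show ?thesis
    using A_in_alt[OF a] A_carrier[OF a] by (simp add: free_group_mult_nf nf_reduced)
next
  case (step s q' w')
  have rw: "reduced w" using alt_carrier[OF w] by (simp add: free_group_carrier)
  show ?thesis
  proof (cases "a = [] \<or> q' \<noteq> q")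
    case True
    then have "a @ w \<in> alt col A"
      using alt_step[OF a, of w] w A_hd[OF step(2,3)] step(1,3) by (cases "a = []") auto
    moreover from alt_carrier[OF this] have "a \<otimes>\<^bsub>free_group X\<^esub> w = a @ w"
      using rw by (simp add: free_group_mult_nf nf_reduced free_group_carrier)
    ultimately show ?thesis by simp
  next
    case False
    then have s: "s \<in> A q" "w' = [] \<or> col (fst (hd w')) \<noteq> q" using step by auto
    define r where "r = nf (a @ s)"
    have r: "r \<in> A q" using subgroup.m_closed[OF sub a s(1)] A_carrier[OF s(1)]
      by (simp add: free_group_mult_nf r_def)
    have "a \<otimes>\<^bsub>free_group X\<^esub> w = nf (r @ w')"
      using rw by (simp add: free_group_mult_nf step(1) r_def nf_nf_append)
    moreover have rw': "r @ w' \<in> alt col A"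
      using alt_step[OF r _ step(4) s(2)] step(4) by (cases "r = []") auto
    moreover have "nf (r @ w') = r @ w'"
      using alt_carrier[OF rw'] by (simp add: nf_reduced free_group_carrier)
    ultimately show ?thesis by simp
  qed
qed

lemma alt_monochromatic:
  assumes "w \<in> alt col A" "\<forall>l\<in>set w. col (fst l) = q"
  shows "w \<in> A q" using assms(1)
proof (cases rule: alt.cases)
  case Nil
  then show ?thesis using subgroup.one_closed[OF sub] by (simp add: free_group_one)
next
  case (step a q' w')
  then have "q' = q" using A_hd[OF step(2,3)] assms(2) by (metis Un_iff hd_in_set set_append)
  moreover have "w' = []" using step(1,5) assms(2) \<open>q' = q\<close> hd_in_set[of w'] by auto
  ultimately show ?thesis using step by simp
qed

text \<open>A syllable has one colour, so the colour changes only at a seam between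
  syllables.\<close>

lemma alt_split:
  assumes "x @ y \<in> alt col A" "x \<noteq> []" "y \<noteq> []" "col (fst (last x)) \<noteq> col (fst (hd y))"
  shows "x \<in> alt col A \<and> y \<in> alt col A"
proof -
  have "\<forall>x y. z = x @ y \<longrightarrow> x \<noteq> [] \<longrightarrow> y \<noteq> [] \<longrightarrow> col (fst (last x)) \<noteq> col (fst (hd y)) \<longrightarrow>
      x \<in> alt col A \<and> y \<in> alt col A" if "z \<in> alt col A" for z using that
  proof (induction rule: alt.induct)
    case (step a q w)
    show ?case
    proof (intro allI impI)
      fix x y
      assume xy: "a @ w = x @ y" "x \<noteq> []" "y \<noteq> []" "col (fst (last x)) \<noteq> col (fst (hd y))"
      from xy(1) consider us where "x = a @ us" "w = us @ y" | us where "a = x @ us" "us @ w = y"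
        using append_eq_append_conv2[of a w x y] by auto
      then show "x \<in> alt col A \<and> y \<in> alt col A"
      proof cases
        case 1
        show ?thesis
        proof (cases "us = []")
          case True
          then show ?thesis using 1 step.hyps A_in_alt by simp
        next
          case False
          then have us: "us \<in> alt col A \<and> y \<in> alt col A" using step.IH 1 xy by simp
          moreover have "x \<in> alt col A" unfolding 1(1) using step.hyps(4) 1(2) False us
            by (intro alt_step[OF step.hyps(1,2)]) auto
          ultimately show ?thesis by simp
        qed
      next
        case 2
        show ?thesis
        proof (cases "us = []")
          case True
          then show ?thesis using 2 step.hyps A_in_alt by simp
        next
          case False
          then have "hd us \<in> set a" "last x \<in> set a" "hd y = hd us" using 2 xy(2) by auto
          then have "col (fst (hd y)) = q" "col (fst (last x)) = q"
            using colour[OF step.hyps(1)] by simp_all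
          then show ?thesis using xy(4) by simp
        qed
      qed
    qed
  qed simp
  then show ?thesis using assms by blast
qed

lemma alt_join:
  assumes "x \<in> alt col A" "y \<in> alt col A"
    and "x \<noteq> [] \<Longrightarrow> y \<noteq> [] \<Longrightarrow> col (fst (last x)) \<noteq> col (fst (hd y))"
  shows "x @ y \<in> alt col A" using assms(1,3)
proof (induction rule: alt.induct)
  case (step a q w)
  show ?case
  proof (cases "w = []")
    case True
    then show ?thesis
      using step.prems A_last[OF step.hyps(1,2)] A_in_alt[OF step.hyps(1)] step.hyps(2) assms(2)
      by (cases "y = []") (auto intro!: alt_step[OF step.hyps(1,2)])
  next
    case False
    then have "a @ (w @ y) \<in> alt col A" using step by (intro alt_step[OF step.hyps(1,2)]) auto
    then show ?thesis by simp
  qed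
qed (use assms(2) in simp)

text \<open>Write \<open>t = u c u^-1\<close> with \<open>c\<close> cyclically reduced. If
  \<open>c\<close> has two colours, cutting the first and the last copy of \<open>c\<close> in the
  power at the same colour change yields a beginning and an end of \<open>t\<close>, both
  alternating. If \<open>c\<close> has one colour, the middle of the power is a single syllable, to
  which primitivity of \<open>A q\<close> applies.\<close>

lemma alt_primitive:
  assumes prim: "\<And>q t n. t \<in> carrier (free_group X) \<Longrightarrow> \<forall>l\<in>set t. col (fst l) = q \<Longrightarrow> n \<ge> (1 :: nat) \<Longrightarrow>
      t [^]\<^bsub>free_group X\<^esub> n \<in> A q \<Longrightarrow> t \<in> A q"
    and t: "t \<in> carrier (free_group X)" "n \<ge> (1 :: nat)" "t [^]\<^bsub>free_group X\<^esub> n \<in> alt col A"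
  shows "t \<in> alt col A"
proof (cases "t = []")
  case False
  then obtain u c where uc: "t = u @ c @ winv u" "c \<noteq> []" "reduced (c @ c)"
    using cyclic_reduction[of t] t(1) by (auto simp: free_group_carrier)
  obtain m where n: "n = Suc m" using t(2) by (cases n) auto
  define C where "C = concat (replicate (Suc m) c)"
  have C1: "C = c @ concat (replicate m c)" by (simp add: C_def)
  have C2: "C = concat (replicate m c) @ c" unfolding C_def by (induction m) auto
  have pow: "t [^]\<^bsub>free_group X\<^esub> n = u @ C @ winv u"
    using free_group_power[OF t(1)[unfolded uc(1)] uc(2,3), of m] by (simp add: uc(1) n C_def)
  define q where "q = col (fst (hd c))"
  show ?thesis
  proof (cases "\<forall>l\<in>set c. col (fst l) = q")
    case False
    define c1 c2 where "c1 = takeWhile (\<lambda>l. col (fst l) = q) c"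
      and "c2 = dropWhile (\<lambda>l. col (fst l) = q) c"
    have c: "c = c1 @ c2" by (simp add: c1_def c2_def)
    have "c1 \<noteq> []" using uc(2) by (cases c) (auto simp: c1_def q_def)
    have "c2 \<noteq> []" using False by (simp add: c2_def dropWhile_eq_Nil_conv)
    have "col (fst (last c1)) = q"
      using last_in_set[OF \<open>c1 \<noteq> []\<close>] set_takeWhileD unfolding c1_def by metis
    moreover have "col (fst (hd c2)) \<noteq> q"
      using hd_dropWhile \<open>c2 \<noteq> []\<close> unfolding c2_def by blast
    ultimately have ch: "col (fst (last c1)) \<noteq> col (fst (hd c2))" by simp
    have "(u @ c1) @ (c2 @ concat (replicate m c) @ winv u) \<in> alt col A"
      using t(3) unfolding pow C1 c by simp
    then have 1: "u @ c1 \<in> alt col A"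
      using alt_split[of "u @ c1" "c2 @ concat (replicate m c) @ winv u"] ch \<open>c1 \<noteq> []\<close> \<open>c2 \<noteq> []\<close> by simp
    have "(u @ concat (replicate m c) @ c1) @ (c2 @ winv u) \<in> alt col A"
      using t(3) unfolding pow C2 by (simp add: c)
    then have "c2 @ winv u \<in> alt col A"
      using alt_split[of "u @ concat (replicate m c) @ c1" "c2 @ winv u"] ch \<open>c1 \<noteq> []\<close> \<open>c2 \<noteq> []\<close>
      by simp
    then have "(u @ c1) @ (c2 @ winv u) \<in> alt col A"
      using alt_join[OF 1] ch \<open>c1 \<noteq> []\<close> \<open>c2 \<noteq> []\<close> by simp
    then show ?thesis by (simp add: uc(1) c)
  next
    case True
    \<comment> \<open>The syllable around \<open>c\<close> may reach into \<open>u\<close>: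
      \<open>s\<close> is the longest suffix of \<open>u\<close> of colour \<open>q\<close>, so that
      \<open>M\<close> and \<open>b\<close> are the middle syllables of the power and of
      \<open>t\<close>.\<close>
    define s where "s = rev (takeWhile (\<lambda>l. col (fst l) = q) (rev u))"
    define u' where "u' = rev (dropWhile (\<lambda>l. col (fst l) = q) (rev u))"
    have u: "u = u' @ s" by (simp add: u'_def s_def flip: rev_append)
    have sq: "\<forall>l\<in>set s. col (fst l) = q" by (auto simp: s_def dest: set_takeWhileD)
    have u'q: "col (fst (last u')) \<noteq> q" if "u' \<noteq> []"
      using hd_dropWhile[of "\<lambda>l. col (fst l) = q" "rev u"] that by (simp add: u'_def last_rev)
    define M where "M = s @ C @ winv s"
    define b where "b = s @ c @ winv s"
    have tb: "t = u' @ b @ winv u'" by (simp add: b_def uc(1) u)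
    have b: "b \<in> carrier (free_group X)"
      using t(1) unfolding tb by (auto simp: free_group_carrier reduced_append)
    have bM: "b [^]\<^bsub>free_group X\<^esub> n = M"
      using free_group_power[OF b[unfolded b_def] uc(2,3), of m] by (simp add: b_def M_def n C_def)
    have Cq: "\<forall>l\<in>set C. col (fst l) = q" using True by (auto simp: C_def)
    have Mq: "\<forall>l\<in>set M. col (fst l) = q" using Cq sq by (auto simp: M_def)
    have bq: "\<forall>l\<in>set b. col (fst l) = q" using True sq by (auto simp: b_def)
    have ne: "M \<noteq> []" "b \<noteq> []" using uc(2) by (auto simp: M_def b_def C1)
    have tM: "u' @ M @ winv u' \<in> alt col A" using t(3) unfolding pow by (simp add: M_def u)
    have "hd M \<in> set M" "last M \<in> set M" "hd b \<in> set b" "last b \<in> set b" using ne by auto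
    then have hl: "col (fst (hd M)) = q" "col (fst (last M)) = q" "col (fst (hd b)) = q"
        "col (fst (last b)) = q" using Mq bq by auto
    have hw: "col (fst (hd (winv u'))) \<noteq> q" if "u' \<noteq> []"
      using u'q that by (simp add: hd_rev last_map)
    have parts: "u' \<in> alt col A \<and> M \<in> alt col A \<and> winv u' \<in> alt col A"
    proof (cases "u' = []")
      case True
      then show ?thesis using tM by (simp add: alt.Nil)
    next
      case False
      then have "u' \<in> alt col A \<and> M @ winv u' \<in> alt col A"
        using alt_split[OF tM] ne hl u'q by simp
      moreover then have "M \<in> alt col A \<and> winv u' \<in> alt col A"
        using alt_split[of M "winv u'"] ne hl hw False by simp
      ultimately show ?thesis by simp
    qed
    then have "M \<in> A q" using alt_monochromatic Mq by simp
    then have "b \<in> A q" using prim[OF b bq t(2)] bM by simp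
    then have "b \<in> alt col A" by (rule A_in_alt)
    moreover then have "b @ winv u' \<in> alt col A" using parts hl hw by (intro alt_join) auto
    ultimately have "u' @ b @ winv u' \<in> alt col A"
      using parts hl u'q hw ne by (intro alt_join) auto
    then show ?thesis by (simp add: tb)
  qed
qed (simp add: alt.Nil)

end

section \<open>Relabelling of generators and the two copies of a free group\<close>

definition wmap :: "('x \<Rightarrow> 'y) \<Rightarrow> 'x letter list \<Rightarrow> 'y letter list" where
  "wmap f = map (\<lambda>(x, b). (f x, b))"

lemma wmap_simps [simp]: "wmap f [] = []" "wmap f (u @ v) = wmap f u @ wmap f v"
    "wmap f w = [] \<longleftrightarrow> w = []" by (simp_all add: wmap_def)

lemma set_wmap: "fst ` set (wmap f w) = f ` fst ` set w" by (force simp: wmap_def)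

lemma wmap_cancel_cons:
  "inj f \<Longrightarrow> wmap f (cancel_cons l w) = cancel_cons (f (fst l), snd l) (wmap f w)"
  by (cases w; cases l) (auto simp: wmap_def letter_inv_def inj_eq)

lemma wmap_foldr: "inj f \<Longrightarrow> wmap f (foldr cancel_cons u v) = foldr cancel_cons (wmap f u) (wmap f v)"
  by (induction u) (auto simp: wmap_cancel_cons, auto simp: wmap_def)

lemma reduced_wmap:
  assumes "inj f" "reduced w"
  shows "reduced (wmap f w)"
proof -
  have "wmap f w = foldr cancel_cons (wmap f w) []"
    using wmap_foldr[OF assms(1), of w "[]"] foldr_cancel_cons_Nil[OF assms(2)] by simp
  then show ?thesis using reduced_foldr[OF reduced_Nil] by metis
qed

lemma inj_wmap: "inj f \<Longrightarrow> inj (wmap f)"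
  unfolding wmap_def by (rule inj_mapI) (auto simp: inj_def)

lemma wmap_carrier:
  "inj f \<Longrightarrow> w \<in> carrier (free_group S) \<Longrightarrow> f ` S \<subseteq> T \<Longrightarrow> wmap f w \<in> carrier (free_group T)"
  unfolding free_group_carrier set_wmap by (auto intro: reduced_wmap)

lemma wmap_hom: "inj f \<Longrightarrow> f ` S \<subseteq> T \<Longrightarrow> wmap f \<in> hom (free_group S) (free_group T)"
  by (auto simp: hom_def wmap_carrier free_group_mult wmap_foldr)

lemma wmap_gen: "wmap f (free_gen x) = free_gen (f x)" by (simp add: wmap_def free_gen_def)

lemma eval_word_wmap: "eval_word G g (wmap f w) = eval_word G (\<lambda>x. g (f x)) w"
  by (induction w) (auto simp: wmap_def eval_word_def eval_letter_def)

lemma wmap_preimage: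
  assumes "\<forall>l\<in>set w. fst l \<in> f ` S"
  shows "\<exists>v. w = wmap f v \<and> fst ` set v \<subseteq> S" using assms
proof (induction w)
  case Nil
  show ?case by (intro exI[of _ "[]"]) simp
next
  case (Cons l w)
  then obtain v y where "w = wmap f v" "fst ` set v \<subseteq> S" "y \<in> S" "fst l = f y" by auto
  then show ?case by (intro exI[of _ "(y, snd l) # v"]) (cases l, simp add: wmap_def)
qed

lemma reduced_wmapD:
  assumes "reduced (wmap f w)"
  shows "reduced w" using assms
proof (induction w)
  case (Cons l w)
  then show ?case by (cases w) (auto simp: reduced_Cons wmap_def letter_inv_def split: prod.splits)
qed simp

text \<open>Killing the letters outside the range of \<open>f\<close> inverts the relabelling on the
  left, so the genus cannot drop.\<close>

lemma is_cp_wmap_inj: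
  assumes "inj f" "is_cp FU g (nf (wmap f w))" "w \<in> carrier (free_group S)"
  shows "is_cp (free_group S) g w"
proof -
  define k where "k y = (if y \<in> range f then free_gen (inv_into UNIV f y) else [])" for y
  have k: "k y \<in> carrier FU" for y
    using free_gen_carrier[of "inv_into UNIV f y" UNIV] by (simp add: k_def free_group_carrier)
  have "is_cp FU g (eval_word FU k (nf (wmap f w)))"
    by (rule is_cp_hom[OF group_free_group group_free_group eval_word_hom[OF group_free_group k]
        assms(2)])
  also have "eval_word FU k (nf (wmap f w)) = eval_word FU (\<lambda>x. k (f x)) w"
    by (simp add: eval_word_nf[OF group_free_group k] eval_word_wmap)
  also have "(\<lambda>x. k (f x)) = free_gen" using assms(1) by (simp add: k_def fun_eq_iff)
  also have "eval_word FU free_gen w = w"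
    using assms(3) by (simp add: eval_word_UNIV_nf nf_reduced free_group_carrier)
  finally show ?thesis using assms(3) by (rule is_cp_free_group_restrict)
qed

abbreviation is_Inl :: "'c + 'd \<Rightarrow> bool" where
  "is_Inl \<equiv> case_sum (\<lambda>_. True) (\<lambda>_. False)"

definition double :: "'c letter list set \<Rightarrow> 'c letter list set \<Rightarrow> bool \<Rightarrow> ('c + 'c) letter list set" where
  "double A B q = (if q then wmap Inl ` A else wmap Inr ` B)"

lemma coloured_double:
  assumes "subgroup A (free_group S)" "subgroup B (free_group S)"
  shows "coloured_subgroups (S <+> S) is_Inl (double A B)"
proof (rule coloured_subgroups.intro)
  have h: "wmap Inl \<in> hom (free_group S) (free_group (S <+> S))"
    "wmap Inr \<in> hom (free_group S) (free_group (S <+> S))" by (auto intro!: wmap_hom)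
  have "subgroup (f ` C) (free_group (S <+> S))"
    if f: "f \<in> hom (free_group S) (free_group (S <+> S))" and C: "subgroup C (free_group S)" for f C
  proof -
    interpret group_hom "free_group S" "free_group (S <+> S)" f
      using f by (simp add: group_hom_def group_hom_axioms_def group_free_group)
    show ?thesis by (rule subgroup_img_is_subgroup[OF C])
  qed
  then show "subgroup (double A B q) (free_group (S <+> S))" for q
    using h assms by (simp add: double_def)
  show "is_Inl (fst l) = q" if "a \<in> double A B q" "l \<in> set a" for a l q
    using that by (auto simp: double_def wmap_def split: if_splits)
qed

lemma double_primitive:
  assumes A: "primitive_subgroup (free_group S) A" and B: "primitive_subgroup (free_group S) B"
    and t: "t \<in> carrier (free_group (S <+> S))" "\<forall>l\<in>set t. is_Inl (fst l) = q" "n \<ge> (1 :: nat)"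
      "t [^]\<^bsub>free_group (S <+> S)\<^esub> n \<in> double A B q"
  shows "t \<in> double A B q"
proof -
  have main: "t \<in> wmap f ` C"
    if f: "inj f" "f ` S \<subseteq> S <+> S" and C: "primitive_subgroup (free_group S) C"
      and tf: "\<forall>l\<in>set t. fst l \<in> f ` S" and tn: "t [^]\<^bsub>free_group (S <+> S)\<^esub> n \<in> wmap f ` C"
    for f :: "'a \<Rightarrow> 'a + 'a" and C
  proof -
    obtain v where v: "t = wmap f v" "fst ` set v \<subseteq> S" using wmap_preimage[OF tf] by blast
    have vS: "v \<in> carrier (free_group S)"
      using v t(1) reduced_wmapD by (auto simp: free_group_carrier)
    obtain c where c: "c \<in> C" "t [^]\<^bsub>free_group (S <+> S)\<^esub> n = wmap f c" using tn by blast
    have cS: "c \<in> carrier (free_group S)"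
      using C c(1) subgroup.mem_carrier by (auto simp: primitive_subgroup_def)
    have "v [^]\<^bsub>free_group S\<^esub> n = c"
      by (rule inj_hom_power_cancel[OF group_free_group group_free_group wmap_hom[OF f]
          inj_on_subset[OF inj_wmap[OF f(1)]] vS cS]) (use c(2) v(1) in auto)
    then have "v \<in> C" using C c(1) vS t(3) by (auto simp: primitive_subgroup_def)
    then show ?thesis using v(1) by blast
  qed
  have S: "fst l \<in> S <+> S" if "l \<in> set t" for l using t(1) that by (auto simp: free_group_carrier)
  show ?thesis
  proof (cases q)
    case True
    then have "\<forall>l\<in>set t. fst l \<in> Inl ` S" using S t(2) by (fastforce split: sum.splits)
    then show ?thesis using main[of Inl A] A t(4) True by (auto simp: double_def)
  next
    case False
    then have "\<forall>l\<in>set t. fst l \<in> Inr ` S" using S t(2) by (fastforce split: sum.splits)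
    then show ?thesis using main[of Inr B] B t(4) False by (auto simp: double_def)
  qed
qed

section \<open>The surface group of genus m + n as a free product\<close>

definition shift_gen :: "nat \<Rightarrow> surface_gen \<Rightarrow> surface_gen" where
  "shift_gen m y = (case y of SA i \<Rightarrow> SA (i + m) | SB i \<Rightarrow> SB (i + m))"

definition low_gen :: "nat \<Rightarrow> surface_gen \<Rightarrow> bool" where
  "low_gen m y = (case y of SA i \<Rightarrow> i \<le> m | SB i \<Rightarrow> i \<le> m)"

definition surface_gens :: "nat \<Rightarrow> surface_gen set" where
  "surface_gens g = SA ` {1..g} \<union> SB ` {1..g}"

lemma surface_group_eq: "surface_group g = free_group (surface_gens g)"
  by (simp add: surface_group_def surface_gens_def)

lemma inj_shift_gen: "inj (shift_gen m)"
  by (auto simp: inj_def shift_gen_def split: surface_gen.splits)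

lemma surface_gens_add: "surface_gens (m + n) = surface_gens m \<union> shift_gen m ` surface_gens n"
proof -
  have "{1..m + n} = {1..m} \<union> (\<lambda>i. i + m) ` {1..n}"
    by (simp add: image_add_atLeastAtMost) auto
  then show ?thesis unfolding surface_gens_def
    by (simp only: image_Un image_image shift_gen_def surface_gen.case) blast
qed

lemma low_gen_low: "y \<in> surface_gens m \<Longrightarrow> low_gen m y"
  by (auto simp: surface_gens_def low_gen_def)

lemma low_gen_high: "y \<in> surface_gens n \<Longrightarrow> \<not> low_gen m (shift_gen m y)"
  by (auto simp: surface_gens_def low_gen_def shift_gen_def)

definition split_surface :: "nat \<Rightarrow> nat \<Rightarrow> bool \<Rightarrow> surface_gen letter list set" where
  "split_surface m n q = (if q then carrier (surface_group m)
     else wmap (shift_gen m) ` carrier (surface_group n))"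

lemma coloured_split_surface:
  "coloured_subgroups (surface_gens (m + n)) (low_gen m) (split_surface m n)"
proof (rule coloured_subgroups.intro)
  have "subgroup (id ` carrier (surface_group m)) (surface_group (m + n))"
  proof -
    have "id \<in> hom (surface_group m) (surface_group (m + n))"
      by (fastforce simp: hom_def surface_group_eq free_group_mult free_group_carrier surface_gens_add)
    then interpret group_hom "surface_group m" "surface_group (m + n)" id
      by (simp add: group_hom_def group_hom_axioms_def group_surface_group)
    show ?thesis by (rule img_is_subgroup)
  qed
  moreover have "subgroup (wmap (shift_gen m) ` carrier (surface_group n)) (surface_group (m + n))"
  proof -
    have "wmap (shift_gen m) \<in> hom (surface_group n) (surface_group (m + n))"
      unfolding surface_group_eq by (rule wmap_hom[OF inj_shift_gen]) (auto simp: surface_gens_add)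
    then interpret group_hom "surface_group n" "surface_group (m + n)" "wmap (shift_gen m)"
      by (simp add: group_hom_def group_hom_axioms_def group_surface_group)
    show ?thesis by (rule img_is_subgroup)
  qed
  ultimately show "subgroup (split_surface m n q) (free_group (surface_gens (m + n)))" for q
    by (simp add: split_surface_def surface_group_eq)
  show "low_gen m (fst l) = q" if a: "a \<in> split_surface m n q" and l: "l \<in> set a" for a l q
  proof (cases q)
    case True
    then have "fst l \<in> surface_gens m"
      using a l by (auto simp: split_surface_def surface_group_eq free_group_carrier)
    then show ?thesis using True low_gen_low by simp
  next
    case False
    then obtain w where w: "w \<in> carrier (surface_group n)" "a = wmap (shift_gen m) w"
      using a by (auto simp: split_surface_def)
    have "fst l \<in> fst ` set (wmap (shift_gen m) w)" using l w(2) by simp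
    then obtain y where "y \<in> surface_gens n" "fst l = shift_gen m y"
      using w(1) unfolding set_wmap by (auto simp: surface_group_eq free_group_carrier)
    then show ?thesis using False low_gen_high by simp
  qed
qed

lemma cprod_cong:
  assumes "\<And>i. i < n \<Longrightarrow> a i = a' i" "\<And>i. i < n \<Longrightarrow> b i = b' i"
  shows "cprod G n a b = cprod G n a' b'" using assms
proof (induction n arbitrary: a b a' b')
  case (Suc n)
  have "cprod G n (\<lambda>i. a (Suc i)) (\<lambda>i. b (Suc i)) = cprod G n (\<lambda>i. a' (Suc i)) (\<lambda>i. b' (Suc i))"
    by (rule Suc.IH) (simp_all add: Suc.prems)
  moreover have "a 0 = a' 0" "b 0 = b' 0" using Suc.prems by simp_all
  ultimately show ?case by simp
qed simp

text \<open>\<open>h\<close> acts as \<open>h1\<close> on the first \<open>m\<close> handles and as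
  \<open>h2\<close> on the others. It sends syllables to nonempty syllables of the same colour, so
  nothing cancels; this gives injectivity and identifies the image, and \<open>alt_primitive\<close>
  makes it primitive.\<close>

lemma admissible_rep_double:
  assumes h1: "admissible_rep (free_group S) m x h1" and h2: "admissible_rep (free_group S) n y h2"
  shows "\<exists>h. admissible_rep (free_group (S <+> S)) (m + n)
        (wmap Inl x \<otimes>\<^bsub>free_group (S <+> S)\<^esub> wmap Inr y) h \<and>
      h ` carrier (surface_group (m + n)) =
        alt is_Inl (double (h1 ` carrier (surface_group m)) (h2 ` carrier (surface_group n)))"
proof -
  let ?X = "free_group (S <+> S)" and ?S = "free_group S"
  let ?H = "surface_group (m + n)"
  define A where "A = double (h1 ` carrier (surface_group m)) (h2 ` carrier (surface_group n))"
  note hh1 = h1[unfolded admissible_rep_def genus_rep_iff[OF group_free_group]]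
  note hh2 = h2[unfolded admissible_rep_def genus_rep_iff[OF group_free_group]]
  have hom1: "h1 \<in> hom (surface_group m) ?S" and hom2: "h2 \<in> hom (surface_group n) ?S"
    using hh1 hh2 by auto
  interpret X: group ?X by (rule group_free_group)
  interpret H: group ?H by (rule group_surface_group)
  interpret A: coloured_subgroups "S <+> S" is_Inl A unfolding A_def by (rule coloured_double)
      (use hh1 hh2 in \<open>auto simp: primitive_subgroup_def\<close>)
  interpret B: coloured_subgroups "surface_gens (m + n)" "low_gen m" "split_surface m n"
    by (rule coloured_split_surface)
  have iL: "wmap Inl \<in> hom ?S ?X" "inj (wmap (Inl :: 'a \<Rightarrow> 'a + 'a))"
    by (auto intro!: wmap_hom inj_wmap)
  have iR: "wmap Inr \<in> hom ?S ?X" "inj (wmap (Inr :: 'a \<Rightarrow> 'a + 'a))"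
    by (auto intro!: wmap_hom inj_wmap)
  define f where "f y = (if y \<in> surface_gens m then wmap Inl (h1 (free_gen y))
     else if y \<in> shift_gen m ` surface_gens n
       then wmap Inr (h2 (free_gen (inv_into UNIV (shift_gen m) y))) else [])" for y
  have f: "f y \<in> carrier ?X" for y using hom_in_carrier[OF iL(1) hom_in_carrier[OF hom1]]
      hom_in_carrier[OF iR(1) hom_in_carrier[OF hom2]] inj_shift_gen[of m]
    by (auto simp: f_def surface_group_eq free_gen_carrier free_group_carrier[of "[]"])
  define h where "h = eval_word ?X f"
  have hom: "h \<in> hom (free_group Y) ?X" for Y
    unfolding h_def by (rule eval_word_hom[OF group_free_group f])
  have hgen: "h (free_gen y) = f y" for y
    unfolding h_def by (rule eval_word_gen[OF group_free_group f])
  have low: "h w = wmap Inl (h1 w)" if "w \<in> carrier (surface_group m)" for w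
  proof (rule free_group_extend_unique[OF group_free_group hom])
    show "(\<lambda>w. wmap Inl (h1 w)) \<in> hom (free_group (surface_gens m)) ?X"
      using hom_compose[OF hom1 iL(1)] by (simp add: comp_def surface_group_eq)
  qed (use that in \<open>auto simp: hgen f_def surface_group_eq\<close>)
  have high: "h (wmap (shift_gen m) w) = wmap Inr (h2 w)" if "w \<in> carrier (surface_group n)" for w
  proof (rule free_group_extend_unique[OF group_free_group, of _ "surface_gens n"])
    have "wmap (shift_gen m) \<in> hom (free_group (surface_gens n)) FU"
      by (rule wmap_hom[OF inj_shift_gen]) simp
    from hom_compose[OF this hom]
    show "(\<lambda>w. h (wmap (shift_gen m) w)) \<in> hom (free_group (surface_gens n)) ?X"
      by (simp add: comp_def)
    show "(\<lambda>w. wmap Inr (h2 w)) \<in> hom (free_group (surface_gens n)) ?X"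
      using hom_compose[OF hom2 iR(1)] by (simp add: comp_def surface_group_eq)
    show "h (wmap (shift_gen m) (free_gen y)) = wmap Inr (h2 (free_gen y))"
      if "y \<in> surface_gens n" for y
    proof -
      have "shift_gen m y \<notin> surface_gens m" using low_gen_low low_gen_high that by blast
      then show ?thesis using that inj_shift_gen[of m] by (simp add: wmap_gen hgen f_def)
    qed
  qed (use that in \<open>simp add: surface_group_eq\<close>)
  have hB: "h a \<in> A q" if "a \<in> split_surface m n q" for a q
    using that low high by (cases q) (auto simp: split_surface_def A_def double_def)
  have hne: "h a \<noteq> []" if a: "a \<in> split_surface m n q" "a \<noteq> []" for a q
  proof (cases q)
    case True
    then have am: "a \<in> carrier (surface_group m)" using a by (simp add: split_surface_def)
    have "h1 a \<noteq> h1 []" using hh1 am a(2) inj_onD[of h1 "carrier (surface_group m)" a "[]"]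
      by (auto simp: surface_group_eq free_group_carrier)
    moreover have "h1 [] = []" using hom_one[OF hom1 group_surface_group group_free_group]
      by (simp add: surface_group_eq free_group_one)
    ultimately show ?thesis using low[OF am] by simp
  next
    case False
    then obtain w where w: "w \<in> carrier (surface_group n)" "a = wmap (shift_gen m) w"
      using a by (auto simp: split_surface_def)
    have "h2 w \<noteq> h2 []" using hh2 w a(2) inj_onD[of h2 "carrier (surface_group n)" w "[]"]
      by (auto simp: surface_group_eq free_group_carrier)
    moreover have "h2 [] = []" using hom_one[OF hom2 group_surface_group group_free_group]
      by (simp add: surface_group_eq free_group_one)
    ultimately show ?thesis using high[OF w(1)] w(2) by simp
  qed
  have altH: "w \<in> alt (low_gen m) (split_surface m n)" if "w \<in> carrier ?H" for w using that
  proof (induction w)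
    case (Cons l w)
    have red: "reduced (l # w)" "w \<in> carrier ?H" "fst l \<in> surface_gens (m + n)"
      using Cons.prems by (auto simp: surface_group_eq free_group_carrier reduced_Cons)
    have "\<exists>q. [l] \<in> split_surface m n q"
    proof (cases "fst l \<in> surface_gens m")
      case True
      then show ?thesis
        by (intro exI[of _ True]) (simp add: split_surface_def surface_group_eq free_group_carrier)
    next
      case False
      then obtain y where y: "y \<in> surface_gens n" "fst l = shift_gen m y"
        using red(3) by (auto simp: surface_gens_add)
      have "[l] = wmap (shift_gen m) [(y, snd l)]" using y(2) by (cases l) (simp add: wmap_def)
      then show ?thesis using y(1)
        by (intro exI[of _ False]) (auto simp: split_surface_def surface_group_eq free_group_carrier)
    qed
    then obtain q where "[l] \<in> split_surface m n q" by blast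
    from B.alt_mult[OF this Cons.IH[OF red(2)]] show ?case
      using red(1) by (simp add: free_group_mult cancel_cons_reduced)
  qed (simp add: alt.Nil)
  \<comment> \<open>The colour of the first letter is carried through the induction, as it ensures
    that the image syllables alternate.\<close>
  have key: "h w \<in> alt is_Inl A \<and> (w \<noteq> [] \<longrightarrow> h w \<noteq> [] \<and> is_Inl (fst (hd (h w))) = low_gen m (fst (hd w)))"
    if "w \<in> alt (low_gen m) (split_surface m n)" for w using that
  proof (induction rule: alt.induct)
    case Nil
    show ?case by (simp add: h_def eval_word_def free_group_one alt.Nil)
  next
    case (step a q w)
    have ha: "h a \<in> A q" "h a \<noteq> []" using hB hne step.hyps by auto
    have "w = [] \<or> h w = [] \<or> is_Inl (fst (hd (h w))) \<noteq> q" using step.IH step.hyps(4) by auto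
    moreover have "h w = []" if "w = []" using that by (simp add: h_def eval_word_def free_group_one)
    ultimately have alt: "h a @ h w \<in> alt is_Inl A"
      using step.IH by (intro A.alt_step[OF ha]) auto
    have "h (a @ w) = h a \<otimes>\<^bsub>?X\<^esub> h w"
      unfolding h_def by (rule eval_word_append[OF group_free_group f])
    also have "\<dots> = h a @ h w" using A.alt_carrier[OF alt]
      by (simp add: free_group_mult_nf nf_reduced free_group_carrier reduced_append)
    finally have eq: "h (a @ w) = h a @ h w" .
    then show ?case using alt ha A.A_hd[OF ha] B.A_hd[OF step.hyps(1,2)] step.hyps(2) by simp
  qed
  interpret hom: group_hom ?H ?X h using hom[of "surface_gens (m + n)"]
    by (simp add: group_hom_def group_hom_axioms_def group_surface_group group_free_group
        surface_group_eq)
  have subg: "subgroup (h ` carrier ?H) ?X" by (rule hom.img_is_subgroup)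
  have img: "h ` carrier ?H = alt is_Inl A"
  proof
    show "h ` carrier ?H \<subseteq> alt is_Inl A" using key altH by auto
    show "alt is_Inl A \<subseteq> h ` carrier ?H"
    proof
      fix v assume "v \<in> alt is_Inl A"
      then show "v \<in> h ` carrier ?H"
      proof (induction rule: alt.induct)
        case Nil
        show ?case using subgroup.one_closed[OF subg] by (simp add: free_group_one)
      next
        case (step a q w)
        have "a @ w \<in> carrier ?X" by (rule A.alt_carrier[OF alt.step[OF step.hyps(1,2,3,4)]])
        then have "a @ w = a \<otimes>\<^bsub>?X\<^esub> w"
          by (simp add: free_group_mult_nf nf_reduced free_group_carrier reduced_append)
        moreover have "a \<in> h ` carrier ?H"
        proof -
          have "\<exists>b \<in> split_surface m n q. a = h b" using step.hyps(1) low high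
            by (cases q) (auto simp: split_surface_def A_def double_def image_iff)
          then show ?thesis using subgroup.subset[OF B.sub[of q]] by (auto simp: surface_group_eq)
        qed
        ultimately show ?case using subgroup.m_closed[OF subg _ step.IH] by simp
      qed
    qed
  qed
  have "inj_on h (carrier ?H)"
  proof -
    have "w = \<one>\<^bsub>?H\<^esub>" if "w \<in> carrier ?H" "h w = \<one>\<^bsub>?X\<^esub>" for w
      using key[OF altH, of w] that by (auto simp: free_group_one surface_group_eq)
    then show ?thesis using hom.inj_on_one_iff by blast
  qed
  moreover have "primitive_subgroup ?X (h ` carrier ?H)" unfolding primitive_subgroup_def
  proof (intro conjI ballI allI impI)
    fix t and k :: nat assume t: "t \<in> carrier ?X" "k \<ge> 1" "t [^]\<^bsub>?X\<^esub> k \<in> h ` carrier ?H"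
    show "t \<in> h ` carrier ?H" unfolding img
    proof (rule A.alt_primitive[OF _ t(1,2)])
      show "t [^]\<^bsub>?X\<^esub> k \<in> alt is_Inl A" using t(3) by (simp add: img)
      show "t \<in> A q" if "t \<in> carrier ?X" "\<forall>l\<in>set t. is_Inl (fst l) = q" "n \<ge> 1"
        "t [^]\<^bsub>?X\<^esub> n \<in> A q" for q t and n :: nat
        using double_primitive[of S _ _ t q n] hh1 hh2 that unfolding A_def by blast
    qed
  qed (rule subg)
  moreover have "genus_rep ?X (m + n) (wmap Inl x \<otimes>\<^bsub>?X\<^esub> wmap Inr y) h"
  proof -
    have g1: "h (free_gen (SA (Suc i))) = wmap Inl (h1 (free_gen (SA (Suc i))))"
      "h (free_gen (SB (Suc i))) = wmap Inl (h1 (free_gen (SB (Suc i))))" if "i < m" for i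
      using low surface_gen_carrier[OF that] by auto
    have g2: "h (free_gen (SA (Suc (m + i)))) = wmap Inr (h2 (free_gen (SA (Suc i))))"
      "h (free_gen (SB (Suc (m + i)))) = wmap Inr (h2 (free_gen (SB (Suc i))))" if "i < n" for i
      using high[OF surface_gen_carrier(1)[OF that]] high[OF surface_gen_carrier(2)[OF that]]
      by (simp_all add: wmap_gen shift_gen_def add.commute)
    have c1: "h1 (free_gen (SA (Suc i))) \<in> carrier ?S" "h1 (free_gen (SB (Suc i))) \<in> carrier ?S"
      if "i < m" for i using hom_in_carrier[OF hom1] surface_gen_carrier[OF that] by auto
    have c2: "h2 (free_gen (SA (Suc i))) \<in> carrier ?S" "h2 (free_gen (SB (Suc i))) \<in> carrier ?S"
      if "i < n" for i using hom_in_carrier[OF hom2] surface_gen_carrier[OF that] by auto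
    have "cprod ?X (m + n) (\<lambda>i. h (free_gen (SA (Suc i)))) (\<lambda>i. h (free_gen (SB (Suc i))))
      = cprod ?X m (\<lambda>i. h (free_gen (SA (Suc i)))) (\<lambda>i. h (free_gen (SB (Suc i)))) \<otimes>\<^bsub>?X\<^esub>
        cprod ?X n (\<lambda>i. h (free_gen (SA (Suc (m + i))))) (\<lambda>i. h (free_gen (SB (Suc (m + i)))))"
      by (rule X.cprod_add) (simp_all add: hgen f)
    also have "cprod ?X m (\<lambda>i. h (free_gen (SA (Suc i)))) (\<lambda>i. h (free_gen (SB (Suc i))))
      = cprod ?X m (\<lambda>i. wmap Inl (h1 (free_gen (SA (Suc i))))) (\<lambda>i. wmap Inl (h1 (free_gen (SB (Suc i)))))"
      by (rule cprod_cong) (simp_all add: g1)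
    also have "\<dots> = wmap Inl x"
      using hom_cprod[OF group_free_group group_free_group iL(1), where n = m and
          a = "\<lambda>i. h1 (free_gen (SA (Suc i)))" and b = "\<lambda>i. h1 (free_gen (SB (Suc i)))"] c1 hh1
      by simp
    also have "cprod ?X n (\<lambda>i. h (free_gen (SA (Suc (m + i))))) (\<lambda>i. h (free_gen (SB (Suc (m + i)))))
      = cprod ?X n (\<lambda>i. wmap Inr (h2 (free_gen (SA (Suc i))))) (\<lambda>i. wmap Inr (h2 (free_gen (SB (Suc i)))))"
      by (rule cprod_cong) (simp_all add: g2)
    also have "\<dots> = wmap Inr y"
      using hom_cprod[OF group_free_group group_free_group iR(1), where n = n and
          a = "\<lambda>i. h2 (free_gen (SA (Suc i)))" and b = "\<lambda>i. h2 (free_gen (SB (Suc i)))"] c2 hh2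
      by simp
    finally show ?thesis using hom[of "surface_gens (m + n)"]
      by (simp add: genus_rep_iff[OF group_free_group] surface_group_eq)
  qed
  ultimately show ?thesis using img unfolding admissible_rep_def A_def by blast
qed

text \<open>Each factor is recovered as the set of elements of one colour.\<close>

lemma double_inject:
  assumes "subgroup A (free_group S)" "subgroup B (free_group S)"
    "subgroup A' (free_group S)" "subgroup B' (free_group S)"
    and "alt is_Inl (double A B) = alt is_Inl (double A' B')"
  shows "A = A' \<and> B = B'"
proof -
  interpret D: coloured_subgroups "S <+> S" is_Inl "double A B" by (rule coloured_double[OF assms(1,2)])
  interpret D': coloured_subgroups "S <+> S" is_Inl "double A' B'"
    by (rule coloured_double[OF assms(3,4)])
  have "double A B q = double A' B' q" for q
  proof (intro equalityI subsetI)
    fix a assume a: "a \<in> double A B q"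
    then have "a \<in> alt is_Inl (double A' B')" using D.A_in_alt unfolding assms(5)[symmetric] by simp
    then show "a \<in> double A' B' q" by (rule D'.alt_monochromatic) (use D.colour[OF a] in simp)
  next
    fix a assume a: "a \<in> double A' B' q"
    then have "a \<in> alt is_Inl (double A B)" using D'.A_in_alt unfolding assms(5) by simp
    then show "a \<in> double A B q" by (rule D.alt_monochromatic) (use D'.colour[OF a] in simp)
  qed
  from this[of True] this[of False] show ?thesis by (simp add: double_def inj_image_eq_iff inj_wmap)
qed

lemma num'_double:
  assumes x: "x \<in> genus_elems (free_group S) m" and y: "y \<in> genus_elems (free_group S) n"
  shows "wmap Inl x \<otimes>\<^bsub>free_group (S <+> S)\<^esub> wmap Inr y \<in> genus_elems (free_group (S <+> S)) (m + n)"
      (is "?z \<in> genus_elems ?X _")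
    and "num' (free_group S) x * num' (free_group S) y
      \<le> num' (free_group (S <+> S)) (wmap Inl x \<otimes>\<^bsub>free_group (S <+> S)\<^esub> wmap Inr y)"
proof -
  let ?S = "free_group S"
  interpret X: group ?X by (rule group_free_group)
  interpret S: group ?S by (rule group_free_group)
  have hom: "wmap Inl \<in> hom ?S ?X" "wmap Inr \<in> hom ?S ?X" by (auto intro!: wmap_hom)
  have xy: "x \<in> carrier ?S" "y \<in> carrier ?S"
    using x y S.is_cp_closed by (auto simp: genus_elems_def)
  have red: "reduced (wmap Inl x :: ('a + 'a) letter list)" "reduced (wmap Inr y :: ('a + 'a) letter list)"
    using xy by (auto intro!: reduced_wmap simp: free_group_carrier)
  have z: "?z = nf (wmap Inl x @ wmap Inr y)" using red(2) by (simp add: free_group_mult_nf)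
  show zg: "?z \<in> genus_elems ?X (m + n)" unfolding genus_elems_def
  proof (intro CollectI conjI allI impI)
    show "is_cp ?X (m + n) ?z"
      by (rule X.is_cp_mult[OF is_cp_hom[OF group_free_group group_free_group hom(1)]
            is_cp_hom[OF group_free_group group_free_group hom(2)]])
        (use x y in \<open>simp_all add: genus_elems_def\<close>)
    fix k assume "is_cp ?X k ?z"
    then have "is_cp FU k (nf (wmap Inl x @ wmap Inr y))"
      unfolding z by (rule is_cp_free_group_mono) simp
    moreover have "fst ` set (wmap Inl x :: ('a + 'a) letter list) \<inter> fst ` set (wmap Inr y) = {}"
      unfolding set_wmap by auto
    ultimately obtain m' n' where mn: "m' + n' \<le> k"
      "is_cp FU m' (nf (wmap Inl x :: ('a + 'a) letter list))"
      "is_cp FU n' (nf (wmap Inr y :: ('a + 'a) letter list))" using is_cp_additive by blast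
    have "m \<le> m'" "n \<le> n'"
      using is_cp_wmap_inj[OF _ mn(2) xy(1)] is_cp_wmap_inj[OF _ mn(3) xy(2)] x y
      by (auto simp: genus_elems_def)
    then show "m + n \<le> k" using mn(1) by simp
  qed
  have sub: "subgroup A ?S" if "A \<in> images ?S g w" for A g w
    using that by (auto simp: images_def admissible_rep_def primitive_subgroup_def)
  show "num' ?S x * num' ?S y \<le> num' ?X ?z"
    unfolding num'_eq[OF S.is_group x] num'_eq[OF S.is_group y] num'_eq[OF X.is_group zg]
      ecard_times[symmetric]
  proof (rule ecard_le)
    show "inj_on (\<lambda>(A, B). alt is_Inl (double A B)) (images ?S m x \<times> images ?S n y)"
    proof (rule inj_onI, clarify)
      fix A B A' B' assume im: "A \<in> images ?S m x" "B \<in> images ?S n y" "A' \<in> images ?S m x"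
        "B' \<in> images ?S n y" and eq: "alt is_Inl (double A B) = alt is_Inl (double A' B')"
      show "A = A' \<and> B = B'"
        by (rule double_inject[OF sub[OF im(1)] sub[OF im(2)] sub[OF im(3)] sub[OF im(4)] eq])
    qed
    show "(\<lambda>(A, B). alt is_Inl (double A B)) ` (images ?S m x \<times> images ?S n y)
        \<subseteq> images ?X (m + n) ?z"
    proof
      fix C assume "C \<in> (\<lambda>(A, B). alt is_Inl (double A B)) ` (images ?S m x \<times> images ?S n y)"
      then obtain h1 h2 where h: "admissible_rep ?S m x h1" "admissible_rep ?S n y h2"
        "C = alt is_Inl (double (h1 ` carrier (surface_group m)) (h2 ` carrier (surface_group n)))"
        by (auto simp: images_def)
      show "C \<in> images ?X (m + n) ?z"
        using admissible_rep_double[OF h(1,2)] unfolding images_def h(3) by blast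
    qed
  qed
qed

text \<open>Conjugation by \<open>g\<close> is the identity once it fixes all generators; this is
  applied first to a generator and then to an arbitrary element. It is what turns noncommutativity
  into two different generators.\<close>

lemma free_group_commutative:
  assumes "\<forall>x\<in>S. \<forall>y\<in>S. x = y"
    and "v \<in> carrier (free_group S)" "w \<in> carrier (free_group S)"
  shows "v \<otimes>\<^bsub>free_group S\<^esub> w = w \<otimes>\<^bsub>free_group S\<^esub> v"
proof -
  let ?S = "free_group S"
  interpret group ?S by (rule group_free_group)
  have conj: "(\<lambda>w. g \<otimes>\<^bsub>?S\<^esub> w \<otimes>\<^bsub>?S\<^esub> inv\<^bsub>?S\<^esub> g) \<in> hom ?S ?S" if "g \<in> carrier ?S" for g
    using that by (auto simp: hom_def m_assoc inv_solve_left)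
  have id: "(\<lambda>w. w) \<in> hom ?S ?S" by (simp add: hom_def)
  have step: "g \<otimes>\<^bsub>?S\<^esub> u = u \<otimes>\<^bsub>?S\<^esub> g"
    if g: "g \<in> carrier ?S" and u: "u \<in> carrier ?S"
      and c: "\<And>x. x \<in> S \<Longrightarrow> g \<otimes>\<^bsub>?S\<^esub> free_gen x = free_gen x \<otimes>\<^bsub>?S\<^esub> g" for g u
  proof -
    have "g \<otimes>\<^bsub>?S\<^esub> u \<otimes>\<^bsub>?S\<^esub> inv\<^bsub>?S\<^esub> g = u"
    proof (rule free_group_extend_unique[OF group_free_group conj[OF g] id _ u])
      fix x assume x: "x \<in> S"
      show "g \<otimes>\<^bsub>?S\<^esub> free_gen x \<otimes>\<^bsub>?S\<^esub> inv\<^bsub>?S\<^esub> g = free_gen x"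
        unfolding c[OF x] using g free_gen_carrier[OF x] by (simp add: m_assoc)
    qed
    then show ?thesis using g u by (metis inv_solve_right m_closed)
  qed
  have gen: "free_gen x \<otimes>\<^bsub>?S\<^esub> u = u \<otimes>\<^bsub>?S\<^esub> free_gen x" if x: "x \<in> S" and u: "u \<in> carrier ?S" for x u
  proof (rule step[OF free_gen_carrier[OF x] u])
    fix y assume "y \<in> S"
    then have "y = x" using assms(1) x by blast
    then show "free_gen x \<otimes>\<^bsub>?S\<^esub> free_gen y = free_gen y \<otimes>\<^bsub>?S\<^esub> free_gen x" by simp
  qed
  show ?thesis by (rule step[OF assms(2,3)]) (rule gen[OF _ assms(2), symmetric])
qed

lemma comm_group_iso:
  assumes "group G" "\<phi> \<in> iso G K" "\<And>x y. x \<in> carrier K \<Longrightarrow> y \<in> carrier K \<Longrightarrow> x \<otimes>\<^bsub>K\<^esub> y = y \<otimes>\<^bsub>K\<^esub> x"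
  shows "comm_group G"
proof -
  interpret group G by fact
  have \<phi>: "\<phi> \<in> hom G K" "inj_on \<phi> (carrier G)"
    using assms(2) by (auto simp: iso_def bij_betw_def)
  show ?thesis
  proof (rule group_comm_groupI)
    fix x y assume xy: "x \<in> carrier G" "y \<in> carrier G"
    have "\<phi> (x \<otimes>\<^bsub>G\<^esub> y) = \<phi> (y \<otimes>\<^bsub>G\<^esub> x)"
      using xy assms(3) hom_in_carrier[OF \<phi>(1)] by (simp add: hom_mult[OF \<phi>(1)])
    then show "x \<otimes>\<^bsub>G\<^esub> y = y \<otimes>\<^bsub>G\<^esub> x" using xy inj_onD[OF \<phi>(2)] by simp
  qed
qed

section \<open>Supermultiplicativity\<close>

lemma num'_mult_le_f_hat':
  assumes S: "finite S" "\<alpha> \<in> S" "\<beta> \<in> S" "\<alpha> \<noteq> \<beta>"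
    and x: "x \<in> genus_elems (free_group S) m" and y: "y \<in> genus_elems (free_group S) n"
  shows "num' (free_group S) x * num' (free_group S) y \<le> f_hat' (free_group S) (m + n)"
proof -
  let ?X = "free_group (S <+> S)"
  define z where "z = wmap Inl x \<otimes>\<^bsub>?X\<^esub> wmap Inr y"
  have z: "z \<in> genus_elems ?X (m + n)" unfolding z_def by (rule num'_double(1)[OF x y])
  have zX: "z \<in> carrier ?X"
    using z group.is_cp_closed[OF group_free_group] by (auto simp: genus_elems_def)
  have zI: "fst ` set z \<subseteq> S <+> S" "nf z = z"
    using zX by (auto simp: free_group_carrier nf_reduced)
  have "finite (S <+> S)" using S(1) by simp
  from finite_imp_inj_to_nat_seg[OF this] obtain idx :: "'a + 'a \<Rightarrow> nat" and N
    where idx: "idx ` (S <+> S) = {i. i < N}" "inj_on idx (S <+> S)" by (elim exE conjE)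
  \<comment> \<open>Large enough for \<open>is_cp_decode\<close> at every genus below
    \<open>m + n\<close>. The code may depend on \<open>z\<close>, since only the genus of
    \<open>z\<close> has to be preserved.\<close>
  define K where "K = 3 * (4 * (m + n) + length z) + 1"
  interpret block_code \<alpha> \<beta> "S <+> S" idx N K by unfold_locales (use S(4) idx in auto)
  note hom = code_hom_hom[OF S(2,3)]
  have "m + n \<le> k" if "is_cp (free_group S) k (code_hom S z)" for k
  proof (rule ccontr)
    assume k: "\<not> m + n \<le> k"
    have "is_cp FU k (nf z)"
    proof (rule is_cp_decode)
      show "is_cp (free_group S) k (nf (enc z))" using that code_hom_enc[OF S(2,3) zI(1)] by simp
    qed (use zI(1) k in \<open>auto simp: K_def\<close>)
    then have "is_cp ?X k z" using zX by (auto simp: zI(2) intro: is_cp_free_group_restrict)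
    then show False using z k by (auto simp: genus_elems_def)
  qed
  moreover have "is_cp (free_group S) (m + n) (code_hom S z)"
    using z is_cp_hom[OF group_free_group group_free_group hom] by (auto simp: genus_elems_def)
  ultimately have cz: "code_hom S z \<in> genus_elems (free_group S) (m + n)"
    by (simp add: genus_elems_def)
  have "num' (free_group S) x * num' (free_group S) y \<le> num' ?X z"
    unfolding z_def by (rule num'_double(2)[OF x y])
  also have "\<dots> \<le> num' (free_group S) (code_hom S z)"
    by (rule num'_transfer[OF group_free_group group_free_group hom
        code_hom_embedding[OF S(2,3)] z cz])
  also have "\<dots> \<le> f_hat' (free_group S) (m + n)"
    by (rule num'_le_f_hat'[OF group_free_group cz])
  finally show ?thesis .
qed

lemma enat_Sup_attained:
  fixes A :: "enat set"
  assumes "A \<noteq> {}" "Sup A \<noteq> \<infinity>"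
  shows "Sup A \<in> A"
proof -
  have "finite A" using assms by (auto simp: Sup_enat_def split: if_splits)
  then show ?thesis using assms(1) by (simp add: Sup_enat_def)
qed

text \<open>A finite supremum of a nonempty set in \<open>enat\<close> is attained. If
  \<open>c\<close> is finite and both suprema are nonzero, multiplying by a fixed nonzero value of
  the other function bounds each of them by \<open>c\<close>, so both are attained.\<close>

lemma enat_SUP_mult_le:
  fixes f :: "'a \<Rightarrow> enat" and g :: "'b \<Rightarrow> enat"
  assumes le: "\<And>x y. x \<in> A \<Longrightarrow> y \<in> B \<Longrightarrow> f x * g y \<le> c"
  shows "(SUP x\<in>A. f x) * (SUP y\<in>B. g y) \<le> c"
proof (cases "A = {} \<or> B = {}")
  case True
  then show ?thesis by (auto simp: bot_enat_def)
next
  case False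
  show ?thesis
  proof (cases "(SUP x\<in>A. f x) = 0 \<or> (SUP y\<in>B. g y) = 0")
    case True
    then show ?thesis by auto
  next
    case ne: False
    then obtain x0 y0 where xy: "x0 \<in> A" "f x0 \<noteq> 0" "y0 \<in> B" "g y0 \<noteq> 0"
      by (metis SUP_least ile0_eq order_refl)
    show ?thesis
    proof (cases "c = \<infinity>")
      case c: False
      have 1: "1 \<le> f x0" "1 \<le> g y0" using xy by (simp_all add: ileI1 one_eSuc)
      have "f x \<le> c" if "x \<in> A" for x
        using mult_left_mono[OF 1(2), of "f x"] le[OF that xy(3)] by (metis mult.right_neutral order_trans zero_le)
      then have "(SUP x\<in>A. f x) \<le> c" by (rule SUP_least)
      then have "Sup (f ` A) \<in> f ` A" using c False by (intro enat_Sup_attained) auto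
      then obtain x where x: "x \<in> A" "(SUP x\<in>A. f x) = f x" by auto
      have "g y \<le> c" if "y \<in> B" for y
        using mult_right_mono[OF 1(1), of "g y"] le[OF xy(1) that] by (metis mult.left_neutral order_trans zero_le)
      then have "(SUP y\<in>B. g y) \<le> c" by (rule SUP_least)
      then have "Sup (g ` B) \<in> g ` B" using c False by (intro enat_Sup_attained) auto
      then obtain y where y: "y \<in> B" "(SUP y\<in>B. g y) = g y" by auto
      show ?thesis using le[OF x(1) y(1)] x(2) y(2) by simp
    qed simp
  qed
qed

section \<open>Two genus one subgroups with the same boundary\<close>

lemma surface_gens_one: "surface_gens 1 = {SA 1, SB 1}" by (auto simp: surface_gens_def)

text \<open>It suffices that evaluation at coordinate 0 sends \<open>u\<close> and \<open>v\<close>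
  to the basis of the surface group, by \<open>wreath_retraction\<close>. The vanishing shift on the
  image is recorded to tell subgroups apart.\<close>

lemma genus_one_rep:
  assumes u: "u \<in> carrier (free_group S)" and v: "v \<in> carrier (free_group S)" and ab: "two_letters \<alpha> \<beta>"
    and \<pi>: "\<And>j. \<pi> j \<in> carrier (free_group (surface_gens 1))"
    and w: "\<Theta> = eval_word (wreath (free_group (surface_gens 1)))
      (two_letters.wreath_gen \<alpha> \<beta> (free_group (surface_gens 1)) \<pi>)"
    and ev: "snd (\<Theta> u) = 0" "fst (\<Theta> u) 0 = free_gen (SA 1)"
      "snd (\<Theta> v) = 0" "fst (\<Theta> v) 0 = free_gen (SB 1)"
  shows "\<exists>h. admissible_rep (free_group S) 1 (nf (u @ v @ winv u @ winv v)) h \<and>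
    u \<in> h ` carrier (surface_group 1) \<and> v \<in> h ` carrier (surface_group 1) \<and>
    (\<forall>t \<in> h ` carrier (surface_group 1). snd (\<Theta> t) = 0)"
proof -
  let ?S = "free_group S"
  interpret S: group ?S by (rule group_free_group)
  define f where "f y = (if y = SA 1 then u else if y = SB 1 then v else [])" for y
  have f: "f y \<in> carrier ?S" for y using u v by (simp add: f_def free_group_carrier[of "[]"])
  define h where "h = eval_word ?S f"
  have hom: "h \<in> hom (free_group (surface_gens 1)) ?S"
    unfolding h_def by (rule eval_word_hom[OF group_free_group f])
  have gen: "h (free_gen y) = f y" for y unfolding h_def by (rule eval_word_gen[OF group_free_group f])
  have \<Theta>: "\<Theta> \<in> hom ?S (wreath (free_group (surface_gens 1)))"
    unfolding w by (rule eval_word_hom[OF group_wreath[OF group_free_group]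
          two_letters.wreath_gen_closed[OF ab group_free_group \<pi>]])
  have g: "snd (\<Theta> (h (free_gen y))) = 0 \<and> fst (\<Theta> (h (free_gen y))) 0 = free_gen y"
    if "y \<in> surface_gens 1" for y
    using that ev unfolding surface_gens_one by (auto simp: gen f_def)
  note wr = wreath_retraction[OF hom \<Theta> g]
  have "genus_rep ?S 1 (nf (u @ v @ winv u @ winv v)) h"
    unfolding genus_rep_iff[OF group_free_group] using hom u v S.commutator_closed[OF u v]
    by (simp add: surface_group_eq gen f_def commutator_free_group)
  then have adm: "admissible_rep ?S 1 (nf (u @ v @ winv u @ winv v)) h"
    using wr(1,2) by (simp add: admissible_rep_def surface_group_eq)
  have "h (free_gen y) \<in> h ` carrier (surface_group 1)" if "y \<in> surface_gens 1" for y
    unfolding surface_group_eq by (rule imageI, rule free_gen_carrier[OF that])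
  from this[of "SA 1"] this[of "SB 1"] have "u \<in> h ` carrier (surface_group 1)"
      "v \<in> h ` carrier (surface_group 1)"
    unfolding surface_gens_one by (simp_all add: gen f_def)
  with adm wr(3) show ?thesis by (auto simp: surface_group_eq)
qed

text \<open>With \<open>A = a\<^sup>-\<^sup>1\<close> and \<open>B = b\<^sup>-\<^sup>1\<close> one has \<open>[ABabAbaB, a] = [ABabAba, BabABAba]\<close>. In the free basis of
  conjugates of \<open>a\<close> by powers of \<open>b\<close> the first pair is part of a basis, and in the free basis of
  conjugates of \<open>b\<close> by powers of \<open>a\<close> so is the second pair. The exponent of \<open>a\<close> distinguishes
  the two subgroups.\<close>

lemma f_hat'_one:
  assumes S: "\<alpha> \<in> S" "\<beta> \<in> S" "\<alpha> \<noteq> \<beta>"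
  shows "2 \<le> f_hat' (free_group S) 1"
proof -
  let ?a = "(\<alpha>, False)" and ?A = "(\<alpha>, True)" and ?b = "(\<beta>, False)" and ?B = "(\<beta>, True)"
  let ?S = "free_group S" and ?H = "free_group (surface_gens 1)"
  define u where "u = [?A, ?B, ?a, ?b, ?A, ?b, ?a, ?B]"
  define u' where "u' = [?A, ?B, ?a, ?b, ?A, ?b, ?a]"
  define v' where "v' = [?B, ?a, ?b, ?A, ?B, ?A, ?b, ?a]"
  define x where "x = nf (u @ [?a] @ winv u @ winv [?a])"
  have x': "x = nf (u' @ v' @ winv u' @ winv v')"
    using S(3) by (simp add: x_def u_def u'_def v'_def nf_Cons letter_inv_def)
  have car: "u \<in> carrier ?S" "[?a] \<in> carrier ?S" "u' \<in> carrier ?S" "v' \<in> carrier ?S"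
    using S by (auto simp: u_def u'_def v'_def free_group_carrier reduced_Cons letter_inv_def)
  have xne: "x \<noteq> []" using S(3) by (simp add: x_def u_def nf_Cons letter_inv_def)
  interpret S: group ?S by (rule group_free_group)
  have "is_cp ?S 1 x" using S.commutator_one_is_cp[OF car(1,2)] commutator_free_group[OF car(1,2)]
    by (simp add: x_def)
  moreover have "1 \<le> k" if "is_cp ?S k x" for k
    using that xne by (cases k) (auto simp: free_group_one elim: is_cp.cases)
  ultimately have xg: "x \<in> genus_elems ?S 1" by (simp add: genus_elems_def)
  let ?p = "(SA 1, False)" and ?q = "(SB 1, False)"
  \<comment> \<open>Let \<open>a_j\<close> be the conjugate of \<open>a\<close> by
    \<open>b^j\<close>. Then \<open>u\<close> is \<open>a_0^-1 a_-1 a_0^-1 a_1\<close>, and as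
    \<open>\<pi> (-1)\<close> is empty its value is \<open>q^-1 q^-1 (q q p) = p\<close>.\<close>
  define \<pi> where "\<pi> j = (if j = 0 then [?q] else if j = 1 then [?q, ?q, ?p] else [])" for j :: int
  \<comment> \<open>With the roles of the letters exchanged, let \<open>b_j\<close> be the conjugate
    of \<open>b\<close> by \<open>a^j\<close>. Then \<open>u'\<close> is
    \<open>b_-1^-1 b_0 b_-1\<close> with value \<open>p\<close>, and \<open>v'\<close> is
    \<open>b_0^-1 b_1 b_0^-1 b_-1\<close> with value \<open>p^-1 (p q p) p^-1 = q\<close>.\<close>
  define \<pi>' where "\<pi>' j = (if j = 0 then [?p] else if j = 1 then [?p, ?q, ?p] else [])" for j :: int
  have \<pi>: "\<pi> j \<in> carrier ?H" "\<pi>' j \<in> carrier ?H" for j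
    unfolding surface_gens_one
    by (auto simp: \<pi>_def \<pi>'_def free_group_carrier reduced_Cons letter_inv_def)
  define \<Theta> where "\<Theta> = eval_word (wreath ?H) (two_letters.wreath_gen \<alpha> \<beta> ?H \<pi>)"
  define \<Theta>' where "\<Theta>' = eval_word (wreath ?H) (two_letters.wreath_gen \<beta> \<alpha> ?H \<pi>')"
  have ab: "two_letters \<alpha> \<beta>" and ba: "two_letters \<beta> \<alpha>"
    using S(3) by (simp_all add: two_letters_def)
  note we = two_letters.we_Cons[where H = ?H and \<pi> = \<pi>, OF ab group_free_group \<pi>(1), folded \<Theta>_def]
    two_letters.we_Nil[where H = ?H and \<pi> = \<pi>, OF ab group_free_group \<pi>(1), folded \<Theta>_def]
  note we' = two_letters.we_Cons[where H = ?H and \<pi> = \<pi>', OF ba group_free_group \<pi>(2), folded \<Theta>'_def]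
    two_letters.we_Nil[where H = ?H and \<pi> = \<pi>', OF ba group_free_group \<pi>(2), folded \<Theta>'_def]
  have inv: "inv\<^bsub>?H\<^esub> (\<pi> j) = winv (\<pi> j)" "inv\<^bsub>?H\<^esub> (\<pi>' j) = winv (\<pi>' j)" for j
    using \<pi> by (simp_all add: free_group_inv)
  have ev: "snd (\<Theta> u) = 0" "fst (\<Theta> u) 0 = free_gen (SA 1)"
      "snd (\<Theta> [?a]) = 0" "fst (\<Theta> [?a]) 0 = free_gen (SB 1)" unfolding u_def we inv
    by (simp_all add: \<pi>_def free_group_mult free_group_one letter_inv_def free_gen_def)
  have ev': "snd (\<Theta>' u') = 0" "fst (\<Theta>' u') 0 = free_gen (SA 1)"
      "snd (\<Theta>' v') = 0" "fst (\<Theta>' v') 0 = free_gen (SB 1)"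
    unfolding u'_def v'_def we' inv
    by (simp_all add: \<pi>'_def free_group_mult free_group_one letter_inv_def free_gen_def)
  obtain h where h: "admissible_rep ?S 1 x h" "[?a] \<in> h ` carrier (surface_group 1)"
    using genus_one_rep[OF car(1,2) ab \<pi>(1) \<Theta>_def ev] unfolding x_def by blast
  obtain h' where h': "admissible_rep ?S 1 x h'"
      "\<forall>t \<in> h' ` carrier (surface_group 1). snd (\<Theta>' t) = 0"
    using genus_one_rep[OF car(3,4) ba \<pi>(2) \<Theta>'_def ev'] unfolding x' by blast
  have "snd (\<Theta>' [?a]) \<noteq> 0" by (simp add: we')
  then have "[?a] \<notin> h' ` carrier (surface_group 1)" using h'(2) by blast
  then have ne: "h ` carrier (surface_group 1) \<noteq> h' ` carrier (surface_group 1)"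
    using h(2) by blast
  have "2 = ecard {h ` carrier (surface_group 1), h' ` carrier (surface_group 1)}"
    using ne by (simp add: ecard_def numeral_eq_enat)
  also have "\<dots> \<le> ecard (images ?S 1 x)"
    by (rule ecard_le[of id]) (use h(1) h'(1) in \<open>auto simp: images_def\<close>)
  finally have "2 \<le> num' ?S x" by (simp only: num'_eq[OF S.is_group xg])
  also have "\<dots> \<le> f_hat' ?S 1" by (rule num'_le_f_hat'[OF S.is_group xg])
  finally show ?thesis .
qed

theorem theorem1p12:
  fixes F :: "('a, 'b) monoid_scheme" and S :: "'c set"
  assumes "group F"
    and "finite S" and "F \<cong> free_group S"
    and "\<not> comm_group F"
  shows "f_hat' F 1 \<ge> 2 \<and>
         (\<forall>m n :: nat. m \<ge> 1 \<longrightarrow> n \<ge> 1 \<longrightarrow> f_hat' F (m + n) \<ge> f_hat' F m * f_hat' F n)"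
proof -
  interpret F: group F by fact
  obtain \<phi> where \<phi>: "\<phi> \<in> iso F (free_group S)" using assms(3) by (auto simp: is_iso_def)
  have \<psi>: "inv_into (carrier F) \<phi> \<in> iso (free_group S) F" by (rule F.iso_set_sym[OF \<phi>])
  have eq: "f_hat' F g = f_hat' (free_group S) g" for g
    by (intro antisym f_hat'_iso_le[OF assms(1) group_free_group \<phi>]
        f_hat'_iso_le[OF group_free_group assms(1) \<psi>])
  have "\<not> (\<forall>x\<in>S. \<forall>y\<in>S. x = y)"
    using comm_group_iso[OF assms(1) \<phi>] free_group_commutative[of S] assms(4) by blast
  then obtain \<alpha> \<beta> where S: "\<alpha> \<in> S" "\<beta> \<in> S" "\<alpha> \<noteq> \<beta>" by blast
  have "f_hat' (free_group S) m * f_hat' (free_group S) n \<le> f_hat' (free_group S) (m + n)" for m n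
    unfolding f_hat'_eq[OF group_free_group, of S m] f_hat'_eq[OF group_free_group, of S n]
    by (rule enat_SUP_mult_le) (rule num'_mult_le_f_hat'[OF assms(2) S])
  then show ?thesis using f_hat'_one[OF S] by (simp add: eq)
qed

end
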